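(* Assume that the density function $f:\mathcal{D}\to\mathbb{R}$ satisfies $\|f\|_{\mathcal{V}(\rho)}:=\sup_{u\in\mathcal{V}(\rho)}|f(t+u)|<\infty$. Assume further that the domain $\mathcal{D}$ satisfies the following property: there exists a positive real constant $b\in(0,\infty)$, not depending on $n$, such that $$\min_{\gamma=(m,h)\in\Gamma_n}(h^m)^{-b}\lambda_\gamma\ge 1.$$ Define, for any $\gamma\in\Gamma_n$, $$\mathbb{B}_\gamma=\max_{\gamma'\in\Gamma_n,\ \gamma'\preceq\gamma}\left|\mathsf{E}\{\hat f_{\gamma'}(t)\}-f(t)\right|,\qquad \mathbb{U}_\gamma^\star=r_\gamma\{v_\gamma^\star,\mathrm{pen}(\gamma)\},\qquad v_\gamma^\star=\left(\frac{W_h\sqrt{D_m}}{\lambda_\gamma}\right)^2\frac{\|f\|_{\mathcal{V}(\rho)}}{nh^dW_h}.$$ Then, as $n\to\infty$, the adaptive estimator $\hat f(t)=\hat f_{\hat\gamma}(t)$ satisfies $$R_n(\hat f,f)\le\min_{\gamma\in\Gamma_n}\left[5\,\mathbb{B}_\gamma+\left\{3+2\sqrt{(\delta-1)/\|f\|_{\mathcal{V}(\rho)}}\right\}\mathbb{U}_\gamma^\star\right]+\mathcal{O}\left\{\sqrt{\frac{(\log n)^d}{n}}\right\}.$$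
   Context: Setting. Let $d\in\mathbb{N}=\{1,2,\dots\}$ and let $\mathcal{D}$ be the closure of a nonempty open subset of $\mathbb{R}^d$, where $\mathbb{R}^d$ carries the sup norm $\|\cdot\|_\infty$. Fix $t\in\mathcal{D}$, put $\Delta=[-1,1]^d$ and, for $h>0$, $\mathcal{V}(h)=\{u\in\mathbb{R}^d: t+u\in\mathcal{D},\ \|u\|_\infty\le h\}$. Fix $\rho\in(0,e^{-1}]$ such that $\mathcal{V}(\rho)$ is a neighborhood of the origin for the topology on the (translated) domain $\mathcal{D}-t$ inherited from $\mathbb{R}^d$. Let $X,X_1,\dots,X_n$ be i.i.d. random variables supported on $\mathcal{D}$ with density $f$ with respect to Lebesgue measure; $\mathsf{E}$ is the corresponding expectation. The pointwise risk of an estimator $\tilde f$ is $R_n(\tilde f,f)=(\mathsf{E}[\{\tilde f(t)-f(t)\}^2])^{1/2}$. The notation $u_n=\mathcal{O}(v_n)$ means $\limsup_{n\to\infty}|u_n/v_n|<\infty$. Local polynomial estimators. For $\alpha\in\mathbb{N}_0^d$, $|\alpha|=\sum_j\alpha_j$ and $\varphi_\alpha(u)=\prod_{j=1}^d u_j^{\alpha_j}$; $D_m=\binom{m+d}{d}$. $\Gamma=\mathbb{N}_0\times(0,\rho]$. For $\gamma=(m,h)\in\Gamma$: $K=\mathbf{1}_\Delta$, $w_h(u)=h^{-d}K(h^{-1}u)\mathbf{1}_{\mathcal{D}}(t+u)$, $W_h=\int_{\mathbb{R}^d}w_h(u)\,du$; $\Phi_\gamma(u)=(\varphi_\alpha(u/h))_{|\alpha|\le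 m}$ as a column vector of length $D_m$ (graded by $|\alpha|$, lexicographic order within each degree); $\mathcal{B}_\gamma=\int\Phi_\gamma(u)\Phi_\gamma^\top(u)w_h(u)\,du$ (symmetric positive definite), with smallest eigenvalue $\lambda_\gamma>0$; $\mathcal{B}_\gamma^{1/2}$ is the lower triangular Cholesky factor of $\mathcal{B}_\gamma$; $H_\gamma(u)=\mathcal{B}_\gamma^{-1/2}\Phi_\gamma(u)$; and $\hat f_\gamma(t)=\frac1n\sum_{i=1}^n H_\gamma^\top(0)H_\gamma(X_i-t)w_h(X_i-t)$. Selection procedure. Fix $\delta>1$. Set $h_\ell=\rho\exp(-\ell)$ for $\ell\in\mathbb{N}$, and (for each $n$) let $(m_\ell)_{\ell\in\mathbb{N}}$ be a nonincreasing sequence of integers in $\{0,1,\dots,\lfloor\log n\rfloor\}$. Let $\mathcal{L}_n=\{1\le\ell\le\lfloor\log n\rfloor: nh_\ell^dW_{h_\ell}\ge(\log n)^3\}$ and $\Gamma_n=\{(m_\ell,h_\ell):\ell\in\mathcal{L}_n\}$ (nonempty for $n$ large). For $\gamma=(m,h)\in\Gamma_n$ put $$\hat v_\gamma=\frac1{n^2}\sum_{i=1}^n\{H_\gamma^\top(0)H_\gamma(X_i-t)w_h(X_i-t)\}^2,\quad c_\gamma=\frac{\sqrt{D_m}}{nh^d\lambda_\gamma},\quad \varepsilon_\gamma=\frac{(\delta-1)D_mW_h}{nh^d\lambda_\gamma^2},\quad \Lambda_\gamma=2|\log\lambda_\gamma|,$$ $$r_\gamma(v,x)=\sqrt{2vx}+c_\gamma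 x\ \ (v,x\ge0),\qquad \mathrm{pen}(\gamma)=d\delta|\log h|+\Lambda_\gamma,\qquad \hat{\mathbb{U}}_\gamma=r_\gamma\{\hat v_\gamma+\varepsilon_\gamma,\mathrm{pen}(\gamma)\}.$$ Order $\Gamma_n$ by $(m_\ell,h_\ell)\preceq(m_{\ell'},h_{\ell'})$ iff $h_\ell\le h_{\ell'}$, and let $\gamma\vee\gamma'$ be the maximum for this total order. With $(x)_+=\max\{x,0\}$, put $$\hat A_\gamma=\max_{\gamma'\in\Gamma_n}\left\{|\hat f_{\gamma\vee\gamma'}(t)-\hat f_{\gamma'}(t)|-\hat{\mathbb{U}}_{\gamma\vee\gamma'}-\hat{\mathbb{U}}_{\gamma'}\right\}_+,\qquad \hat\gamma=\mathop{\mathrm{arg\,min}}_{\gamma\in\Gamma_n}(\hat A_\gamma+\hat{\mathbb{U}}_\gamma),\qquad \hat f(t)=\hat f_{\hat\gamma}(t).$$ *)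

theory Defs
  imports
    "HOL-Probability.Probability"
    "HOL-Library.Landau_Symbols"
    "Jordan_Normal_Form.Spectral_Radius"
    "Jordan_Normal_Form.Gauss_Jordan_Elimination"
begin

text \<open>
  The space \<open>\<real>\<^sup>d\<close> is \<open>real^'d\<close> with \<open>d = CARD('d)\<close>; the linear order on the index type is the order
  of the coordinates and enters only through the lexicographic order on multi-indices.  The
  matrices attached to \<open>\<gamma> = (m, h)\<close> have a size depending on \<open>m\<close> and are therefore taken from
  \<open>Jordan_Normal_Form\<close>.
\<close>

text \<open>Abbreviating \<open>real^'d\<close>, which would force the sort \<open>finite\<close> at every occurrence.\<close>

type_synonym 'd rvec = "(real, 'd) Finite_Cartesian_Product.vec"

subsection \<open>Multi-indices and monomials\<close>

definition mi_degree :: "('d::finite \<Rightarrow> nat) \<Rightarrow> nat" where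
  "mi_degree \<alpha> = (\<Sum>j\<in>UNIV. \<alpha> j)"

definition mi_monom :: "('d::finite \<Rightarrow> nat) \<Rightarrow> 'd rvec \<Rightarrow> real" where
  "mi_monom \<alpha> u = (\<Prod>j\<in>UNIV. vec_nth u j ^ \<alpha> j)"

definition mi_less :: "('d::{finite,linorder} \<Rightarrow> nat) \<Rightarrow> ('d \<Rightarrow> nat) \<Rightarrow> bool" where
  "mi_less \<alpha> \<beta> \<longleftrightarrow> mi_degree \<alpha> < mi_degree \<beta> \<or>
     (mi_degree \<alpha> = mi_degree \<beta> \<and> (\<exists>j. \<alpha> j < \<beta> j \<and> (\<forall>i<j. \<alpha> i = \<beta> i)))"

text \<open>
  The order \<open>mi_less\<close> is a strict total order and there are finitely many multi-indices of degree
  at most \<open>m\<close>, so the following enumeration exists, is unique and has no repetitions.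
\<close>

definition multi_indices :: "nat \<Rightarrow> ('d::{finite,linorder} \<Rightarrow> nat) list" where
  "multi_indices m = (THE \<alpha>s. sorted_wrt mi_less \<alpha>s \<and> set \<alpha>s = {\<alpha>. mi_degree \<alpha> \<le> m})"

definition Dm :: "'d::finite itself \<Rightarrow> nat \<Rightarrow> nat" where
  "Dm _ m = (m + CARD('d)) choose CARD('d)"

subsection \<open>Local polynomial estimators\<close>

definition nbhd :: "'d::finite rvec set \<Rightarrow> 'd rvec \<Rightarrow> real \<Rightarrow> 'd rvec set" where
  "nbhd D t h = {u. t + u \<in> D \<and> infnorm u \<le> h}"

definition cube :: "'d::finite rvec set" where
  "cube = {u. \<forall>j. - 1 \<le> vec_nth u j \<and> vec_nth u j \<le> 1}"

definition weight :: "'d::finite rvec set \<Rightarrow> 'd rvec \<Rightarrow> real \<Rightarrow> 'd rvec \<Rightarrow> real" where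
  "weight D t h u = (1 / h ^ CARD('d)) * indicator cube ((1 / h) *\<^sub>R u) * indicator D (t + u)"

definition Wh :: "'d::finite rvec set \<Rightarrow> 'd rvec \<Rightarrow> real \<Rightarrow> real" where
  "Wh D t h = (\<integral>u. weight D t h u \<partial>lborel)"

definition Phi :: "nat \<times> real \<Rightarrow> 'd::{finite,linorder} rvec \<Rightarrow> real Matrix.vec" where
  "Phi = (\<lambda>(m, h) u.
     Matrix.vec (Dm TYPE('d) m) (\<lambda>i. mi_monom (multi_indices m ! i) ((1 / h) *\<^sub>R u)))"

definition gram :: "'d::{finite,linorder} rvec set \<Rightarrow> 'd rvec \<Rightarrow> nat \<times> real \<Rightarrow> real mat" where
  "gram D t = (\<lambda>(m, h). mat (Dm TYPE('d) m) (Dm TYPE('d) m)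
     (\<lambda>(i, j). \<integral>u. vec_index (Phi (m, h) u) i * vec_index (Phi (m, h) u) j * weight D t h u \<partial>lborel))"

definition lam :: "'d::{finite,linorder} rvec set \<Rightarrow> 'd rvec \<Rightarrow> nat \<times> real \<Rightarrow> real" where
  "lam D t \<gamma> = Min (spectrum (gram D t \<gamma>))"

definition cholesky :: "real mat \<Rightarrow> real mat" where
  "cholesky A = (THE L. L \<in> carrier_mat (dim_row A) (dim_row A) \<and> upper_triangular (transpose_mat L)
     \<and> (\<forall>i<dim_row A. 0 < L $$ (i, i)) \<and> L * transpose_mat L = A)"

text \<open>
  \<open>mat_inverse\<close> is option-valued; the factor is invertible whenever the Gram matrix is positive
  definite.
\<close>

definition Hvec :: "'d::{finite,linorder} rvec set \<Rightarrow> 'd rvec \<Rightarrow> nat \<times> real \<Rightarrow> 'd rvec \<Rightarrow> real Matrix.vec"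
  where "Hvec D t \<gamma> u = the (mat_inverse (cholesky (gram D t \<gamma>))) *\<^sub>v Phi \<gamma> u"

definition lp_kernel :: "'d::{finite,linorder} rvec set \<Rightarrow> 'd rvec \<Rightarrow> nat \<times> real \<Rightarrow> 'd rvec \<Rightarrow> real" where
  "lp_kernel D t = (\<lambda>(m, h) u.
     scalar_prod (Hvec D t (m, h) 0) (Hvec D t (m, h) u) * weight D t h u)"

text \<open>Statistics are functions of the sample size \<open>n\<close> and of a sample \<open>x 1, \<dots>, x n\<close>.\<close>

definition fhat ::
  "'d::{finite,linorder} rvec set \<Rightarrow> 'd rvec \<Rightarrow> nat \<Rightarrow> (nat \<Rightarrow> 'd rvec) \<Rightarrow> nat \<times> real \<Rightarrow> real" where
  "fhat D t n x \<gamma> = (1 / real n) * (\<Sum>i=1..n. lp_kernel D t \<gamma> (x i - t))"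

subsection \<open>Selection procedure\<close>

definition bandwidth :: "real \<Rightarrow> nat \<Rightarrow> real" where
  "bandwidth \<rho> l = \<rho> * exp (- real l)"

definition levels :: "'d::finite rvec set \<Rightarrow> 'd rvec \<Rightarrow> real \<Rightarrow> nat \<Rightarrow> nat set" where
  "levels D t \<rho> n = {l. 1 \<le> l \<and> l \<le> nat \<lfloor>ln (real n)\<rfloor> \<and>
     real n * bandwidth \<rho> l ^ CARD('d) * Wh D t (bandwidth \<rho> l) \<ge> ln (real n) ^ 3}"

definition Gam ::
  "'d::finite rvec set \<Rightarrow> 'd rvec \<Rightarrow> real \<Rightarrow> (nat \<Rightarrow> nat) \<Rightarrow> nat \<Rightarrow> (nat \<times> real) set" where
  "Gam D t \<rho> m n = (\<lambda>l. (m l, bandwidth \<rho> l)) ` levels D t \<rho> n"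

text \<open>
  On \<open>Gam D t \<rho> m n\<close> the second component determines the first one, so comparing bandwidths is a
  total order there.
\<close>

definition gle :: "nat \<times> real \<Rightarrow> nat \<times> real \<Rightarrow> bool" where
  "gle \<gamma> \<gamma>' \<longleftrightarrow> snd \<gamma> \<le> snd \<gamma>'"

definition gmax :: "nat \<times> real \<Rightarrow> nat \<times> real \<Rightarrow> nat \<times> real" where
  "gmax \<gamma> \<gamma>' = (if gle \<gamma> \<gamma>' then \<gamma>' else \<gamma>)"

definition vhat ::
  "'d::{finite,linorder} rvec set \<Rightarrow> 'd rvec \<Rightarrow> nat \<Rightarrow> (nat \<Rightarrow> 'd rvec) \<Rightarrow> nat \<times> real \<Rightarrow> real" where
  "vhat D t n x \<gamma> = (1 / (real n)\<^sup>2) * (\<Sum>i=1..n. (lp_kernel D t \<gamma> (x i - t))\<^sup>2)"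

definition cpar :: "'d::{finite,linorder} rvec set \<Rightarrow> 'd rvec \<Rightarrow> nat \<Rightarrow> nat \<times> real \<Rightarrow> real" where
  "cpar D t n = (\<lambda>(m, h).
     sqrt (real (Dm TYPE('d) m)) / (real n * h ^ CARD('d) * lam D t (m, h)))"

definition epspar :: "'d::{finite,linorder} rvec set \<Rightarrow> 'd rvec \<Rightarrow> real \<Rightarrow> nat \<Rightarrow> nat \<times> real \<Rightarrow> real" where
  "epspar D t \<delta> n = (\<lambda>(m, h).
     ((\<delta> - 1) * real (Dm TYPE('d) m) * Wh D t h) / (real n * h ^ CARD('d) * (lam D t (m, h))\<^sup>2))"

definition Lampar :: "'d::{finite,linorder} rvec set \<Rightarrow> 'd rvec \<Rightarrow> nat \<times> real \<Rightarrow> real" where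
  "Lampar D t \<gamma> = 2 * \<bar>ln (lam D t \<gamma>)\<bar>"

definition rfun ::
  "'d::{finite,linorder} rvec set \<Rightarrow> 'd rvec \<Rightarrow> nat \<Rightarrow> nat \<times> real \<Rightarrow> real \<Rightarrow> real \<Rightarrow> real" where
  "rfun D t n \<gamma> v x = sqrt (2 * v * x) + cpar D t n \<gamma> * x"

definition pen :: "'d::{finite,linorder} rvec set \<Rightarrow> 'd rvec \<Rightarrow> real \<Rightarrow> nat \<times> real \<Rightarrow> real" where
  "pen D t \<delta> = (\<lambda>(m, h). real CARD('d) * \<delta> * \<bar>ln h\<bar> + Lampar D t (m, h))"

definition Uhat ::
  "'d::{finite,linorder} rvec set \<Rightarrow> 'd rvec \<Rightarrow> real \<Rightarrow> nat \<Rightarrow> (nat \<Rightarrow> 'd rvec) \<Rightarrow> nat \<times> real \<Rightarrow> real"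
  where "Uhat D t \<delta> n x \<gamma> = rfun D t n \<gamma> (vhat D t n x \<gamma> + epspar D t \<delta> n \<gamma>) (pen D t \<delta> \<gamma>)"

definition Ahat ::
  "'d::{finite,linorder} rvec set \<Rightarrow> 'd rvec \<Rightarrow> real \<Rightarrow> real \<Rightarrow> (nat \<Rightarrow> nat) \<Rightarrow> nat
    \<Rightarrow> (nat \<Rightarrow> 'd rvec) \<Rightarrow> nat \<times> real \<Rightarrow> real" where
  "Ahat D t \<rho> \<delta> m n x \<gamma> = (MAX \<gamma>'\<in>Gam D t \<rho> m n.
     max (\<bar>fhat D t n x (gmax \<gamma> \<gamma>') - fhat D t n x \<gamma>'\<bar>
            - Uhat D t \<delta> n x (gmax \<gamma> \<gamma>') - Uhat D t \<delta> n x \<gamma>') 0)"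

definition crit ::
  "'d::{finite,linorder} rvec set \<Rightarrow> 'd rvec \<Rightarrow> real \<Rightarrow> real \<Rightarrow> (nat \<Rightarrow> nat) \<Rightarrow> nat
    \<Rightarrow> (nat \<Rightarrow> 'd rvec) \<Rightarrow> nat \<times> real \<Rightarrow> real" where
  "crit D t \<rho> \<delta> m n x \<gamma> = Ahat D t \<rho> \<delta> m n x \<gamma> + Uhat D t \<delta> n x \<gamma>"

subsection \<open>Risk, bias and majorant\<close>

definition risk :: "'a measure \<Rightarrow> ('a \<Rightarrow> real) \<Rightarrow> real \<Rightarrow> real" where
  "risk M est v = sqrt (\<integral>\<omega>. (est \<omega> - v)\<^sup>2 \<partial>M)"

text \<open>
  If \<open>fnorm D t \<rho> f = 0\<close>, a quotient \<open>c / fnorm D t \<rho> f\<close> is \<open>0\<close> in HOL instead of \<open>\<infinity>\<close>; an upper bound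
  that is increasing in this quotient is then the stronger one.
\<close>

definition fnorm :: "'d::finite rvec set \<Rightarrow> 'd rvec \<Rightarrow> real \<Rightarrow> ('d rvec \<Rightarrow> real) \<Rightarrow> real" where
  "fnorm D t \<rho> f = (SUP u\<in>nbhd D t \<rho>. \<bar>f (t + u)\<bar>)"

definition bias_maj ::
  "'a measure \<Rightarrow> (nat \<Rightarrow> 'a \<Rightarrow> 'd rvec) \<Rightarrow> ('d rvec \<Rightarrow> real) \<Rightarrow> 'd::{finite,linorder} rvec set
    \<Rightarrow> 'd rvec \<Rightarrow> real \<Rightarrow> (nat \<Rightarrow> nat) \<Rightarrow> nat \<Rightarrow> nat \<times> real \<Rightarrow> real" where
  "bias_maj M X f D t \<rho> m n \<gamma> = (MAX \<gamma>'\<in>{\<gamma>'\<in>Gam D t \<rho> m n. gle \<gamma>' \<gamma>}.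
     \<bar>(\<integral>\<omega>. fhat D t n (\<lambda>i. X i \<omega>) \<gamma>' \<partial>M) - f t\<bar>)"

definition vstar ::
  "('d rvec \<Rightarrow> real) \<Rightarrow> 'd::{finite,linorder} rvec set \<Rightarrow> 'd rvec \<Rightarrow> real \<Rightarrow> nat \<Rightarrow> nat \<times> real \<Rightarrow> real"
  where
  "vstar f D t \<rho> n = (\<lambda>(m, h). (Wh D t h * sqrt (real (Dm TYPE('d) m)) / lam D t (m, h))\<^sup>2
     * (fnorm D t \<rho> f / (real n * h ^ CARD('d) * Wh D t h)))"

definition Ustar ::
  "('d rvec \<Rightarrow> real) \<Rightarrow> 'd::{finite,linorder} rvec set \<Rightarrow> 'd rvec \<Rightarrow> real \<Rightarrow> real \<Rightarrow> nat
    \<Rightarrow> nat \<times> real \<Rightarrow> real" where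
  "Ustar f D t \<rho> \<delta> n \<gamma> = rfun D t n \<gamma> (vstar f D t \<rho> n \<gamma>) (pen D t \<delta> \<gamma>)"

end

theory Submission
  imports Defs "HOL-Real_Asymp.Real_Asymp"
begin

text \<open>
  The estimator with index \<open>\<gamma> = (k, h)\<close> is the sample mean of a kernel that is bounded by
  \<open>n * cpar\<close> and has second moment at most \<open>n * vstar\<close>.  Both bounds come from one fact of linear
  algebra: if \<open>L\<close> is the Cholesky factor of a symmetric matrix with smallest eigenvalue \<open>\<lambda> > 0\<close>,
  then \<open>L\<inverse>\<close> has operator norm at most \<open>1 / sqrt \<lambda>\<close>, so that the scalar product of
  \<open>L\<inverse> \<Phi>(0)\<close> and \<open>L\<inverse> \<Phi>(u)\<close> is at most \<open>\<bar>\<Phi>(0)\<bar> \<bar>\<Phi>(u)\<bar> / \<lambda>\<close>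
  (\<open>inverse_Cholesky_scalar_prod_le\<close>), where \<open>\<bar>\<Phi>(0)\<bar> \<le> 1\<close> and \<open>\<bar>\<Phi>(u)\<bar>\<^sup>2 \<le> Dm\<close> on the cube.

  Let \<open>\<xi>\<close> be the absolute deviation of an estimator from its mean, and let \<open>Z\<close> be any random number
  with \<open>\<xi> \<le> Uhat + Z\<close> for all indices of the grid.  Comparing the selected estimator with
  the one of index \<open>\<gamma>\<close> gives, sample by sample (\<open>pairwise_selection_oracle\<close>),
  the bound \<open>5 * bias + \<xi> + 2 * Uhat + 4 * Z\<close> for the error of the selected one.  In the \<open>L\<^sup>2\<close> norm,
  \<open>\<xi>\<close> contributes at most \<open>sqrt vstar \<le> Ustar\<close> and \<open>Uhat\<close> at most
  \<open>(1 + sqrt ((\<delta> - 1) / \<parallel>f\<parallel>)) * Ustar\<close>.  Keeping one of the three stochastic terms equal to \<open>\<xi>\<close>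
  instead of bounding it by \<open>Uhat + Z\<close> is what gives the factor \<open>3 + 2 sqrt ((\<delta> - 1) / \<parallel>f\<parallel>)\<close>
  (\<open>risk_le_oracle\<close>).

  For \<open>Z\<^sup>2\<close> the sum of the squared excesses of \<open>\<xi>\<close> over \<open>Uhat\<close> is taken.  A Bernstein bound controls
  the excess over the threshold built from the true second moment, enlarged by \<open>epspar / 2\<close>, by
  \<open>exp (- pen)\<close> times a variance, and the empirical second moment falls below the true one by more than \<open>epspar / 2\<close> only with probability
  \<open>exp (- \<kappa> n h\<^sup>d W)\<close> (\<open>empirical_Bernstein_excess\<close>).  Since \<open>exp (- pen) \<le> h\<^sup>d \<lambda>\<^sup>2 exp (- (\<delta> - 1) l)\<close>
  at level \<open>l\<close>, the first contributions add up geometrically to \<open>O((log n)\<^sup>d / n)\<close>.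
  The second ones are multiplied by the squared sup bound of the kernel, which the assumption on \<open>\<lambda>\<close>
  bounds by \<open>exp (O((log n)\<^sup>2))\<close>, and \<open>n h\<^sup>d W \<ge> (log n)\<^sup>3\<close> makes them negligible
  (\<open>sum_excess_le\<close>).

  If \<open>f\<close> vanishes on the neighbourhood, the risk is \<open>0\<close> (\<open>risk_eq_0_if_fnorm_0\<close>); this case
  is separate because the quotient by \<open>\<parallel>f\<parallel>\<close> is then \<open>0\<close> as well.
\<close>

section \<open>Inequalities for the exponential\<close>

text \<open>
  The sub-gamma bound behind Bernstein's inequality.
\<close>

lemma exp_le_quadratic:
  fixes y c :: real
  assumes "\<bar>y\<bar> \<le> c" "c < 1"
  shows "exp y \<le> 1 + y + y\<^sup>2 / (2 * (1 - c))"
proof -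
  obtain t where t: "\<bar>t\<bar> \<le> \<bar>y\<bar>"
    and e: "exp y = (\<Sum>k<2. y ^ k / fact k) + exp t / fact 2 * y ^ 2"
    using Maclaurin_exp_le[of y 2] by auto
  have "exp t * (1 - c) \<le> exp t * (1 + (- t))"
    using t assms by (intro mult_left_mono) auto
  also have "\<dots> \<le> exp t * exp (- t)"
    by (intro mult_left_mono exp_ge_add_one_self) auto
  finally have "exp t \<le> 1 / (1 - c)"
    using assms by (simp add: exp_minus field_simps)
  then have "exp t * y\<^sup>2 \<le> 1 / (1 - c) * y\<^sup>2"
    by (intro mult_right_mono) auto
  also have "\<dots> = 2 * (y\<^sup>2 / (2 * (1 - c)))"
    using assms by (simp add: divide_simps)
  finally have "exp t / 2 * y\<^sup>2 \<le> y\<^sup>2 / (2 * (1 - c))" by (simp add: mult.commute)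
  then show ?thesis
    unfolding e by (simp add: eval_nat_numeral)
qed

lemma exp_minus_le_quadratic:
  fixes y :: real
  assumes "0 \<le> y"
  shows "exp (- y) \<le> 1 - y + y\<^sup>2 / 2"
proof -
  have lo: "1 + y + y\<^sup>2 / 2 \<le> exp y"
    using assms by (rule exp_lower_Taylor_quadratic)
  have pos: "0 < 1 + y + y\<^sup>2 / 2"
    using assms by (simp add: add_pos_nonneg)
  have "(1 - y + y\<^sup>2 / 2) * (1 + y + y\<^sup>2 / 2) = 1 + y ^ 4 / 4"
    by (simp add: field_simps power2_eq_square power4_eq_xxxx)
  also have "\<dots> \<ge> 1" by simp
  finally have "1 / (1 + y + y\<^sup>2 / 2) \<le> 1 - y + y\<^sup>2 / 2"
    using pos by (simp add: divide_le_eq)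
  moreover have "exp (- y) \<le> 1 / (1 + y + y\<^sup>2 / 2)"
    using lo pos by (simp add: exp_minus inverse_eq_divide frac_le)
  ultimately show ?thesis by linarith
qed

lemma square_le_exp:
  fixes y :: real
  assumes "0 \<le> y"
  shows "y\<^sup>2 \<le> 2 * exp y"
  using exp_lower_Taylor_quadratic[OF assms] assms by linarith

section \<open>The \<open>L\<^sup>2\<close> norm\<close>

text \<open>
  The square root of the second moment of a real function on a measure space.  Without square
  integrability the Bochner integral, and hence the norm, is \<open>0\<close>.
\<close>

definition L2norm :: "'a measure \<Rightarrow> ('a \<Rightarrow> real) \<Rightarrow> real" where
  "L2norm M Y = sqrt (\<integral>\<omega>. (Y \<omega>)\<^sup>2 \<partial>M)"

text \<open>
  Minkowski's inequality.  For \<open>a, b > 0\<close> one has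
  \<open>(Y + Z)\<^sup>2 \<le> (1 + b / a) Y\<^sup>2 + (1 + a / b) Z\<^sup>2\<close>; integrate this with \<open>a\<close> and \<open>b\<close> slightly
  above the two norms.
\<close>

lemma L2norm_add_le:
  assumes Y: "integrable M (\<lambda>\<omega>. (Y \<omega>)\<^sup>2)" and Z: "integrable M (\<lambda>\<omega>. (Z \<omega>)\<^sup>2)"
  shows "L2norm M (\<lambda>\<omega>. Y \<omega> + Z \<omega>) \<le> L2norm M Y + L2norm M Z"
proof (rule field_le_epsilon)
  fix e :: real assume e: "0 < e"
  define a b where "a = L2norm M Y + e / 2" and "b = L2norm M Z + e / 2"
  have ab: "0 < a" "0 < b"
    using e by (auto simp: a_def b_def L2norm_def intro!: add_nonneg_pos)
  have Ya: "(\<integral>\<omega>. (Y \<omega>)\<^sup>2 \<partial>M) \<le> a\<^sup>2"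
    using e by (intro sqrt_le_D) (simp add: a_def L2norm_def)
  have Zb: "(\<integral>\<omega>. (Z \<omega>)\<^sup>2 \<partial>M) \<le> b\<^sup>2"
    using e by (intro sqrt_le_D) (simp add: b_def L2norm_def)
  have pt: "(Y \<omega> + Z \<omega>)\<^sup>2 \<le> (1 + b / a) * (Y \<omega>)\<^sup>2 + (1 + a / b) * (Z \<omega>)\<^sup>2" for \<omega>
  proof -
    have "0 \<le> (b * Y \<omega> - a * Z \<omega>)\<^sup>2 / (a * b)" using ab by simp
    also have "\<dots> = (1 + b / a) * (Y \<omega>)\<^sup>2 + (1 + a / b) * (Z \<omega>)\<^sup>2 - (Y \<omega> + Z \<omega>)\<^sup>2"
      using ab by (simp add: field_simps power2_eq_square)
    finally show ?thesis by simp
  qed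
  have "(\<integral>\<omega>. (Y \<omega> + Z \<omega>)\<^sup>2 \<partial>M)
      \<le> (\<integral>\<omega>. (1 + b / a) * (Y \<omega>)\<^sup>2 + (1 + a / b) * (Z \<omega>)\<^sup>2 \<partial>M)"
    using Y Z pt ab by (intro integral_mono') (auto intro!: add_nonneg_nonneg)
  also have "\<dots> = (1 + b / a) * (\<integral>\<omega>. (Y \<omega>)\<^sup>2 \<partial>M) + (1 + a / b) * (\<integral>\<omega>. (Z \<omega>)\<^sup>2 \<partial>M)"
    using Y Z by simp
  also have "\<dots> \<le> (1 + b / a) * a\<^sup>2 + (1 + a / b) * b\<^sup>2"
    using ab Ya Zb by (intro add_mono mult_left_mono) auto
  also have "\<dots> = (a + b)\<^sup>2"
    using ab by (simp add: field_simps power2_eq_square)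
  finally have "L2norm M (\<lambda>\<omega>. Y \<omega> + Z \<omega>) \<le> a + b"
    unfolding L2norm_def using ab by (intro real_le_lsqrt) auto
  then show "L2norm M (\<lambda>\<omega>. Y \<omega> + Z \<omega>) \<le> L2norm M Y + L2norm M Z + e"
    by (simp add: a_def b_def)
qed

lemma L2norm_cmult: "L2norm M (\<lambda>\<omega>. a * Y \<omega>) = \<bar>a\<bar> * L2norm M Y"
  by (simp add: L2norm_def power_mult_distrib real_sqrt_mult)

text \<open>
  The smaller function need not be measurable.
\<close>

lemma L2norm_mono:
  assumes "integrable M (\<lambda>\<omega>. (Z \<omega>)\<^sup>2)" "\<And>\<omega>. \<omega> \<in> space M \<Longrightarrow> \<bar>Y \<omega>\<bar> \<le> Z \<omega>"
  shows "L2norm M Y \<le> L2norm M Z"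
  unfolding L2norm_def
proof (intro real_sqrt_le_mono integral_mono'[OF assms(1)])
  show "(Y \<omega>)\<^sup>2 \<le> (Z \<omega>)\<^sup>2" if "\<omega> \<in> space M" for \<omega>
    using power_mono[OF assms(2)[OF that], of 2] by simp
qed simp

lemma (in prob_space) L2norm_const: "L2norm M (\<lambda>_. a) = \<bar>a\<bar>"
  by (simp add: L2norm_def prob_space)

lemma square_add_integrable:
  fixes Y Z :: "'a \<Rightarrow> real"
  assumes [measurable]: "Y \<in> borel_measurable M" "Z \<in> borel_measurable M"
    and "integrable M (\<lambda>\<omega>. (Y \<omega>)\<^sup>2)" "integrable M (\<lambda>\<omega>. (Z \<omega>)\<^sup>2)"
  shows "integrable M (\<lambda>\<omega>. (Y \<omega> + Z \<omega>)\<^sup>2)"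
proof (rule Bochner_Integration.integrable_bound)
  show "integrable M (\<lambda>\<omega>. 2 * (Y \<omega>)\<^sup>2 + 2 * (Z \<omega>)\<^sup>2)" using assms by simp
  have "(Y \<omega> + Z \<omega>)\<^sup>2 \<le> 2 * (Y \<omega>)\<^sup>2 + 2 * (Z \<omega>)\<^sup>2" for \<omega>
    using zero_le_power2[of "Y \<omega> - Z \<omega>"] by (simp add: power2_sum power2_diff)
  then show "AE \<omega> in M. norm ((Y \<omega> + Z \<omega>)\<^sup>2) \<le> norm (2 * (Y \<omega>)\<^sup>2 + 2 * (Z \<omega>)\<^sup>2)"
    by (intro AE_I2) simp
qed measurable

section \<open>Deviation bounds for sample means\<close>

context prob_space
begin

lemma integrable_bounded:
  fixes g :: "'a \<Rightarrow> real"
  assumes "g \<in> borel_measurable M" "\<And>\<omega>. \<omega> \<in> space M \<Longrightarrow> \<bar>g \<omega>\<bar> \<le> B"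
  shows "integrable M g"
  using assms by (intro integrable_const_bound[of _ B]) auto

lemma integral_le_const:
  fixes g :: "'a \<Rightarrow> real"
  assumes "g \<in> borel_measurable M" "\<And>\<omega>. \<omega> \<in> space M \<Longrightarrow> \<bar>g \<omega>\<bar> \<le> B"
    and "\<And>\<omega>. \<omega> \<in> space M \<Longrightarrow> g \<omega> \<le> C"
  shows "expectation g \<le> C"
proof -
  have "expectation g \<le> expectation (\<lambda>_. C)"
    using integrable_bounded[OF assms(1,2)] assms(3) by (intro integral_mono) auto
  then show ?thesis by (simp add: prob_space)
qed

lemma exp_moment_sum_le:
  fixes Y :: "nat \<Rightarrow> 'a \<Rightarrow> real"
  assumes ind: "indep_vars (\<lambda>_. borel) Y {1..n}"
    and B: "\<And>i \<omega>. i \<in> {1..n} \<Longrightarrow> \<omega> \<in> space M \<Longrightarrow> \<bar>Y i \<omega>\<bar> \<le> B"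
    and a: "\<And>i. i \<in> {1..n} \<Longrightarrow> expectation (\<lambda>\<omega>. exp (s * Y i \<omega>)) \<le> exp a"
  shows "expectation (\<lambda>\<omega>. exp (s * (\<Sum>i=1..n. Y i \<omega>))) \<le> exp (real n * a)"
proof -
  have meas [measurable]: "Y i \<in> borel_measurable M" if "i \<in> {1..n}" for i
    using ind that by (auto simp: indep_vars_def)
  have ind': "indep_vars (\<lambda>_. borel) (\<lambda>i \<omega>. exp (s * Y i \<omega>)) {1..n}"
    using indep_vars_compose2[OF ind, of "\<lambda>_ y. exp (s * y)" "\<lambda>_. borel"] by simp
  have int: "integrable M (\<lambda>\<omega>. exp (s * Y i \<omega>))" if i: "i \<in> {1..n}" for i
  proof (rule integrable_bounded[where B = "exp (\<bar>s\<bar> * B)"])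
    show "(\<lambda>\<omega>. exp (s * Y i \<omega>)) \<in> borel_measurable M"
      using meas[OF i] by simp
    fix \<omega> assume "\<omega> \<in> space M"
    then have "\<bar>s * Y i \<omega>\<bar> \<le> \<bar>s\<bar> * B"
      unfolding abs_mult using B[OF i] by (intro mult_left_mono) auto
    then show "\<bar>exp (s * Y i \<omega>)\<bar> \<le> exp (\<bar>s\<bar> * B)" by simp
  qed
  have "expectation (\<lambda>\<omega>. exp (s * (\<Sum>i=1..n. Y i \<omega>)))
      = expectation (\<lambda>\<omega>. \<Prod>i=1..n. exp (s * Y i \<omega>))"
    by (simp add: sum_distrib_left exp_sum)
  also have "\<dots> = (\<Prod>i=1..n. expectation (\<lambda>\<omega>. exp (s * Y i \<omega>)))"
    using ind' int by (intro indep_vars_lebesgue_integral) auto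
  also have "\<dots> \<le> (\<Prod>i=1..n. exp a)"
    using a by (intro prod_mono) auto
  finally show ?thesis by (simp add: exp_of_nat_mult)
qed

text \<open>
  Here \<open>n * v\<close> bounds the second moments, not the variances, of the summands, so that \<open>v\<close> bounds the
  variance of the sample mean.
\<close>

lemma Bernstein_exp_moment:
  fixes Y :: "nat \<Rightarrow> 'a \<Rightarrow> real"
  assumes n: "0 < n" and ind: "indep_vars (\<lambda>_. borel) Y {1..n}"
    and B: "\<And>i \<omega>. i \<in> {1..n} \<Longrightarrow> \<omega> \<in> space M \<Longrightarrow> \<bar>Y i \<omega>\<bar> \<le> B"
    and mean: "\<And>i. i \<in> {1..n} \<Longrightarrow> expectation (Y i) = \<mu>"
    and var: "\<And>i. i \<in> {1..n} \<Longrightarrow> expectation (\<lambda>\<omega>. (Y i \<omega>)\<^sup>2) \<le> real n * v"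
    and c: "B / real n * \<bar>s\<bar> < 1"
  shows "expectation (\<lambda>\<omega>. exp (s * ((\<Sum>i=1..n. Y i \<omega>) / real n - \<mu>)))
    \<le> exp (v * s\<^sup>2 / (2 * (1 - B / real n * \<bar>s\<bar>)))"
proof -
  define q where "q = B / real n * \<bar>s\<bar>"
  define u where "u = s / real n"
  have meas [measurable]: "Y i \<in> borel_measurable M" if "i \<in> {1..n}" for i
    using ind that by (auto simp: indep_vars_def)
  have one: "expectation (\<lambda>\<omega>. exp (u * Y i \<omega>)) \<le> exp (u * \<mu> + v * s\<^sup>2 / (2 * (1 - q)) / real n)"
    if i: "i \<in> {1..n}" for i
  proof -
    note [measurable] = meas[OF i]
    have iY: "integrable M (Y i)" using B[OF i] by (intro integrable_bounded) auto
    have iY2: "integrable M (\<lambda>\<omega>. (Y i \<omega>)\<^sup>2)"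
      using B[OF i] by (intro integrable_bounded[where B = "B\<^sup>2"]) (auto simp flip: abs_le_square_iff
        intro!: power_mono[of "\<bar>_\<bar>" B 2, simplified])
    have "expectation (\<lambda>\<omega>. exp (u * Y i \<omega>))
        \<le> expectation (\<lambda>\<omega>. 1 + u * Y i \<omega> + u\<^sup>2 / (2 * (1 - q)) * (Y i \<omega>)\<^sup>2)"
    proof (rule integral_mono')
      show "integrable M (\<lambda>\<omega>. 1 + u * Y i \<omega> + u\<^sup>2 / (2 * (1 - q)) * (Y i \<omega>)\<^sup>2)"
        using iY iY2 by simp
      fix \<omega> assume "\<omega> \<in> space M"
      then have "\<bar>u * Y i \<omega>\<bar> \<le> \<bar>s\<bar> / real n * B"
        unfolding abs_mult u_def using B[OF i] by (intro mult_mono) auto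
      also have "\<dots> = q" by (simp add: q_def)
      finally have "exp (u * Y i \<omega>) \<le> 1 + u * Y i \<omega> + (u * Y i \<omega>)\<^sup>2 / (2 * (1 - q))"
        using c by (intro exp_le_quadratic) (auto simp: q_def)
      then show "exp (u * Y i \<omega>) \<le> 1 + u * Y i \<omega> + u\<^sup>2 / (2 * (1 - q)) * (Y i \<omega>)\<^sup>2"
        by (simp add: power_mult_distrib)
      then show "0 \<le> 1 + u * Y i \<omega> + u\<^sup>2 / (2 * (1 - q)) * (Y i \<omega>)\<^sup>2"
        by (rule order_trans[rotated]) simp
    qed
    also have "\<dots> = 1 + u * \<mu> + u\<^sup>2 / (2 * (1 - q)) * expectation (\<lambda>\<omega>. (Y i \<omega>)\<^sup>2)"
      using iY iY2 mean[OF i] by (simp add: prob_space)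
    also have "\<dots> \<le> 1 + u * \<mu> + u\<^sup>2 / (2 * (1 - q)) * (real n * v)"
      using var[OF i] c by (intro add_left_mono mult_left_mono) (auto simp: q_def)
    also have "u\<^sup>2 / (2 * (1 - q)) * (real n * v) = v * s\<^sup>2 / (2 * (1 - q)) / real n"
      using n by (simp add: u_def power2_eq_square mult_ac)
    also have "1 + u * \<mu> + v * s\<^sup>2 / (2 * (1 - q)) / real n
        = 1 + (u * \<mu> + v * s\<^sup>2 / (2 * (1 - q)) / real n)"
      by simp
    also have "\<dots> \<le> exp (u * \<mu> + v * s\<^sup>2 / (2 * (1 - q)) / real n)"
      by (rule exp_ge_add_one_self)
    finally show ?thesis .
  qed
  have "expectation (\<lambda>\<omega>. exp (s * ((\<Sum>i=1..n. Y i \<omega>) / real n - \<mu>)))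
      = expectation (\<lambda>\<omega>. exp (u * (\<Sum>i=1..n. Y i \<omega>)) * exp (- s * \<mu>))"
    by (simp add: u_def right_diff_distrib exp_diff exp_minus divide_inverse mult.assoc
        mult.commute)
  also have "\<dots> = expectation (\<lambda>\<omega>. exp (u * (\<Sum>i=1..n. Y i \<omega>))) * exp (- s * \<mu>)"
    by simp
  also have "\<dots> \<le> exp (real n * (u * \<mu> + v * s\<^sup>2 / (2 * (1 - q)) / real n)) * exp (- s * \<mu>)"
    using exp_moment_sum_le[OF ind B one] by (intro mult_right_mono) auto
  also have "\<dots> = exp (v * s\<^sup>2 / (2 * (1 - q)))"
    using n by (simp add: u_def distrib_left flip: exp_add)
  finally show ?thesis by (simp add: q_def)
qed

text \<open>
  Integrated form of Bernstein's inequality.  Since \<open>y\<^sup>2 \<le> 2 exp y\<close> for \<open>y \<ge> 0\<close>, one exponential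
  moment at the point \<open>s\<close> suffices and no tail integral is needed.
\<close>

lemma Bernstein_excess:
  fixes Y :: "nat \<Rightarrow> 'a \<Rightarrow> real"
  assumes n: "0 < n" and ind: "indep_vars (\<lambda>_. borel) Y {1..n}"
    and B: "\<And>i \<omega>. i \<in> {1..n} \<Longrightarrow> \<omega> \<in> space M \<Longrightarrow> \<bar>Y i \<omega>\<bar> \<le> B"
    and mean: "\<And>i. i \<in> {1..n} \<Longrightarrow> expectation (Y i) = \<mu>"
    and var: "\<And>i. i \<in> {1..n} \<Longrightarrow> expectation (\<lambda>\<omega>. (Y i \<omega>)\<^sup>2) \<le> real n * v"
    and pos: "0 \<le> B" "0 < v" "0 < x"
  defines "c \<equiv> B / real n"
  shows "expectation (\<lambda>\<omega>. (max 0 (\<bar>(\<Sum>i=1..n. Y i \<omega>) / real n - \<mu>\<bar>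
        - (sqrt (2 * v * x) + c * x)))\<^sup>2)
    \<le> 4 * (sqrt (v / (2 * x)) + c)\<^sup>2 * exp (- x)"
proof -
  define r where "r = sqrt (2 * v * x) + c * x"
  define p where "p = sqrt (v / (2 * x)) + c"
  \<comment> \<open>The point that minimises \<open>- s * r\<close> plus the logarithmic moment bound.\<close>
  define s where "s = 1 / p"
  define T where "T = (\<lambda>\<omega>. (\<Sum>i=1..n. Y i \<omega>) / real n - \<mu>)"
  have c0: "0 \<le> c" using pos by (simp add: c_def)
  have w: "0 < sqrt (v / (2 * x))" using pos by simp
  have p: "0 < p" unfolding p_def using w c0 by (rule add_pos_nonneg)
  have s: "0 < s" using p by (simp add: s_def)
  have cs: "1 - c * s = sqrt (v / (2 * x)) * s"
    using p by (simp add: s_def p_def field_simps)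
  then have cs1: "c * s < 1" using w s by (smt (verit) mult_pos_pos)
  have sv: "sqrt (v / (2 * x)) * sqrt (v / (2 * x)) = v / (2 * x)" using pos by simp
  have sx: "sqrt (2 * v * x) = 2 * x * sqrt (v / (2 * x))"
  proof -
    have "2 * v * x = (2 * x)\<^sup>2 * (v / (2 * x))" using pos by (simp add: field_simps power2_eq_square)
    then show ?thesis using pos by (simp only: real_sqrt_mult real_sqrt_abs)
  qed
  have psi: "v * s\<^sup>2 / (2 * (1 - c * s)) = s * (x * sqrt (v / (2 * x)))"
  proof -
    have vW: "v = 2 * x * (W * W)" if "W * W = v / (2 * x)" for W using that pos by simp
    have "v * s\<^sup>2 = (s * (x * W)) * (2 * (W * s))" if "W * W = v / (2 * x)" for W
      unfolding vW[OF that] by (simp add: power2_eq_square)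
    from this[OF sv]
    have "v * s\<^sup>2 = (s * (x * sqrt (v / (2 * x)))) * (2 * (sqrt (v / (2 * x)) * s))" .
    moreover have "2 * (sqrt (v / (2 * x)) * s) \<noteq> 0" using mult_pos_pos[OF w s] by linarith
    ultimately show ?thesis unfolding cs by (metis nonzero_mult_div_cancel_right)
  qed
  have key: "s * (x * sqrt (v / (2 * x))) - s * r = - x"
  proof -
    have "s * r - s * (x * sqrt (v / (2 * x))) = s * (x * p)"
      unfolding r_def sx p_def by (simp add: algebra_simps)
    also have "\<dots> = x" using p by (simp add: s_def)
    finally show ?thesis by simp
  qed
  have meas [measurable]: "Y i \<in> borel_measurable M" if "i \<in> {1..n}" for i
    using ind that by (auto simp: indep_vars_def)
  have measS [measurable]: "(\<lambda>\<omega>. \<Sum>i=1..n. Y i \<omega>) \<in> borel_measurable M"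
    using meas by (intro borel_measurable_sum) auto
  have measT [measurable]: "T \<in> borel_measurable M" unfolding T_def by measurable
  have Tb: "\<bar>T \<omega>\<bar> \<le> B + \<bar>\<mu>\<bar>" if "\<omega> \<in> space M" for \<omega>
  proof -
    have "\<bar>\<Sum>i=1..n. Y i \<omega>\<bar> \<le> (\<Sum>i=1..n. B)"
      using B that by (intro order_trans[OF sum_abs] sum_mono) auto
    then have "\<bar>(\<Sum>i=1..n. Y i \<omega>) / real n\<bar> \<le> B"
      using n by (simp add: field_simps)
    then show ?thesis unfolding T_def by linarith
  qed
  have iexp: "integrable M (\<lambda>\<omega>. exp (u * T \<omega>))" for u
  proof (rule integrable_bounded[where B = "exp (\<bar>u\<bar> * (B + \<bar>\<mu>\<bar>))"])
    fix \<omega> assume "\<omega> \<in> space M"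
    then have "\<bar>u * T \<omega>\<bar> \<le> \<bar>u\<bar> * (B + \<bar>\<mu>\<bar>)"
      unfolding abs_mult using Tb by (intro mult_left_mono) auto
    then show "\<bar>exp (u * T \<omega>)\<bar> \<le> exp (\<bar>u\<bar> * (B + \<bar>\<mu>\<bar>))" by simp
  qed measurable
  have mgf: "expectation (\<lambda>\<omega>. exp (u * T \<omega>)) \<le> exp (s * (x * sqrt (v / (2 * x))))"
    if u: "\<bar>u\<bar> = s" for u
  proof -
    have u2: "u\<^sup>2 = s\<^sup>2" using u by (metis power2_abs)
    show ?thesis
      using Bernstein_exp_moment[OF n ind B mean var, of u] u cs1
      unfolding T_def u u2 c_def[symmetric] psi by simp
  qed
  have pt: "(max 0 (\<bar>T \<omega>\<bar> - r))\<^sup>2 \<le> 2 * p\<^sup>2 * exp (- (s * r)) * (exp (s * T \<omega>) + exp (- s * T \<omega>))"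
    (is "?l \<le> ?r") for \<omega>
  proof (cases "r \<le> \<bar>T \<omega>\<bar>")
    case True
    have "(s * (\<bar>T \<omega>\<bar> - r))\<^sup>2 \<le> 2 * exp (s * (\<bar>T \<omega>\<bar> - r))"
      using True s by (intro square_le_exp) auto
    also have "exp (s * (\<bar>T \<omega>\<bar> - r)) = exp (- (s * r)) * exp (s * \<bar>T \<omega>\<bar>)"
      by (simp add: algebra_simps flip: exp_add)
    also have "exp (s * \<bar>T \<omega>\<bar>) \<le> exp (s * T \<omega>) + exp (- s * T \<omega>)"
      by (cases "0 \<le> T \<omega>") auto
    finally have "p\<^sup>2 * (s * (\<bar>T \<omega>\<bar> - r))\<^sup>2
        \<le> p\<^sup>2 * (2 * (exp (- (s * r)) * (exp (s * T \<omega>) + exp (- s * T \<omega>))))"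
      by (simp add: mult_left_mono)
    also have "p\<^sup>2 * (s * (\<bar>T \<omega>\<bar> - r))\<^sup>2 = (\<bar>T \<omega>\<bar> - r)\<^sup>2"
      using p by (simp add: s_def power_mult_distrib power_divide)
    finally show ?thesis using True by (simp add: algebra_simps)
  next
    case False
    then show ?thesis by (simp add: max_def add_nonneg_nonneg)
  qed
  have "expectation (\<lambda>\<omega>. (max 0 (\<bar>T \<omega>\<bar> - r))\<^sup>2)
     \<le> expectation (\<lambda>\<omega>. 2 * p\<^sup>2 * exp (- (s * r)) * (exp (s * T \<omega>) + exp (- s * T \<omega>)))"
    using iexp[of s] iexp[of "- s"] pt by (intro integral_mono') auto
  also have "\<dots> = 2 * p\<^sup>2 * exp (- (s * r)) *
      (expectation (\<lambda>\<omega>. exp (s * T \<omega>)) + expectation (\<lambda>\<omega>. exp (- s * T \<omega>)))"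
    using iexp[of s] iexp[of "- s"] by simp
  also have "\<dots> \<le> 2 * p\<^sup>2 * exp (- (s * r)) *
      (exp (s * (x * sqrt (v / (2 * x)))) + exp (s * (x * sqrt (v / (2 * x)))))"
    using mgf[of s] mgf[of "- s"] s by (intro mult_left_mono add_mono) auto
  also have "\<dots> = 4 * p\<^sup>2 * (exp (s * (x * sqrt (v / (2 * x)))) * exp (- (s * r)))"
    by simp
  also have "\<dots> = 4 * p\<^sup>2 * exp (- x)"
    using key by (simp flip: exp_add)
  finally show ?thesis unfolding T_def r_def p_def .
qed

text \<open>
  Since \<open>exp (- y) \<le> 1 - y + y\<^sup>2 / 2\<close> for \<open>y \<ge> 0\<close>, a sum of squares has a sub-Gaussian lower tail: the
  exponent is quadratic in \<open>\<theta>\<close>, without the restriction on \<open>\<theta>\<close> that the Bernstein bound needs.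
\<close>

lemma empirical_second_moment_lower_tail:
  fixes Y :: "nat \<Rightarrow> 'a \<Rightarrow> real"
  assumes n: "0 < n" and ind: "indep_vars (\<lambda>_. borel) Y {1..n}"
    and B: "\<And>i \<omega>. i \<in> {1..n} \<Longrightarrow> \<omega> \<in> space M \<Longrightarrow> \<bar>Y i \<omega>\<bar> \<le> B"
    and var: "\<And>i. i \<in> {1..n} \<Longrightarrow> expectation (\<lambda>\<omega>. (Y i \<omega>)\<^sup>2) = real n * v"
    and th: "0 \<le> \<theta>" and vle: "v \<le> w"
  shows "expectation (\<lambda>\<omega>. exp (\<theta> * (v - e - (\<Sum>i=1..n. (Y i \<omega>)\<^sup>2) / (real n)\<^sup>2)))
    \<le> exp (\<theta>\<^sup>2 * B\<^sup>2 * w / (2 * (real n)\<^sup>2) - \<theta> * e)"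
proof -
  define u where "u = - \<theta> / (real n)\<^sup>2"
  have meas [measurable]: "Y i \<in> borel_measurable M" if "i \<in> {1..n}" for i
    using ind that by (auto simp: indep_vars_def)
  have ind2: "indep_vars (\<lambda>_. borel) (\<lambda>i \<omega>. (Y i \<omega>)\<^sup>2) {1..n}"
    using indep_vars_compose2[OF ind, of "\<lambda>_ y. y\<^sup>2" "\<lambda>_. borel"] by simp
  have B2: "\<bar>(Y i \<omega>)\<^sup>2\<bar> \<le> B\<^sup>2" if "i \<in> {1..n}" "\<omega> \<in> space M" for i \<omega>
    using B[OF that] by (metis abs_ge_zero abs_power2 power2_abs power_mono)
  have one: "expectation (\<lambda>\<omega>. exp (u * (Y i \<omega>)\<^sup>2))
      \<le> exp ((\<theta>\<^sup>2 * B\<^sup>2 * w / (2 * (real n)\<^sup>2) - \<theta> * v) / real n)"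
    if i: "i \<in> {1..n}" for i
  proof -
    note [measurable] = meas[OF i]
    have iY2: "integrable M (\<lambda>\<omega>. (Y i \<omega>)\<^sup>2)"
      using B2[OF i] by (intro integrable_bounded[where B = "B\<^sup>2"]) auto
    have pt: "exp (u * (Y i \<omega>)\<^sup>2) \<le> 1 + (u + u\<^sup>2 * B\<^sup>2 / 2) * (Y i \<omega>)\<^sup>2"
      if "\<omega> \<in> space M" for \<omega>
    proof -
      have "exp (- (- u * (Y i \<omega>)\<^sup>2)) \<le> 1 - (- u * (Y i \<omega>)\<^sup>2) + (- u * (Y i \<omega>)\<^sup>2)\<^sup>2 / 2"
        using th by (intro exp_minus_le_quadratic) (simp add: u_def)
      also have "(- u * (Y i \<omega>)\<^sup>2)\<^sup>2 = u\<^sup>2 * ((Y i \<omega>)\<^sup>2 * (Y i \<omega>)\<^sup>2)"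
        by (simp add: power_mult_distrib power2_eq_square)
      also have "\<dots> \<le> u\<^sup>2 * (B\<^sup>2 * (Y i \<omega>)\<^sup>2)"
        using B2[OF i that] by (intro mult_left_mono mult_right_mono) auto
      finally show ?thesis by (simp add: algebra_simps)
    qed
    have "expectation (\<lambda>\<omega>. exp (u * (Y i \<omega>)\<^sup>2))
        \<le> expectation (\<lambda>\<omega>. 1 + (u + u\<^sup>2 * B\<^sup>2 / 2) * (Y i \<omega>)\<^sup>2)"
      using iY2 pt by (intro integral_mono') (auto intro: order_trans[OF _ pt])
    also have "\<dots> = 1 + (u + u\<^sup>2 * B\<^sup>2 / 2) * (real n * v)"
      using iY2 var[OF i] by (simp add: prob_space)
    also have "\<dots> = 1 + u * (real n * v) + u\<^sup>2 * B\<^sup>2 / 2 * (real n * v)"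
      by (simp add: algebra_simps)
    also have "\<dots> \<le> 1 + u * (real n * v) + u\<^sup>2 * B\<^sup>2 / 2 * (real n * w)"
      using vle by (intro add_left_mono mult_left_mono) auto
    also have "\<dots> = 1 + (\<theta>\<^sup>2 * B\<^sup>2 * w / (2 * (real n)\<^sup>2) - \<theta> * v) / real n"
      using n by (simp add: u_def power2_eq_square field_simps)
    also have "\<dots> \<le> exp ((\<theta>\<^sup>2 * B\<^sup>2 * w / (2 * (real n)\<^sup>2) - \<theta> * v) / real n)"
      by (rule exp_ge_add_one_self)
    finally show ?thesis .
  qed
  have "expectation (\<lambda>\<omega>. exp (\<theta> * (v - e - (\<Sum>i=1..n. (Y i \<omega>)\<^sup>2) / (real n)\<^sup>2)))
      = expectation (\<lambda>\<omega>. exp (u * (\<Sum>i=1..n. (Y i \<omega>)\<^sup>2)) * exp (\<theta> * (v - e)))"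
    by (intro Bochner_Integration.integral_cong refl)
      (simp add: u_def algebra_simps flip: exp_add)
  also have "\<dots> = expectation (\<lambda>\<omega>. exp (u * (\<Sum>i=1..n. (Y i \<omega>)\<^sup>2))) * exp (\<theta> * (v - e))"
    by simp
  also have "\<dots> \<le> exp (real n * ((\<theta>\<^sup>2 * B\<^sup>2 * w / (2 * (real n)\<^sup>2) - \<theta> * v) / real n))
      * exp (\<theta> * (v - e))"
    using exp_moment_sum_le[OF ind2 B2 one] by (intro mult_right_mono) auto
  also have "\<dots> = exp (\<theta>\<^sup>2 * B\<^sup>2 * w / (2 * (real n)\<^sup>2) - \<theta> * e)"
  proof -
    have cancel: "real n * (y / real n) = y" for y using n by simp
    show ?thesis unfolding cancel by (simp add: algebra_simps flip: exp_add)
  qed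
  finally show ?thesis .
qed

lemma L2norm_sample_mean_le:
  fixes Y :: "nat \<Rightarrow> 'a \<Rightarrow> real"
  assumes n: "0 < n" and ind: "indep_vars (\<lambda>_. borel) Y {1..n}"
    and B: "\<And>i \<omega>. i \<in> {1..n} \<Longrightarrow> \<omega> \<in> space M \<Longrightarrow> \<bar>Y i \<omega>\<bar> \<le> B"
    and mean: "\<And>i. i \<in> {1..n} \<Longrightarrow> expectation (Y i) = \<mu>"
    and var: "\<And>i. i \<in> {1..n} \<Longrightarrow> expectation (\<lambda>\<omega>. (Y i \<omega>)\<^sup>2) \<le> real n * v"
  shows "L2norm M (\<lambda>\<omega>. (\<Sum>i=1..n. Y i \<omega>) / real n - \<mu>) \<le> sqrt v"
proof -
  have meas [measurable]: "Y i \<in> borel_measurable M" if "i \<in> {1..n}" for i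
    using ind that by (auto simp: indep_vars_def)
  define Z where "Z i \<omega> = Y i \<omega> - \<mu>" for i \<omega>
  have indZ: "indep_vars (\<lambda>_. borel) Z {1..n}"
    using indep_vars_compose2[OF ind, of "\<lambda>_ y. y - \<mu>" "\<lambda>_. borel"] by (simp add: Z_def[abs_def])
  have Zb: "\<bar>Z i \<omega>\<bar> \<le> B + \<bar>\<mu>\<bar>" if "i \<in> {1..n}" "\<omega> \<in> space M" for i \<omega>
    using B[OF that] by (auto simp: Z_def)
  have measZ [measurable]: "Z i \<in> borel_measurable M" if "i \<in> {1..n}" for i
    using meas[OF that] by (simp add: Z_def[abs_def])
  have intY: "integrable M (Y i)" if "i \<in> {1..n}" for i
    using meas[OF that] B[OF that] by (rule integrable_bounded)
  have intY2: "integrable M (\<lambda>\<omega>. (Y i \<omega>)\<^sup>2)" if i: "i \<in> {1..n}" for i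
  proof (rule integrable_bounded[where B = "B\<^sup>2"])
    show "\<bar>(Y i \<omega>)\<^sup>2\<bar> \<le> B\<^sup>2" if "\<omega> \<in> space M" for \<omega>
      using B[OF i that] by (metis abs_ge_zero abs_power2 power2_abs power_mono)
  qed (use meas[OF i] in simp)
  have intZ: "integrable M (Z i)" if "i \<in> {1..n}" for i
    using measZ[OF that] Zb[OF that] by (rule integrable_bounded)
  have intZZ: "integrable M (\<lambda>\<omega>. Z i \<omega> * Z j \<omega>)" if ij: "i \<in> {1..n}" "j \<in> {1..n}" for i j
  proof (rule integrable_bounded[where B = "(B + \<bar>\<mu>\<bar>) * (B + \<bar>\<mu>\<bar>)"])
    show "\<bar>Z i \<omega> * Z j \<omega>\<bar> \<le> (B + \<bar>\<mu>\<bar>) * (B + \<bar>\<mu>\<bar>)" if "\<omega> \<in> space M" for \<omega>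
      unfolding abs_mult using Zb[OF ij(1) that] Zb[OF ij(2) that] by (intro mult_mono) auto
  qed (use measZ ij in simp)
  have EZ: "expectation (Z i) = 0" if "i \<in> {1..n}" for i
    using intY[OF that] mean[OF that] by (simp add: Z_def[abs_def] prob_space)
  have diag: "expectation (\<lambda>\<omega>. Z i \<omega> * Z i \<omega>) \<le> real n * v" if i: "i \<in> {1..n}" for i
  proof -
    have "expectation (\<lambda>\<omega>. Z i \<omega> * Z i \<omega>) = expectation (\<lambda>\<omega>. (Y i \<omega>)\<^sup>2 - 2 * \<mu> * Y i \<omega> + \<mu>\<^sup>2)"
      by (simp add: Z_def power2_eq_square algebra_simps)
    also have "\<dots> = expectation (\<lambda>\<omega>. (Y i \<omega>)\<^sup>2) - \<mu>\<^sup>2"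
      using intY[OF i] intY2[OF i] mean[OF i] by (simp add: prob_space power2_eq_square)
    also have "\<dots> \<le> real n * v" using var[OF i] zero_le_power2[of \<mu>] by linarith
    finally show ?thesis .
  qed
  have off: "expectation (\<lambda>\<omega>. Z i \<omega> * Z j \<omega>) = 0" if "i \<in> {1..n}" "j \<in> {1..n}" "i \<noteq> j" for i j
  proof -
    have "indep_vars (\<lambda>_. borel) Z {i, j}" using that by (intro indep_vars_subset[OF indZ]) auto
    then have "expectation (\<lambda>\<omega>. \<Prod>k\<in>{i, j}. Z k \<omega>) = (\<Prod>k\<in>{i, j}. expectation (Z k))"
      using intZ that by (intro indep_vars_lebesgue_integral) auto
    then show ?thesis using that EZ by simp
  qed
  have "expectation (\<lambda>\<omega>. (\<Sum>i=1..n. Z i \<omega>)\<^sup>2)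
      = (\<Sum>i=1..n. \<Sum>j=1..n. expectation (\<lambda>\<omega>. Z i \<omega> * Z j \<omega>))"
  proof -
    have "expectation (\<lambda>\<omega>. (\<Sum>i=1..n. Z i \<omega>)\<^sup>2)
        = (\<Sum>i=1..n. expectation (\<lambda>\<omega>. \<Sum>j=1..n. Z i \<omega> * Z j \<omega>))"
      unfolding power2_eq_square sum_product
      by (intro Bochner_Integration.integral_sum Bochner_Integration.integrable_sum intZZ)
    also have "\<dots> = (\<Sum>i=1..n. \<Sum>j=1..n. expectation (\<lambda>\<omega>. Z i \<omega> * Z j \<omega>))"
      by (intro sum.cong refl Bochner_Integration.integral_sum intZZ)
    finally show ?thesis .
  qed
  also have "\<dots> = (\<Sum>i=1..n. \<Sum>j=1..n. if i = j then expectation (\<lambda>\<omega>. Z i \<omega> * Z i \<omega>) else 0)"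
    using off by (intro sum.cong) auto
  also have "\<dots> = (\<Sum>i=1..n. expectation (\<lambda>\<omega>. Z i \<omega> * Z i \<omega>))" by simp
  also have "\<dots> \<le> (\<Sum>i=1..n. real n * v)" using diag by (intro sum_mono) auto
  also have "\<dots> = (real n)\<^sup>2 * v" by (simp add: power2_eq_square)
  finally have sq: "expectation (\<lambda>\<omega>. (\<Sum>i=1..n. Z i \<omega>)\<^sup>2) \<le> (real n)\<^sup>2 * v" .
  have "(\<Sum>i=1..n. Y i \<omega>) / real n - \<mu> = (\<Sum>i=1..n. Z i \<omega>) / real n" for \<omega>
    using n by (simp add: Z_def sum_subtractf field_simps)
  then have "expectation (\<lambda>\<omega>. ((\<Sum>i=1..n. Y i \<omega>) / real n - \<mu>)\<^sup>2)
      = expectation (\<lambda>\<omega>. (\<Sum>i=1..n. Z i \<omega>)\<^sup>2) / (real n)\<^sup>2"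
    by (simp add: power_divide)
  also have "\<dots> \<le> v" using sq n by (simp add: field_simps)
  finally show ?thesis by (simp add: L2norm_def)
qed

text \<open>
  The threshold uses the empirical second moment enlarged by \<open>e\<close>.  Either this is at least
  \<open>v + e / 2\<close>, and the deterministic threshold applies, or the empirical second moment is
  too small, and the excess is bounded trivially by \<open>2 * B\<close>.
\<close>

lemma empirical_Bernstein_excess:
  fixes Y :: "nat \<Rightarrow> 'a \<Rightarrow> real"
  assumes n: "0 < n" and ind: "indep_vars (\<lambda>_. borel) Y {1..n}"
    and B: "\<And>i \<omega>. i \<in> {1..n} \<Longrightarrow> \<omega> \<in> space M \<Longrightarrow> \<bar>Y i \<omega>\<bar> \<le> B"
    and mean: "\<And>i. i \<in> {1..n} \<Longrightarrow> expectation (Y i) = \<mu>"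
    and var: "\<And>i. i \<in> {1..n} \<Longrightarrow> expectation (\<lambda>\<omega>. (Y i \<omega>)\<^sup>2) = real n * v"
    and pos: "0 < B" "v \<le> w" "0 < w" "0 < e" "1 \<le> x"
  defines "c \<equiv> B / real n"
  shows "expectation (\<lambda>\<omega>. (max 0 (\<bar>(\<Sum>i=1..n. Y i \<omega>) / real n - \<mu>\<bar>
      - (sqrt (2 * ((\<Sum>i=1..n. (Y i \<omega>)\<^sup>2) / (real n)\<^sup>2 + e) * x) + c * x)))\<^sup>2)
    \<le> 4 * (w + e + 2 * c\<^sup>2) * exp (- x) + 4 * B\<^sup>2 * exp (- (e\<^sup>2 * (real n)\<^sup>2 / (8 * B\<^sup>2 * w)))"
proof -
  define T where "T = (\<lambda>\<omega>. (\<Sum>i=1..n. Y i \<omega>) / real n - \<mu>)"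
  define V where "V = (\<lambda>\<omega>. (\<Sum>i=1..n. (Y i \<omega>)\<^sup>2) / (real n)\<^sup>2)"
  \<comment> \<open>Adding \<open>e / 2\<close> also makes the variance proxy positive when \<open>v = 0\<close>.\<close>
  define v' where "v' = v + e / 2"
  define r where "r = sqrt (2 * v' * x) + c * x"
  \<comment> \<open>The minimiser of the exponent of the lower tail bound with \<open>e / 2\<close> in place of \<open>e\<close>.\<close>
  define \<theta> where "\<theta> = e * (real n)\<^sup>2 / (2 * B\<^sup>2 * w)"
  have meas [measurable]: "Y i \<in> borel_measurable M" if "i \<in> {1..n}" for i
    using ind that by (auto simp: indep_vars_def)
  have c0: "0 \<le> c" using pos by (simp add: c_def)
  have "0 \<le> real n * v" by (subst var[of 1, symmetric]) (use n in auto)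
  then have v0: "0 \<le> v" using n by (simp add: zero_le_mult_iff)
  then have v': "0 < v'" using pos by (simp add: v'_def)
  have \<theta>: "0 \<le> \<theta>" using pos by (simp add: \<theta>_def)
  have measT [measurable]: "T \<in> borel_measurable M"
    unfolding T_def using meas by (intro borel_measurable_diff borel_measurable_divide borel_measurable_sum) auto
  have measV [measurable]: "V \<in> borel_measurable M"
    unfolding V_def using meas by (intro borel_measurable_divide borel_measurable_sum borel_measurable_power) auto
  have V0: "0 \<le> V \<omega>" for \<omega> by (auto simp: V_def intro!: divide_nonneg_nonneg sum_nonneg)
  have mu: "\<bar>\<mu>\<bar> \<le> B"
  proof -
    have 1: "(1::nat) \<in> {1..n}" using n by simp
    have "expectation (Y 1) \<le> B"
      using meas[OF 1] B[OF 1] by (intro integral_le_const[where B = B]) (auto simp: abs_le_iff)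
    moreover have "expectation (\<lambda>\<omega>. - Y 1 \<omega>) \<le> B"
      using meas[OF 1] B[OF 1] by (intro integral_le_const[where B = B]) (auto simp: abs_le_iff)
    ultimately show ?thesis using mean[OF 1] by (simp add: abs_le_iff)
  qed
  have Tb: "\<bar>T \<omega>\<bar> \<le> 2 * B" if "\<omega> \<in> space M" for \<omega>
  proof -
    have "\<bar>\<Sum>i=1..n. Y i \<omega>\<bar> \<le> (\<Sum>i=1..n. B)"
      using B that by (intro order_trans[OF sum_abs] sum_mono) auto
    then have "\<bar>(\<Sum>i=1..n. Y i \<omega>) / real n\<bar> \<le> B"
      using n by (simp add: field_simps)
    then show ?thesis using mu unfolding T_def by linarith
  qed
  have r0: "0 \<le> r" using v' pos c0 by (auto simp: r_def intro!: add_nonneg_nonneg)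
  have pt: "(max 0 (\<bar>T \<omega>\<bar> - (sqrt (2 * (V \<omega> + e) * x) + c * x)))\<^sup>2
      \<le> (max 0 (\<bar>T \<omega>\<bar> - r))\<^sup>2 + 4 * B\<^sup>2 * exp (\<theta> * (v - e / 2 - V \<omega>))" (is "?l \<le> ?a + ?b")
    if \<omega>: "\<omega> \<in> space M" for \<omega>
  proof (cases "v' \<le> V \<omega> + e")
    case True
    have "sqrt (2 * v' * x) \<le> sqrt (2 * (V \<omega> + e) * x)"
      using True pos by (intro real_sqrt_le_mono mult_right_mono) auto
    then have "?l \<le> ?a" unfolding r_def by (intro power_mono max.mono) auto
    then show ?thesis by (simp add: add_increasing2)
  next
    case False
    have "max 0 (\<bar>T \<omega>\<bar> - (sqrt (2 * (V \<omega> + e) * x) + c * x)) \<le> 2 * B"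
    proof -
      have "0 \<le> sqrt (2 * (V \<omega> + e) * x) + c * x"
        using V0[of \<omega>] pos c0 by (intro add_nonneg_nonneg) auto
      then show ?thesis using Tb[OF \<omega>] pos by simp
    qed
    then have "?l \<le> (2 * B)\<^sup>2" by (intro power_mono) auto
    also have "\<dots> = 4 * B\<^sup>2 * 1" by (simp add: power_mult_distrib)
    also have "\<dots> \<le> ?b"
      using False \<theta> by (intro mult_left_mono) (auto simp: v'_def)
    finally show ?thesis by (simp add: add_increasing)
  qed
  have int1: "integrable M (\<lambda>\<omega>. (max 0 (\<bar>T \<omega>\<bar> - r))\<^sup>2)"
  proof (rule integrable_bounded[where B = "(2 * B)\<^sup>2"])
    fix \<omega> assume "\<omega> \<in> space M"
    then have "(max 0 (\<bar>T \<omega>\<bar> - r))\<^sup>2 \<le> (2 * B)\<^sup>2"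
      using Tb[of \<omega>] r0 pos by (intro power_mono) auto
    then show "\<bar>(max 0 (\<bar>T \<omega>\<bar> - r))\<^sup>2\<bar> \<le> (2 * B)\<^sup>2" by simp
  qed measurable
  have int2: "integrable M (\<lambda>\<omega>. exp (\<theta> * (v - e / 2 - V \<omega>)))"
  proof (rule integrable_bounded[where B = "exp (\<theta> * v)"])
    show "\<bar>exp (\<theta> * (v - e / 2 - V \<omega>))\<bar> \<le> exp (\<theta> * v)" if "\<omega> \<in> space M" for \<omega>
      using V0[of \<omega>] pos \<theta> by (simp add: mult_left_mono)
  qed measurable
  have t1: "expectation (\<lambda>\<omega>. (max 0 (\<bar>T \<omega>\<bar> - r))\<^sup>2) \<le> 4 * (w + e + 2 * c\<^sup>2) * exp (- x)"
  proof -
    have "expectation (\<lambda>\<omega>. (max 0 (\<bar>T \<omega>\<bar> - r))\<^sup>2) \<le> 4 * (sqrt (v' / (2 * x)) + c)\<^sup>2 * exp (- x)"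
      unfolding T_def r_def c_def
      using pos v' var by (intro Bernstein_excess[OF n ind B mean]) (auto simp: v'_def)
    also have "\<dots> \<le> 4 * (w + e + 2 * c\<^sup>2) * exp (- x)"
    proof (intro mult_right_mono mult_left_mono)
      have "0 \<le> (sqrt (v' / (2 * x)) - c)\<^sup>2" by simp
      then have "(sqrt (v' / (2 * x)) + c)\<^sup>2 \<le> 2 * (sqrt (v' / (2 * x)))\<^sup>2 + 2 * c\<^sup>2"
        by (simp add: power2_sum power2_diff)
      also have "2 * (sqrt (v' / (2 * x)))\<^sup>2 = v' / x" using v' pos by simp
      also have "v' / x \<le> v'" using v' pos by (simp add: divide_le_eq mult_le_cancel_left1)
      also have "v' \<le> w + e" using pos by (simp add: v'_def)
      finally show "(sqrt (v' / (2 * x)) + c)\<^sup>2 \<le> w + e + 2 * c\<^sup>2" by simp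
    qed auto
    finally show ?thesis .
  qed
  have t2: "expectation (\<lambda>\<omega>. exp (\<theta> * (v - e / 2 - V \<omega>)))
      \<le> exp (- (e\<^sup>2 * (real n)\<^sup>2 / (8 * B\<^sup>2 * w)))"
  proof -
    have "expectation (\<lambda>\<omega>. exp (\<theta> * (v - e / 2 - V \<omega>)))
      \<le> exp (\<theta>\<^sup>2 * B\<^sup>2 * w / (2 * (real n)\<^sup>2) - \<theta> * (e / 2))"
      unfolding V_def by (rule empirical_second_moment_lower_tail[OF n ind B var \<theta> pos(2)])
    also have "\<theta>\<^sup>2 * B\<^sup>2 * w / (2 * (real n)\<^sup>2) - \<theta> * (e / 2) = - (e\<^sup>2 * (real n)\<^sup>2 / (8 * B\<^sup>2 * w))"
      using n pos by (simp add: \<theta>_def power2_eq_square field_simps)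
    finally show ?thesis .
  qed
  have "expectation (\<lambda>\<omega>. (max 0 (\<bar>T \<omega>\<bar> - (sqrt (2 * (V \<omega> + e) * x) + c * x)))\<^sup>2)
      \<le> expectation (\<lambda>\<omega>. (max 0 (\<bar>T \<omega>\<bar> - r))\<^sup>2 + 4 * B\<^sup>2 * exp (\<theta> * (v - e / 2 - V \<omega>)))"
    using int1 int2 pt by (intro integral_mono') auto
  also have "\<dots> = expectation (\<lambda>\<omega>. (max 0 (\<bar>T \<omega>\<bar> - r))\<^sup>2)
      + 4 * B\<^sup>2 * expectation (\<lambda>\<omega>. exp (\<theta> * (v - e / 2 - V \<omega>)))"
    using int1 int2 by simp
  also have "\<dots> \<le> 4 * (w + e + 2 * c\<^sup>2) * exp (- x)
      + 4 * B\<^sup>2 * exp (- (e\<^sup>2 * (real n)\<^sup>2 / (8 * B\<^sup>2 * w)))"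
    using t1 t2 by (intro add_mono mult_left_mono) auto
  finally show ?thesis unfolding T_def V_def .
qed

end

section \<open>Rayleigh quotients and Cholesky factors of symmetric matrices\<close>

lemma scalar_prod_mult_mat_vec:
  assumes "A \<in> carrier_mat n n" "x \<in> carrier_vec n" "y \<in> carrier_vec n"
  shows "scalar_prod x (A *\<^sub>v y)
    = (\<Sum>i<n. \<Sum>j<n. vec_index x i * A $$ (i, j) * vec_index y j)"
  using assms
  by (auto simp: scalar_prod_def sum_distrib_left mult.assoc atLeast0LessThan intro!: sum.cong)

lemma scalar_prod_self_nonneg: "0 \<le> scalar_prod x (x :: real Matrix.vec)"
  by (auto simp: scalar_prod_def intro: sum_nonneg)

lemma scalar_prod_self_eq_0:
  assumes "x \<in> carrier_vec n" "scalar_prod x x = (0 :: real)"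
  shows "x = 0\<^sub>v n"
proof (rule eq_vecI)
  have "\<forall>i\<in>{0..<n}. vec_index x i * vec_index x i = 0"
    using assms by (subst sum_nonneg_eq_0_iff[symmetric]) (auto simp: scalar_prod_def)
  then show "vec_index x i = vec_index (0\<^sub>v n) i" if "i < dim_vec (0\<^sub>v n)" for i
    using that by auto
qed (use assms in auto)

lemma scalar_prod_self_pos:
  assumes "x \<in> carrier_vec n" "x \<noteq> 0\<^sub>v n"
  shows "0 < scalar_prod x (x :: real Matrix.vec)"
  using scalar_prod_self_nonneg[of x] scalar_prod_self_eq_0[OF assms(1)] assms(2) by fastforce

lemma scalar_prod_Cauchy_Schwarz:
  assumes "x \<in> carrier_vec n" "y \<in> carrier_vec n"
  shows "\<bar>scalar_prod x y\<bar> \<le> sqrt (scalar_prod x x) * sqrt (scalar_prod y (y :: real Matrix.vec))"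
proof -
  have "(scalar_prod x y)\<^sup>2 \<le> scalar_prod x x * scalar_prod y y"
    using assms Cauchy_Schwarz_ineq_sum[of "vec_index x" "vec_index y" "{0..<n}"]
    by (simp add: scalar_prod_def power2_eq_square)
  then have "sqrt ((scalar_prod x y)\<^sup>2) \<le> sqrt (scalar_prod x x * scalar_prod y y)"
    by (rule real_sqrt_le_mono)
  then show ?thesis by (simp add: real_sqrt_mult)
qed

lemma symmetric_scalar_prod:
  assumes A: "(A :: real mat) \<in> carrier_mat n n" and sym: "transpose_mat A = A"
    and x: "x \<in> carrier_vec n" and y: "y \<in> carrier_vec n"
  shows "scalar_prod x (A *\<^sub>v y) = scalar_prod y (A *\<^sub>v x)"
proof -
  have "scalar_prod (A *\<^sub>v y) x = scalar_prod y (transpose_mat A *\<^sub>v x)"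
    using transpose_vec_mult_scalar[OF A y x] A x y
    by (metis comm_scalar_prod mult_mat_vec_carrier sym)
  then show ?thesis
    using A x y sym by (metis comm_scalar_prod mult_mat_vec_carrier)
qed

lemma quadratic_form_abs_le:
  assumes "(G :: real mat) \<in> carrier_mat n n" "x \<in> carrier_vec n"
  shows "\<bar>scalar_prod x (G *\<^sub>v x)\<bar> \<le> (\<Sum>i<n. \<Sum>j<n. \<bar>G $$ (i, j)\<bar>) * scalar_prod x x"
proof -
  have sq: "(vec_index x i)\<^sup>2 \<le> scalar_prod x x" if "i < n" for i
    using assms that
    by (auto simp: scalar_prod_def power2_eq_square intro!: member_le_sum[where A = "{0..<n}"])
  have "\<bar>vec_index x i * G $$ (i, j) * vec_index x j\<bar> \<le> \<bar>G $$ (i, j)\<bar> * scalar_prod x x"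
    if "i < n" "j < n" for i j
  proof -
    have "0 \<le> (\<bar>vec_index x i\<bar> - \<bar>vec_index x j\<bar>)\<^sup>2" by simp
    then have "2 * (\<bar>vec_index x i\<bar> * \<bar>vec_index x j\<bar>) \<le> (vec_index x i)\<^sup>2 + (vec_index x j)\<^sup>2"
      by (simp add: power2_diff)
    then have "\<bar>vec_index x i\<bar> * \<bar>vec_index x j\<bar> \<le> scalar_prod x x"
      using sq[OF that(1)] sq[OF that(2)] by linarith
    then have "\<bar>G $$ (i, j)\<bar> * (\<bar>vec_index x i\<bar> * \<bar>vec_index x j\<bar>) \<le> \<bar>G $$ (i, j)\<bar> * scalar_prod x x"
      by (rule mult_left_mono) simp
    then show ?thesis by (simp add: abs_mult mult_ac)
  qed
  then show ?thesis
    unfolding scalar_prod_mult_mat_vec[OF assms assms(2)] sum_distrib_right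
    by (intro order_trans[OF sum_abs] sum_mono order_trans[OF sum_abs]) auto
qed

lemma det_nonzero_imp_inverse:
  assumes "(C :: real mat) \<in> carrier_mat n n" "det C \<noteq> 0"
  obtains G where "G \<in> carrier_mat n n" "C * G = 1\<^sub>m n"
  using det_non_zero_imp_unit[OF assms, of "()"] unfolding Units_def ring_mat_def by auto

text \<open>
  Expand the form \<open>z \<mapsto> z \<bullet> C z\<close> at \<open>z = x - r y\<close> with \<open>C y = x\<close>; this gives
  \<open>x \<bullet> C x \<ge> 2 r \<parallel>x\<parallel>\<^sup>2 - r\<^sup>2 (x \<bullet> y)\<close>, and \<open>x \<bullet> y\<close> is bounded by a multiple of \<open>\<parallel>x\<parallel>\<^sup>2\<close>.
\<close>

lemma psd_invertible_imp_coercive: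
  assumes C: "(C :: real mat) \<in> carrier_mat n n" and sym: "transpose_mat C = C"
    and psd: "\<And>x. x \<in> carrier_vec n \<Longrightarrow> 0 \<le> scalar_prod x (C *\<^sub>v x)"
    and det: "det C \<noteq> 0"
  obtains e where "0 < e" "\<And>x. x \<in> carrier_vec n \<Longrightarrow> e * scalar_prod x x \<le> scalar_prod x (C *\<^sub>v x)"
proof -
  obtain G where G: "G \<in> carrier_mat n n" and CG: "C * G = 1\<^sub>m n"
    using det_nonzero_imp_inverse[OF C det] .
  define g where "g = 1 + (\<Sum>i<n. \<Sum>j<n. \<bar>G $$ (i, j)\<bar>)"
  have g: "0 < g" unfolding g_def by (intro add_pos_nonneg sum_nonneg) auto
  have "1 / g * scalar_prod x x \<le> scalar_prod x (C *\<^sub>v x)" if x: "x \<in> carrier_vec n" for x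
  proof -
    define y where "y = G *\<^sub>v x"
    have y: "y \<in> carrier_vec n" using G x by (simp add: y_def)
    have Cy: "C *\<^sub>v y = x"
      unfolding y_def using assoc_mult_mat_vec[OF C G x] CG x by simp
    define r where "r = 1 / g"
    define z where "z = x - r \<cdot>\<^sub>v y"
    have z: "z \<in> carrier_vec n" using x y by (simp add: z_def)
    have Cz: "C *\<^sub>v z = C *\<^sub>v x - r \<cdot>\<^sub>v x"
      unfolding z_def using C x y Cy by (simp add: mult_minus_distrib_mat_vec[OF C] mult_mat_vec[OF C])
    have Cx: "C *\<^sub>v x \<in> carrier_vec n" using C x by simp
    have yCx: "scalar_prod y (C *\<^sub>v x) = scalar_prod x x"
      using symmetric_scalar_prod[OF C sym y x] Cy by simp
    have "0 \<le> scalar_prod z (C *\<^sub>v z)" using psd z .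
    also have "scalar_prod z (C *\<^sub>v z) = scalar_prod x (C *\<^sub>v x) - r * scalar_prod x x
        - r * (scalar_prod x x - r * scalar_prod y x)"
      unfolding Cz unfolding z_def
      using x y Cx yCx
      by (simp add: minus_scalar_prod_distrib[of _ n] scalar_prod_minus_distrib[of _ n]
          smult_scalar_prod_distrib[of _ n] scalar_prod_smult_distrib[of _ n] algebra_simps)
    finally have quad: "0 \<le> scalar_prod x (C *\<^sub>v x) - r * scalar_prod x x
        - r * (scalar_prod x x - r * scalar_prod y x)" .
    have "scalar_prod y x = scalar_prod x (G *\<^sub>v x)"
      unfolding y_def using G x by (metis comm_scalar_prod mult_mat_vec_carrier)
    also have "\<dots> \<le> (\<Sum>i<n. \<Sum>j<n. \<bar>G $$ (i, j)\<bar>) * scalar_prod x x"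
      using quadratic_form_abs_le[OF G x] by linarith
    also have "\<dots> \<le> g * scalar_prod x x"
      using scalar_prod_self_nonneg[of x] by (intro mult_right_mono) (auto simp: g_def)
    finally have "r * scalar_prod y x \<le> r * (g * scalar_prod x x)"
      using g by (intro mult_left_mono) (auto simp: r_def)
    also have "\<dots> = scalar_prod x x" using g by (simp add: r_def)
    finally have "r * (r * scalar_prod y x) \<le> r * scalar_prod x x"
      using g by (intro mult_left_mono) (auto simp: r_def)
    then have "r * scalar_prod x x \<le> scalar_prod x (C *\<^sub>v x)"
      using quad by (simp add: right_diff_distrib)
    then show ?thesis using g by (simp add: r_def)
  qed
  then show ?thesis using g that[of "1 / g"] by auto
qed

text \<open>
  The largest \<open>\<mu>\<close> for which \<open>A - \<mu> I\<close> is positive semidefinite is an eigenvalue: if \<open>A - \<mu> I\<close> were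
  invertible, it would be coercive and \<open>\<mu>\<close> could be increased.
\<close>

lemma symmetric_Rayleigh_eigenvalue:
  assumes A: "(A :: real mat) \<in> carrier_mat n n" and sym: "transpose_mat A = A" and n: "0 < n"
  obtains \<mu> where "\<mu> \<in> spectrum A"
    "\<And>x. x \<in> carrier_vec n \<Longrightarrow> \<mu> * scalar_prod x x \<le> scalar_prod x (A *\<^sub>v x)"
proof -
  define S where "S = {c. \<forall>x \<in> carrier_vec n. c * scalar_prod x x \<le> scalar_prod x (A *\<^sub>v x)}"
  define \<mu> where "\<mu> = Sup S"
  have "- (\<Sum>i<n. \<Sum>j<n. \<bar>A $$ (i, j)\<bar>) \<in> S"
    unfolding S_def using quadratic_form_abs_le[OF A] by (fastforce simp: abs_le_iff)
  then have ne: "S \<noteq> {}" by auto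
  have bdd: "bdd_above S"
  proof (rule bdd_aboveI)
    fix c assume "c \<in> S"
    then have "c * scalar_prod (unit_vec n 0) (unit_vec n 0)
        \<le> scalar_prod (unit_vec n 0) (A *\<^sub>v unit_vec n 0)"
      by (auto simp: S_def)
    then show "c \<le> scalar_prod (unit_vec n 0) (A *\<^sub>v unit_vec n 0)"
      using n by (simp add: scalar_prod_left_unit)
  qed
  have low: "\<mu> * scalar_prod x x \<le> scalar_prod x (A *\<^sub>v x)" if x: "x \<in> carrier_vec n" for x
  proof (cases "x = 0\<^sub>v n")
    case True
    then show ?thesis using A by simp
  next
    case False
    have p: "0 < scalar_prod x x" using scalar_prod_self_pos[OF x False] .
    have "\<mu> \<le> scalar_prod x (A *\<^sub>v x) / scalar_prod x x"
      unfolding \<mu>_def using ne p x by (intro cSup_least) (auto simp: S_def pos_le_divide_eq)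
    then show ?thesis using p by (simp add: pos_le_divide_eq)
  qed
  define C where "C = char_matrix A \<mu>"
  have C: "C \<in> carrier_mat n n" using A by (simp add: C_def)
  have symC: "transpose_mat C = C"
  proof (rule eq_matI)
    fix i j assume "i < dim_row C" "j < dim_col C"
    then have ij: "i < n" "j < n" using C by auto
    have "transpose_mat A $$ (i, j) = A $$ (i, j)" using sym by simp
    then have "A $$ (j, i) = A $$ (i, j)" using ij A by simp
    then show "transpose_mat C $$ (i, j) = C $$ (i, j)"
      using ij A by (auto simp: C_def char_matrix_def)
  qed (use C in auto)
  have quadC: "scalar_prod x (C *\<^sub>v x) = scalar_prod x (A *\<^sub>v x) - \<mu> * scalar_prod x x"
    if x: "x \<in> carrier_vec n" for x
  proof -
    have "C *\<^sub>v x = A *\<^sub>v x + (- \<mu>) \<cdot>\<^sub>v x"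
      unfolding C_def char_matrix_def using A x
      by (intro eq_vecI) (auto simp: add_scalar_prod_distrib[of _ n] row_add)
    then show ?thesis
      using A x by (simp add: scalar_prod_add_distrib[of _ n])
  qed
  have "det C = 0"
  proof (rule ccontr)
    assume "det C \<noteq> 0"
    from psd_invertible_imp_coercive[OF C symC _ this]
    obtain e where e: "0 < e"
      "\<And>x. x \<in> carrier_vec n \<Longrightarrow> e * scalar_prod x x \<le> scalar_prod x (C *\<^sub>v x)"
      using low quadC by (metis diff_ge_0_iff_ge)
    then have "\<mu> + e \<in> S"
      unfolding S_def using quadC by (fastforce simp: algebra_simps)
    then have "\<mu> + e \<le> \<mu>" unfolding \<mu>_def using bdd by (intro cSup_upper)
    then show False using e by simp
  qed
  then have "\<mu> \<in> spectrum A"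
    using eigenvalue_det[OF A] by (simp add: spectrum_def C_def)
  then show ?thesis using low that by blast
qed

lemma Min_spectrum_le_Rayleigh:
  assumes A: "(A :: real mat) \<in> carrier_mat n n" and sym: "transpose_mat A = A" and n: "0 < n"
    and x: "x \<in> carrier_vec n"
  shows "Min (spectrum A) * scalar_prod x x \<le> scalar_prod x (A *\<^sub>v x)"
proof -
  obtain \<mu> where \<mu>: "\<mu> \<in> spectrum A" "\<mu> * scalar_prod x x \<le> scalar_prod x (A *\<^sub>v x)"
    using symmetric_Rayleigh_eigenvalue[OF A sym n] x by blast
  have "Min (spectrum A) \<le> \<mu>" using \<mu> card_finite_spectrum[OF A] by (intro Min_le) auto
  then show ?thesis
    using \<mu>(2) scalar_prod_self_nonneg[of x] by (meson mult_right_mono order_trans)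
qed

text \<open>
  Matrices are represented by their entries, with indices below \<open>n\<close>.  The induction splits off the
  first row and column and passes to the Schur complement \<open>S\<close> of the first entry.
\<close>

lemma Cholesky_factor_exists:
  fixes a :: "nat \<Rightarrow> nat \<Rightarrow> real"
  assumes "\<And>i j. i < n \<Longrightarrow> j < n \<Longrightarrow> a i j = a j i"
    and "\<And>x. \<exists>i<n. x i \<noteq> 0 \<Longrightarrow> 0 < (\<Sum>i<n. \<Sum>j<n. x i * a i j * x j)"
  shows "\<exists>L. (\<forall>i<n. 0 < L i i) \<and> (\<forall>i<n. \<forall>j<n. i < j \<longrightarrow> L i j = 0)
    \<and> (\<forall>i<n. \<forall>j<n. (\<Sum>k<n. L i k * L j k) = a i j)"
  using assms
proof (induction n arbitrary: a)
  case 0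
  then show ?case by simp
next
  case (Suc n)
  define \<alpha> where "\<alpha> = a 0 0"
  have "0 < (\<Sum>i<Suc n. \<Sum>j<Suc n. (if i = 0 then 1 else 0) * a i j * (if j = 0 then 1 else 0))"
    by (rule Suc.prems(2)) auto
  then have \<alpha>: "0 < \<alpha>"
    unfolding sum.lessThan_Suc_shift \<alpha>_def by simp
  define S where "S i j = a (Suc i) (Suc j) - a (Suc i) 0 * a (Suc j) 0 / \<alpha>" for i j
  have pd: "0 < (\<Sum>i<n. \<Sum>j<n. y i * S i j * y j)" if y: "\<exists>i<n. y i \<noteq> 0" for y
  proof -
    define p where "p = (\<Sum>i<n. y i * a (Suc i) 0)"
    \<comment> \<open>The first coordinate that minimises the quadratic form when the others are \<open>y\<close>.\<close>
    define x where "x i = (case i of 0 \<Rightarrow> - p / \<alpha> | Suc i \<Rightarrow> y i)" for i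
    have p_sum: "(\<Sum>j<n. q * a (Suc j) 0 * y j) = q * p" for q
      by (simp add: p_def sum_distrib_left mult_ac)
    have sym0: "a 0 (Suc j) = a (Suc j) 0" if "j < n" for j
      using Suc.prems(1) that by auto
    have "0 < (\<Sum>i<Suc n. \<Sum>j<Suc n. x i * a i j * x j)"
    proof (rule Suc.prems(2))
      obtain i where "i < n" "y i \<noteq> 0" using y by blast
      then show "\<exists>i<Suc n. x i \<noteq> 0" by (intro exI[of _ "Suc i"]) (simp add: x_def)
    qed
    also have "\<dots> = (- p / \<alpha>) * \<alpha> * (- p / \<alpha>) + (\<Sum>j<n. (- p / \<alpha>) * a (Suc j) 0 * y j)
        + ((\<Sum>i<n. y i * a (Suc i) 0 * (- p / \<alpha>)) + (\<Sum>i<n. \<Sum>j<n. y i * a (Suc i) (Suc j) * y j))"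
      unfolding sum.lessThan_Suc_shift using sym0
      by (simp add: x_def \<alpha>_def sum.distrib sum_subtractf sum_negf)
    also have "(\<Sum>j<n. (- p / \<alpha>) * a (Suc j) 0 * y j) = (- p / \<alpha>) * p"
      by (rule p_sum)
    also have "(\<Sum>i<n. y i * a (Suc i) 0 * (- p / \<alpha>)) = p * (- p / \<alpha>)"
      unfolding p_def sum_distrib_right ..
    also have "(- p / \<alpha>) * \<alpha> * (- p / \<alpha>) + (- p / \<alpha>) * p
        + (p * (- p / \<alpha>) + (\<Sum>i<n. \<Sum>j<n. y i * a (Suc i) (Suc j) * y j))
        = (\<Sum>i<n. \<Sum>j<n. y i * a (Suc i) (Suc j) * y j) - p * p / \<alpha>"
      using \<alpha> by (simp add: field_simps)
    also have "p * p / \<alpha> = (\<Sum>i<n. \<Sum>j<n. y i * (a (Suc i) 0 * a (Suc j) 0 / \<alpha>) * y j)"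
      unfolding p_def sum_product sum_divide_distrib by (simp add: mult_ac)
    finally show ?thesis
      by (simp only: S_def left_diff_distrib right_diff_distrib sum_subtractf)
  qed
  have symS: "S i j = S j i" if "i < n" "j < n" for i j
    using Suc.prems(1)[of "Suc i" "Suc j"] that by (simp add: S_def mult.commute)
  from Suc.IH[OF symS pd] obtain L' where L':
    "\<And>i. i < n \<Longrightarrow> 0 < L' i i" "\<And>i j. i < n \<Longrightarrow> j < n \<Longrightarrow> i < j \<Longrightarrow> L' i j = 0"
    "\<And>i j. i < n \<Longrightarrow> j < n \<Longrightarrow> (\<Sum>k<n. L' i k * L' j k) = S i j"
    by blast
  define L where "L i j = (case i of 0 \<Rightarrow> (if j = 0 then sqrt \<alpha> else 0)
      | Suc i' \<Rightarrow> (case j of 0 \<Rightarrow> a (Suc i') 0 / sqrt \<alpha> | Suc j' \<Rightarrow> L' i' j'))" for i j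
  have "0 < L i i" if "i < Suc n" for i
    using that \<alpha> L'(1) by (auto simp: L_def split: nat.split)
  moreover have "L i j = 0" if "i < Suc n" "j < Suc n" "i < j" for i j
    using that L'(2) by (auto simp: L_def split: nat.split)
  moreover have "(\<Sum>k<Suc n. L i k * L j k) = a i j" if ij: "i < Suc n" "j < Suc n" for i j
  proof (cases i)
    case 0
    show ?thesis
      using ij \<alpha> 0 Suc.prems(1)[of 0 j]
      unfolding sum.lessThan_Suc_shift by (cases j) (auto simp: L_def \<alpha>_def)
  next
    case i: (Suc i')
    show ?thesis
    proof (cases j)
      case 0
      then show ?thesis using ij \<alpha> i unfolding sum.lessThan_Suc_shift by (auto simp: L_def)
    next
      case j: (Suc j')
      have "(\<Sum>k<Suc n. L i k * L j k) = a i 0 * a j 0 / \<alpha> + (\<Sum>k<n. L' i' k * L' j' k)"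
        using \<alpha> by (simp add: L_def i j sum.lessThan_Suc_shift del: sum.lessThan_Suc)
      then show ?thesis using ij L'(3)[of i' j'] by (simp add: S_def i j)
    qed
  qed
  ultimately show ?case by blast
qed

lemma Cholesky_factor_unique:
  fixes L L' :: "nat \<Rightarrow> nat \<Rightarrow> real"
  assumes L: "\<And>i. i < n \<Longrightarrow> 0 < L i i" "\<And>i j. i < n \<Longrightarrow> j < n \<Longrightarrow> i < j \<Longrightarrow> L i j = 0"
    and L': "\<And>i. i < n \<Longrightarrow> 0 < L' i i" "\<And>i j. i < n \<Longrightarrow> j < n \<Longrightarrow> i < j \<Longrightarrow> L' i j = 0"
    and eq: "\<And>i j. i < n \<Longrightarrow> j < n \<Longrightarrow> (\<Sum>k<n. L i k * L j k) = (\<Sum>k<n. L' i k * L' j k)"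
  shows "i < n \<Longrightarrow> j < n \<Longrightarrow> L i j = L' i j"
proof (induction j arbitrary: i rule: less_induct)
  case (less j)
  have split: "(\<Sum>k<n. F k) = (\<Sum>k<j. F k) + F j"
    if "\<And>k. k < n \<Longrightarrow> j < k \<Longrightarrow> F k = 0" for F :: "nat \<Rightarrow> real"
  proof -
    have "(\<Sum>k<n. F k) = (\<Sum>k<Suc j. F k)"
      using less.prems that by (intro sum.mono_neutral_right) auto
    then show ?thesis by simp
  qed
  have main: "L l j * L j j = L' l j * L' j j" if l: "l < n" for l
  proof -
    have "(\<Sum>k<j. L l k * L j k) + L l j * L j j = (\<Sum>k<n. L l k * L j k)"
      using less.prems L(2) by (intro split[symmetric]) auto
    also have "\<dots> = (\<Sum>k<n. L' l k * L' j k)" using eq l less.prems by auto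
    also have "\<dots> = (\<Sum>k<j. L' l k * L' j k) + L' l j * L' j j"
      using less.prems L'(2) by (intro split) auto
    also have "(\<Sum>k<j. L' l k * L' j k) = (\<Sum>k<j. L l k * L j k)"
      using less.IH l less.prems by (intro sum.cong) auto
    finally show ?thesis by simp
  qed
  have "(L j j)\<^sup>2 = (L' j j)\<^sup>2" using main[of j] less.prems by (simp add: power2_eq_square)
  then have "L j j = L' j j"
    using L(1)[of j] L'(1)[of j] less.prems by (simp add: power2_eq_iff_nonneg less_imp_le)
  then show ?case using main[of i] less.prems L'(1)[of j] by auto
qed

lemma lower_triangularD:
  assumes L: "L \<in> carrier_mat n n" and tri: "upper_triangular (transpose_mat L)"
    and ij: "i < j" "j < n"
  shows "L $$ (i, j) = 0"
proof -
  have "transpose_mat L $$ (j, i) = 0"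
    using tri L ij unfolding upper_triangular_def
    by (metis carrier_matD(2) index_transpose_mat(2))
  then show ?thesis using L ij by simp
qed

lemma cholesky_properties:
  assumes A: "A \<in> carrier_mat n n" and sym: "transpose_mat A = A"
    and pd: "\<And>x. x \<in> carrier_vec n \<Longrightarrow> x \<noteq> 0\<^sub>v n \<Longrightarrow> 0 < scalar_prod x (A *\<^sub>v x)"
  shows "cholesky A \<in> carrier_mat n n \<and> upper_triangular (transpose_mat (cholesky A))
    \<and> (\<forall>i<n. 0 < cholesky A $$ (i, i)) \<and> cholesky A * transpose_mat (cholesky A) = A"
proof -
  define P where "P L \<longleftrightarrow> L \<in> carrier_mat n n \<and> upper_triangular (transpose_mat L)
     \<and> (\<forall>i<n. 0 < L $$ (i, i)) \<and> L * transpose_mat L = A" for L :: "real mat"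
  have entry: "(L * transpose_mat L) $$ (i, j) = (\<Sum>k<n. L $$ (i, k) * L $$ (j, k))"
    if "L \<in> carrier_mat n n" "i < n" "j < n" for L :: "real mat" and i j
    using that by (simp add: scalar_prod_def atLeast0LessThan)
  have symA: "A $$ (i, j) = A $$ (j, i)" if "i < n" "j < n" for i j
    using sym A that by (metis carrier_matD index_transpose_mat(1))
  have pdA: "0 < (\<Sum>i<n. \<Sum>j<n. x i * A $$ (i, j) * x j)" if x: "\<exists>i<n. x i \<noteq> 0" for x
  proof -
    have v: "Matrix.vec n x \<in> carrier_vec n" by simp
    moreover have "Matrix.vec n x \<noteq> 0\<^sub>v n" using x by (metis index_vec index_zero_vec(1))
    ultimately show ?thesis
      using pd[OF v] unfolding scalar_prod_mult_mat_vec[OF A v v] by simp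
  qed
  obtain L where L: "\<And>i. i < n \<Longrightarrow> 0 < L i i" "\<And>i j. i < n \<Longrightarrow> j < n \<Longrightarrow> i < j \<Longrightarrow> L i j = 0"
    "\<And>i j. i < n \<Longrightarrow> j < n \<Longrightarrow> (\<Sum>k<n. L i k * L j k) = A $$ (i, j)"
  proof -
    have "\<exists>L. (\<forall>i<n. 0 < L i i) \<and> (\<forall>i<n. \<forall>j<n. i < j \<longrightarrow> L i j = 0)
      \<and> (\<forall>i<n. \<forall>j<n. (\<Sum>k<n. L i k * L j k) = A $$ (i, j))"
      by (rule Cholesky_factor_exists[OF symA pdA])
    then obtain L where "\<forall>i<n. 0 < L i i" "\<forall>i<n. \<forall>j<n. i < j \<longrightarrow> L i j = 0"
      "\<forall>i<n. \<forall>j<n. (\<Sum>k<n. L i k * L j k) = A $$ (i, j)" by blast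
    then show ?thesis by (intro that[of L]) auto
  qed
  define LM where "LM = mat n n (\<lambda>(i, j). L i j)"
  have LM: "LM \<in> carrier_mat n n" by (simp add: LM_def)
  have "P LM"
    unfolding P_def
  proof (intro conjI allI impI LM)
    show "upper_triangular (transpose_mat LM)" using L(2) by (auto simp: LM_def)
    show "0 < LM $$ (i, i)" if "i < n" for i using that L(1) by (simp add: LM_def)
    show "LM * transpose_mat LM = A"
    proof (rule eq_matI)
      fix i j assume "i < dim_row A" "j < dim_col A"
      then have ij: "i < n" "j < n" using A by auto
      then have "(\<Sum>k<n. LM $$ (i, k) * LM $$ (j, k)) = (\<Sum>k<n. L i k * L j k)"
        by (simp add: LM_def)
      then show "(LM * transpose_mat LM) $$ (i, j) = A $$ (i, j)"
        using entry[OF LM ij] L(3)[OF ij] by simp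
    qed (use A LM in auto)
  qed
  moreover have "N = LM" if "P N" for N
  proof (rule eq_matI)
    have N: "N \<in> carrier_mat n n" using that by (simp add: P_def)
    fix i j assume "i < dim_row LM" "j < dim_col LM"
    then have ij: "i < n" "j < n" using LM by auto
    have low: "K $$ (i, j) = 0" if "P K" "i < n" "j < n" "i < j" for K i j
      using that(1) lower_triangularD[OF _ _ that(4,3), of K] by (simp add: P_def)
    show "N $$ (i, j) = LM $$ (i, j)"
    proof (rule Cholesky_factor_unique[of n "\<lambda>i j. N $$ (i, j)" "\<lambda>i j. LM $$ (i, j)", OF _ _ _ _ _ ij])
      show "(\<Sum>k<n. N $$ (i, k) * N $$ (j, k)) = (\<Sum>k<n. LM $$ (i, k) * LM $$ (j, k))"
        if "i < n" "j < n" for i j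
        using entry[OF N that] entry[OF LM that] \<open>P N\<close> \<open>P LM\<close> by (simp add: P_def)
    next
      show "0 < N $$ (i, i)" "0 < LM $$ (i, i)" if "i < n" for i
        using \<open>P N\<close> \<open>P LM\<close> that by (simp_all add: P_def)
    qed (use low \<open>P N\<close> \<open>P LM\<close> in blast)+
  next
    have "N \<in> carrier_mat n n" using that by (simp add: P_def)
    then show "dim_row N = dim_row LM" "dim_col N = dim_col LM" using LM by auto
  qed
  ultimately have "P (THE L. P L)" by (rule theI)
  moreover have "(THE L. P L) = cholesky A"
    unfolding P_def cholesky_def carrier_matD(1)[OF A] ..
  ultimately show ?thesis by (simp add: P_def)
qed

text \<open>
  From \<open>l \<parallel>z\<parallel>\<^sup>2 \<le> z \<bullet> A z = \<parallel>L\<^sup>T z\<parallel>\<^sup>2\<close> the inverse transpose of \<open>L\<close> has operator norm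
  at most \<open>1 / sqrt l\<close>, and therefore so has the inverse of \<open>L\<close>.
\<close>

lemma inverse_Cholesky_scalar_prod_le:
  assumes A: "(A :: real mat) \<in> carrier_mat n n" and L: "L \<in> carrier_mat n n"
    and LL: "L * transpose_mat L = A" and R: "R \<in> carrier_mat n n" and RL: "R * L = 1\<^sub>m n"
    and l: "0 < l" "\<And>x. x \<in> carrier_vec n \<Longrightarrow> l * scalar_prod x x \<le> scalar_prod x (A *\<^sub>v x)"
    and x: "x \<in> carrier_vec n" and y: "y \<in> carrier_vec n"
  shows "\<bar>scalar_prod (R *\<^sub>v x) (R *\<^sub>v y)\<bar> \<le> sqrt (scalar_prod x x) * sqrt (scalar_prod y y) / l"
proof -
  define nr where "nr v = sqrt (scalar_prod v v)" for v :: "real Matrix.vec"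
  have nr0: "0 \<le> nr v" for v by (simp add: nr_def scalar_prod_self_nonneg)
  have tR: "transpose_mat R \<in> carrier_mat n n" and tL: "transpose_mat L \<in> carrier_mat n n"
    using R L by auto
  have dual: "sqrt l * nr (transpose_mat R *\<^sub>v w) \<le> nr w" if w: "w \<in> carrier_vec n" for w
  proof -
    define z where "z = transpose_mat R *\<^sub>v w"
    have z: "z \<in> carrier_vec n" using tR w by (simp add: z_def)
    have "transpose_mat L * transpose_mat R = 1\<^sub>m n"
      using transpose_mult[OF R L] RL by simp
    then have Lz: "transpose_mat L *\<^sub>v z = w"
      unfolding z_def using assoc_mult_mat_vec[OF tL tR w] w by simp
    have "l * scalar_prod z z \<le> scalar_prod z (A *\<^sub>v z)" using l(2) z .
    also have "A *\<^sub>v z = L *\<^sub>v w" using LL assoc_mult_mat_vec[OF L tL z] Lz by simp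
    also have "scalar_prod z (L *\<^sub>v w) = scalar_prod (transpose_mat L *\<^sub>v z) w"
      using transpose_vec_mult_scalar[OF L w z] L z w by (metis comm_scalar_prod mult_mat_vec_carrier tL)
    finally have "sqrt (l * scalar_prod z z) \<le> nr w" by (simp add: Lz nr_def)
    then show ?thesis by (simp add: nr_def z_def real_sqrt_mult)
  qed
  have bnd: "sqrt l * nr (R *\<^sub>v v) \<le> nr v" if v: "v \<in> carrier_vec n" for v
  proof -
    define w where "w = R *\<^sub>v v"
    have w: "w \<in> carrier_vec n" using R v by (simp add: w_def)
    have tw: "transpose_mat R *\<^sub>v w \<in> carrier_vec n" using tR w by simp
    have "nr w * nr w = scalar_prod w w" by (simp add: nr_def scalar_prod_self_nonneg)
    also have "\<dots> = scalar_prod (transpose_mat R *\<^sub>v w) v"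
      using transpose_vec_mult_scalar[OF R v w] R v w by (simp add: w_def)
    also have "\<dots> \<le> nr (transpose_mat R *\<^sub>v w) * nr v"
      using scalar_prod_Cauchy_Schwarz[OF tw v] by (simp add: nr_def)
    finally have "sqrt l * (nr w * nr w) \<le> sqrt l * (nr (transpose_mat R *\<^sub>v w) * nr v)"
      using l by (simp add: mult_left_mono)
    also have "\<dots> \<le> nr w * nr v"
      using mult_right_mono[OF dual[OF w] nr0[of v]] by (simp add: mult.assoc)
    finally have "nr w * (sqrt l * nr w) \<le> nr w * nr v" by (simp add: mult_ac)
    then show ?thesis using nr0[of w] nr0[of v]
      by (cases "nr w = 0") (auto simp: w_def[symmetric])
  qed
  have "\<bar>scalar_prod (R *\<^sub>v x) (R *\<^sub>v y)\<bar> \<le> nr (R *\<^sub>v x) * nr (R *\<^sub>v y)"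
    unfolding nr_def using R x y by (intro scalar_prod_Cauchy_Schwarz[of _ n]) auto
  also have "\<dots> = (sqrt l * nr (R *\<^sub>v x)) * (sqrt l * nr (R *\<^sub>v y)) / l"
    using l by (simp add: field_simps)
  also have "\<dots> \<le> nr x * nr y / l"
    using l nr0 bnd[OF x] bnd[OF y] by (intro divide_right_mono mult_mono) auto
  finally show ?thesis by (simp add: nr_def)
qed

lemma cholesky_inverse:
  assumes A: "A \<in> carrier_mat n n" and sym: "transpose_mat A = A"
    and pd: "\<And>x. x \<in> carrier_vec n \<Longrightarrow> x \<noteq> 0\<^sub>v n \<Longrightarrow> 0 < scalar_prod x (A *\<^sub>v x)"
  shows "the (mat_inverse (cholesky A)) \<in> carrier_mat n n"
    and "the (mat_inverse (cholesky A)) * cholesky A = 1\<^sub>m n"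
proof -
  let ?L = "cholesky A"
  note P = cholesky_properties[OF A sym pd]
  have L: "?L \<in> carrier_mat n n" using P by simp
  have low: "?L $$ (i, j) = 0" if "i < j" "j < n" for i j
    using lower_triangularD[OF L _ that] P by simp
  have "det ?L = prod_list (diag_mat ?L)"
    by (rule det_lower_triangular[OF low L])
  moreover have "prod_list (diag_mat ?L) \<noteq> 0"
    using P L by (force simp: diag_mat_def prod_list_zero_iff)
  ultimately have "det ?L \<noteq> 0" by simp
  then have "mat_inverse ?L \<noteq> None"
    using det_non_zero_imp_unit[OF L, of "()"] mat_inverse(1)[OF L, where b = "()"] by blast
  then obtain R where "mat_inverse ?L = Some R" by auto
  then show "the (mat_inverse ?L) \<in> carrier_mat n n" "the (mat_inverse ?L) * ?L = 1\<^sub>m n"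
    using mat_inverse(2)[OF L] by auto
qed

section \<open>Multi-indices\<close>

lemma mi_less_irrefl: "\<not> mi_less \<alpha> \<alpha>"
  by (simp add: mi_less_def)

lemma mi_less_trans: "mi_less \<alpha> \<beta> \<Longrightarrow> mi_less \<beta> \<gamma> \<Longrightarrow> mi_less \<alpha> \<gamma>"
proof -
  assume a: "mi_less \<alpha> \<beta>" "mi_less \<beta> \<gamma>"
  show ?thesis
  proof (cases "mi_degree \<alpha> = mi_degree \<beta> \<and> mi_degree \<beta> = mi_degree \<gamma>")
    case True
    then obtain j k where jk: "\<alpha> j < \<beta> j" "\<forall>i<j. \<alpha> i = \<beta> i" "\<beta> k < \<gamma> k" "\<forall>i<k. \<beta> i = \<gamma> i"
      using a by (auto simp: mi_less_def)
    have "\<alpha> (min j k) < \<gamma> (min j k) \<and> (\<forall>i<min j k. \<alpha> i = \<gamma> i)"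
      using jk by (cases j k rule: linorder_cases) (auto simp: min_def)
    then show ?thesis using True unfolding mi_less_def by auto
  next
    case False
    then show ?thesis using a by (auto simp: mi_less_def)
  qed
qed

lemma mi_less_total: "\<alpha> \<noteq> \<beta> \<Longrightarrow> mi_less \<alpha> \<beta> \<or> mi_less \<beta> \<alpha>"
proof -
  assume "\<alpha> \<noteq> \<beta>"
  then have ne: "{j. \<alpha> j \<noteq> \<beta> j} \<noteq> {}" by auto
  define j where "j = Min {j. \<alpha> j \<noteq> \<beta> j}"
  have "\<alpha> j \<noteq> \<beta> j" using Min_in[OF _ ne] by (auto simp: j_def)
  moreover have "\<forall>i<j. \<alpha> i = \<beta> i"
    unfolding j_def using Min_le[of "{j. \<alpha> j \<noteq> \<beta> j}"] by (metis (mono_tags) finite leD mem_Collect_eq)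
  ultimately show ?thesis unfolding mi_less_def by (metis linorder_neq_iff)
qed

lemma sorted_wrt_irrefl_imp_distinct:
  assumes "\<And>x. \<not> R x x" "sorted_wrt R xs"
  shows "distinct xs"
  using assms(2) by (induction xs) (use assms(1) in auto)

lemma ex1_sorted_wrt_enumeration:
  assumes irrefl: "\<And>x. \<not> R x x" and trans: "\<And>x y z. R x y \<Longrightarrow> R y z \<Longrightarrow> R x z"
    and total: "\<And>x y. x \<noteq> y \<Longrightarrow> R x y \<or> R y x" and "finite A"
  shows "\<exists>!xs. sorted_wrt R xs \<and> set xs = A"
proof (rule ex_ex1I)
  show "\<exists>xs. sorted_wrt R xs \<and> set xs = A"
    using \<open>finite A\<close>
  proof (induction A rule: finite_induct)
    case (insert x A)
    then obtain xs where xs: "sorted_wrt R xs" "set xs = A" by auto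
    \<comment> \<open>The elements below \<open>x\<close>, then \<open>x\<close>, then the elements above.\<close>
    let ?ys = "filter (\<lambda>y. R y x) xs @ x # filter (R x) xs"
    have "sorted_wrt R ?ys"
      using xs(1) trans by (auto simp: sorted_wrt_append intro: sorted_wrt_filter)
    moreover have "set ?ys = insert x A"
      using xs(2) insert.hyps(2) total by auto
    ultimately show ?case by blast
  qed simp
next
  fix xs ys assume "sorted_wrt R xs \<and> set xs = A" "sorted_wrt R ys \<and> set ys = A"
  then have "sorted_wrt R xs" "sorted_wrt R ys" "set xs = set ys" by auto
  then show "xs = ys"
  proof (induction xs arbitrary: ys)
    case (Cons x xs)
    then obtain y ys' where ys: "ys = y # ys'" by (cases ys) auto
    have xy: "x = y"
    proof (rule ccontr)
      assume "x \<noteq> y"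
      then have "R y x" "R x y" using Cons.prems ys by auto
      then show False using trans irrefl by blast
    qed
    have "x \<notin> set xs" "x \<notin> set ys'" using Cons.prems ys xy irrefl by auto
    then have "set xs = set ys'" using Cons.prems(3) ys xy by auto
    then show ?case using Cons ys xy by auto
  qed simp
qed

text \<open>
  The value \<open>k\<close> at the new index \<open>a\<close> leaves degree at most \<open>m - k\<close> for the others; the resulting sum
  of binomial coefficients is a hockey-stick sum.
\<close>

lemma card_bounded_degree:
  assumes "finite A"
  shows "finite {\<alpha> :: 'a \<Rightarrow> nat. (\<forall>i. i \<notin> A \<longrightarrow> \<alpha> i = 0) \<and> sum \<alpha> A \<le> m} \<and>
    card {\<alpha> :: 'a \<Rightarrow> nat. (\<forall>i. i \<notin> A \<longrightarrow> \<alpha> i = 0) \<and> sum \<alpha> A \<le> m} = (m + card A) choose card A"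
  using assms
proof (induction A arbitrary: m rule: finite_induct)
  case empty
  have "{\<alpha> :: 'a \<Rightarrow> nat. \<forall>i. \<alpha> i = 0} = {\<lambda>_. 0}" by auto
  then show ?case by simp
next
  case (insert a A)
  define S where "S B k = {\<alpha> :: 'a \<Rightarrow> nat. (\<forall>i. i \<notin> B \<longrightarrow> \<alpha> i = 0) \<and> sum \<alpha> B \<le> k}" for B k
  have IH: "finite (S A k)" "card (S A k) = (k + card A) choose card A" for k
    using insert.IH[of k] by (auto simp: S_def)
  have upd: "sum (\<beta>(a := k)) A = sum \<beta> A" for \<beta> :: "'a \<Rightarrow> nat" and k
    using insert.hyps by (intro sum.cong) auto
  then have upd_if: "(\<Sum>x\<in>A. if x = a then k else \<beta> x) = sum \<beta> A" for \<beta> :: "'a \<Rightarrow> nat" and k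
    by (simp add: fun_upd_def)
  have bij: "bij_betw (\<lambda>(k, \<beta>). \<beta>(a := k)) (SIGMA k:{..m}. S A (m - k)) (S (insert a A) m)"
  proof (rule bij_betw_byWitness[where f' = "\<lambda>\<alpha>. (\<alpha> a, \<alpha>(a := 0))"])
    show "\<forall>p\<in>SIGMA k:{..m}. S A (m - k). (\<lambda>\<alpha>. (\<alpha> a, \<alpha>(a := 0))) ((\<lambda>(k, \<beta>). \<beta>(a := k)) p) = p"
      using insert.hyps by (auto simp: S_def fun_eq_iff)
    show "(\<lambda>(k, \<beta>). \<beta>(a := k)) ` (SIGMA k:{..m}. S A (m - k)) \<subseteq> S (insert a A) m"
      using insert.hyps by (auto simp: S_def upd upd_if)
    show "(\<lambda>\<alpha>. (\<alpha> a, \<alpha>(a := 0))) ` S (insert a A) m \<subseteq> (SIGMA k:{..m}. S A (m - k))"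
      using insert.hyps by (auto simp: S_def upd upd_if)
  qed auto
  have "card (S (insert a A) m) = card (SIGMA k:{..m}. S A (m - k))"
    using bij_betw_same_card[OF bij] by simp
  also have "\<dots> = (\<Sum>k\<le>m. (m - k + card A) choose card A)"
    using IH by (subst card_SigmaI) auto
  also have "\<dots> = (\<Sum>k\<le>m. (card A + k) choose card A)"
    by (rule sum.reindex_bij_witness[of _ "\<lambda>k. m - k" "\<lambda>k. m - k"]) (auto simp: add.commute)
  also have "\<dots> = (m + card (insert a A)) choose card (insert a A)"
  proof -
    have "m + card (insert a A) = card A + m + 1" "card (insert a A) = card A + 1"
      using insert.hyps by auto
    then show ?thesis by (metis choose_rising_sum(1))
  qed
  finally have "card (S (insert a A) m) = (m + card (insert a A)) choose card (insert a A)" .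
  moreover have "finite (S (insert a A) m)"
    using bij_betw_finite[OF bij] IH by auto
  ultimately show ?case by (simp add: S_def)
qed

lemma
  fixes m :: nat
  shows finite_multi_indices: "finite {\<alpha> :: 'd::{finite,linorder} \<Rightarrow> nat. mi_degree \<alpha> \<le> m}"
    and card_multi_indices: "card {\<alpha> :: 'd \<Rightarrow> nat. mi_degree \<alpha> \<le> m} = Dm TYPE('d) m"
  using card_bounded_degree[of "UNIV :: 'd set" m] by (auto simp: mi_degree_def Dm_def)

lemma
  fixes m :: nat
  defines "\<alpha>s \<equiv> multi_indices m :: ('d::{finite,linorder} \<Rightarrow> nat) list"
  shows distinct_multi_indices: "distinct \<alpha>s"
    and length_multi_indices: "length \<alpha>s = Dm TYPE('d) m"
proof -
  have "\<exists>!xs. sorted_wrt mi_less xs \<and> set xs = {\<alpha> :: 'd \<Rightarrow> nat. mi_degree \<alpha> \<le> m}"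
    by (rule ex1_sorted_wrt_enumeration)
      (rule mi_less_irrefl mi_less_total finite_multi_indices | erule (1) mi_less_trans | assumption)+
  from theI'[OF this] have s: "sorted_wrt mi_less \<alpha>s" "set \<alpha>s = {\<alpha>. mi_degree \<alpha> \<le> m}"
    by (simp_all add: \<alpha>s_def multi_indices_def)
  show d: "distinct \<alpha>s" using sorted_wrt_irrefl_imp_distinct[OF mi_less_irrefl s(1)] .
  show "length \<alpha>s = Dm TYPE('d) m" using distinct_card[OF d] s(2) card_multi_indices by metis
qed

lemma Dm_pos: "0 < Dm TYPE('d::finite) m"
  by (simp add: Dm_def)

lemma Dm_le: "Dm TYPE('d::finite) m \<le> (m + 1) ^ CARD('d)"
proof -
  have "(m + d) choose d \<le> (m + 1) ^ d" for d
  proof (induction d)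
    case (Suc d)
    have "Suc d * ((m + Suc d) choose Suc d) = (m + Suc d) * ((m + d) choose d)"
      using Suc_times_binomial_eq[of "m + d" d] by (simp add: mult.commute)
    also have "\<dots> \<le> (m + Suc d) * (m + 1) ^ d" using Suc by (rule mult_left_mono) simp
    also have "\<dots> \<le> (Suc d * (m + 1)) * (m + 1) ^ d" by (intro mult_right_mono) auto
    also have "\<dots> = Suc d * (m + 1) ^ Suc d" by (simp only: power_Suc mult.assoc)
    finally show ?case by (simp only: mult_le_cancel1)
  qed simp
  then show ?thesis by (simp add: Dm_def)
qed

section \<open>Monomial vectors\<close>

lemma Phi_carrier [simp]: "Phi (m, h) (u :: 'd::{finite,linorder} rvec) \<in> carrier_vec (Dm TYPE('d) m)"
  by (simp add: Phi_def)

lemma mi_monom_abs_le_1: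
  assumes "u \<in> cube"
  shows "\<bar>mi_monom \<alpha> u\<bar> \<le> 1"
proof -
  have "\<bar>vec_nth u j\<bar> ^ \<alpha> j \<le> 1" for j
    using assms by (intro power_le_one) (auto simp: cube_def abs_le_iff minus_le_iff)
  then show ?thesis
    unfolding mi_monom_def abs_prod by (intro prod_le_1) (auto simp: power_abs)
qed

lemma Phi_norm_le:
  fixes u :: "'d::{finite,linorder} rvec"
  assumes "(1 / h) *\<^sub>R u \<in> cube"
  shows "scalar_prod (Phi (m, h) u) (Phi (m, h) u) \<le> real (Dm TYPE('d) m)"
proof -
  have "mi_monom \<alpha> ((1 / h) *\<^sub>R u) * mi_monom \<alpha> ((1 / h) *\<^sub>R u) \<le> 1" for \<alpha>
    using mi_monom_abs_le_1[OF assms] by (simp add: abs_square_le_1 flip: power2_eq_square)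
  then have "scalar_prod (Phi (m, h) u) (Phi (m, h) u) \<le> (\<Sum>i\<in>{0..<Dm TYPE('d) m}. 1)"
    unfolding scalar_prod_def by (intro order_trans[OF eq_refl sum_mono[where g = "\<lambda>_. 1"]])
      (auto simp: Phi_def)
  then show ?thesis by simp
qed

text \<open>
  Only the monomial of the zero multi-index does not vanish at the origin, and it occurs once.
\<close>

lemma Phi_zero_norm_le:
  "scalar_prod (Phi (m, h) (0 :: 'd::{finite,linorder} rvec)) (Phi (m, h) (0 :: 'd rvec)) \<le> 1"
proof -
  let ?as = "multi_indices m :: ('d \<Rightarrow> nat) list" and ?N = "Dm TYPE('d) m"
  have mon: "mi_monom \<alpha> (0 :: 'd rvec) = (if \<alpha> = (\<lambda>_. 0) then 1 else 0)" for \<alpha>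
    by (auto simp: mi_monom_def fun_eq_iff power_0_left)
  have "scalar_prod (Phi (m, h) (0 :: 'd rvec)) (Phi (m, h) (0 :: 'd rvec))
      = (\<Sum>i\<in>{0..<?N}. if ?as ! i = (\<lambda>_. 0) then 1 else 0)"
    unfolding scalar_prod_def by (intro sum.cong) (auto simp: Phi_def mon)
  also have "\<dots> = real (card {i \<in> {0..<?N}. ?as ! i = (\<lambda>_. 0)})"
    by (subst sum.inter_filter[symmetric]) simp_all
  also have "card {i \<in> {0..<?N}. ?as ! i = (\<lambda>_. 0)} \<le> 1"
    using distinct_multi_indices[of m, where 'd = 'd] length_multi_indices[of m, where 'd = 'd]
    by (subst card_le_Suc0_iff_eq[unfolded One_nat_def[symmetric]], simp)
      (metis (mono_tags, lifting) atLeastLessThan_iff mem_Collect_eq nth_eq_iff_index_eq)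
  finally show ?thesis by simp
qed

lemma Phi_index_measurable:
  assumes "i < Dm TYPE('d) m"
  shows "(\<lambda>u :: 'd::{finite,linorder} rvec. vec_index (Phi (m, h) u) i) \<in> borel_measurable borel"
proof -
  have "(\<lambda>u :: 'd rvec. mi_monom (multi_indices m ! i) ((1 / h) *\<^sub>R u)) \<in> borel_measurable borel"
    unfolding mi_monom_def by (intro borel_measurable_continuous_onI continuous_intros)
  then show ?thesis using assms by (simp add: Phi_def)
qed

section \<open>Weights\<close>

lemma weight_nonneg: "0 < h \<Longrightarrow> 0 \<le> weight D t h u"
  by (simp add: weight_def)

lemma weight_le: "0 < h \<Longrightarrow> weight D t h (u :: 'd::finite rvec) \<le> 1 / h ^ CARD('d)"
  by (auto simp: weight_def indicator_def)

lemma weight_square: "(weight D t h (u :: 'd::finite rvec))\<^sup>2 = weight D t h u / h ^ CARD('d)"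
  by (auto simp: weight_def indicator_def power2_eq_square)

lemma closed_cube: "closed (cube :: 'd::finite rvec set)"
  unfolding cube_def by (auto intro!: closed_Collect_all closed_Collect_conj closed_Collect_le continuous_intros)

lemma cube_scaled_iff:
  fixes u :: "'d::finite rvec"
  assumes "0 < h"
  shows "(1 / h) *\<^sub>R u \<in> cube \<longleftrightarrow> (\<forall>j. \<bar>vec_nth u j\<bar> \<le> h)"
proof -
  have "- 1 \<le> vec_nth u j / h \<and> vec_nth u j / h \<le> 1 \<longleftrightarrow> \<bar>vec_nth u j\<bar> \<le> h" for j
    using assms by (auto simp: abs_le_iff field_simps)
  then show ?thesis by (simp add: cube_def)
qed

lemma cube_scaled_imp_infnorm_le:
  fixes u :: "'d::finite rvec"
  assumes "0 < h" "(1 / h) *\<^sub>R u \<in> cube"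
  shows "infnorm u \<le> h"
  unfolding infnorm_cart using assms cube_scaled_iff[OF assms(1)] by (intro cSup_least) auto

lemma weight_measurable [measurable]:
  assumes "closed D"
  shows "weight D t h \<in> borel_measurable borel"
proof -
  have "closed ((\<lambda>u. (1 / h) *\<^sub>R u) -` cube)"
    by (intro closed_vimage closed_cube continuous_intros)
  then have 1: "(\<lambda>u. indicator cube ((1 / h) *\<^sub>R u) :: real) \<in> borel_measurable borel"
    by (auto simp: indicator_vimage[symmetric] intro!: borel_measurable_indicator borel_closed)
  have "closed ((\<lambda>u. t + u) -` D)"
    by (intro closed_vimage assms continuous_intros)
  then have 2: "(\<lambda>u. indicator D (t + u) :: real) \<in> borel_measurable borel"
    by (auto simp: indicator_vimage[symmetric] intro!: borel_measurable_indicator borel_closed)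
  show ?thesis unfolding weight_def using 1 2 by measurable
qed

lemma
  fixes D :: "'d::finite rvec set"
  assumes D: "closed D" and h: "0 < h"
  shows weight_integrable: "integrable lborel (weight D t h)"
    and Wh_nonneg: "0 \<le> Wh D t h" and Wh_le: "Wh D t h \<le> 2 ^ CARD('d)"
proof -
  define Q :: "'d rvec set" where "Q = cbox (\<chi> j. - h) (\<chi> j. h)"
  have Q: "(1 / h) *\<^sub>R u \<in> cube \<longleftrightarrow> u \<in> Q" for u :: "'d rvec"
    unfolding cube_scaled_iff[OF h] Q_def by (auto simp: mem_box_cart abs_le_iff minus_le_iff)
  have iQ: "integrable lborel (\<lambda>u. 1 / h ^ CARD('d) * indicator Q u :: real)"
    unfolding Q_def by (intro integrable_mult_right integrable_real_indicator)
      (auto simp: emeasure_lborel_cbox_eq)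
  have le: "weight D t h u \<le> 1 / h ^ CARD('d) * indicator Q u" for u
    using h Q[of u] by (auto simp: weight_def indicator_def)
  show int: "integrable lborel (weight D t h)"
  proof (rule Bochner_Integration.integrable_bound[OF iQ])
    show "weight D t h \<in> borel_measurable lborel" using weight_measurable[OF D] by simp
    show "AE u in lborel. norm (weight D t h u) \<le> norm (1 / h ^ CARD('d) * indicator Q u :: real)"
    proof (rule AE_I2)
      fix u :: "'d rvec"
      have "norm (weight D t h u) = weight D t h u" using weight_nonneg[OF h, of D t u] by simp
      also have "\<dots> \<le> norm (1 / h ^ CARD('d) * indicator Q u :: real)"
        using le[of u] unfolding real_norm_def by linarith
      finally show "norm (weight D t h u) \<le> norm (1 / h ^ CARD('d) * indicator Q u :: real)" .
    qed
  qed
  show "0 \<le> Wh D t h" unfolding Wh_def by (intro Bochner_Integration.integral_nonneg weight_nonneg[OF h])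
  have "Wh D t h \<le> (\<integral>u. 1 / h ^ CARD('d) * indicator Q u \<partial>lborel)"
    unfolding Wh_def using int iQ le by (intro integral_mono) auto
  also have "\<dots> = 1 / h ^ CARD('d) * measure lborel Q" by simp
  also have "measure lborel Q = (2 * h) ^ CARD('d)"
    unfolding Q_def using h by (subst content_cbox_cart) (auto simp: interval_ne_empty_cart)
  also have "1 / h ^ CARD('d) * (2 * h) ^ CARD('d) = 2 ^ CARD('d)"
    using h by (simp add: power_mult_distrib)
  finally show "Wh D t h \<le> 2 ^ CARD('d)" .
qed

lemma Wh_pos:
  fixes D :: "'d::finite rvec set"
  assumes S: "open S" "D = closure S" and t: "t \<in> D" and h: "0 < h"
  shows "0 < Wh D t h"
proof -
  have D: "closed D" using S by simp
  define B :: "'d rvec set" where "B = box (t - (\<chi> j. h)) (t + (\<chi> j. h))"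
  have "t \<in> B" using h by (auto simp: B_def mem_box_cart)
  moreover have "open B" unfolding B_def by (rule open_box)
  ultimately have "B \<inter> S \<noteq> {}"
    using t S by (metis closure_iff_nhds_not_empty Int_commute order_refl)
  then obtain y where y: "y \<in> B \<inter> S" by auto
  have "open (B \<inter> S)" using S \<open>open B\<close> by blast
  then obtain e where e: "0 < e" "ball y e \<subseteq> B \<inter> S" using y open_contains_ball by blast
  have le: "1 / h ^ CARD('d) * indicator (ball (y - t) e) u \<le> weight D t h u" for u :: "'d rvec"
  proof (cases "u \<in> ball (y - t) e")
    case True
    then have "t + u \<in> ball y e" by (simp add: dist_norm algebra_simps)
    then have tu: "t + u \<in> B" "t + u \<in> S" using e by auto
    then have "\<bar>vec_nth u j\<bar> \<le> h" for j by (auto simp: B_def mem_box_cart abs_le_iff less_imp_le dest!: spec[of _ j])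
    then have "(1 / h) *\<^sub>R u \<in> cube" using cube_scaled_iff[OF h] by blast
    moreover have "t + u \<in> D" using tu(2) S(2) closure_subset by blast
    ultimately show ?thesis using True h by (simp add: weight_def)
  next
    case False
    then show ?thesis using weight_nonneg[OF h] by simp
  qed
  have "0 < 1 / h ^ CARD('d) * measure lborel (ball (y - t) e)"
    using h e by (simp add: content_ball_pos)
  also have "\<dots> = (\<integral>u. 1 / h ^ CARD('d) * indicator (ball (y - t) e) u \<partial>lborel)"
    by simp
  also have "\<dots> \<le> Wh D t h"
    unfolding Wh_def using le weight_integrable[OF D h] h
    by (intro integral_mono') (auto intro: weight_nonneg)
  finally show ?thesis .
qed

lemma lborel_integral_shift:
  fixes g :: "'d::finite rvec \<Rightarrow> real"
  assumes [measurable]: "g \<in> borel_measurable borel"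
  shows "(\<integral>y. g (y - t) \<partial>lborel) = (\<integral>u. g u \<partial>lborel)"
    and "integrable lborel (\<lambda>y. g (y - t)) \<longleftrightarrow> integrable lborel g"
proof -
  have "(\<integral>u. g u \<partial>distr lborel borel ((+) (- t))) = (\<integral>y. g (- t + y) \<partial>lborel)"
    by (intro integral_distr) auto
  then show "(\<integral>y. g (y - t) \<partial>lborel) = (\<integral>u. g u \<partial>lborel)"
    by (simp add: lborel_distr_plus)
  have "integrable (distr lborel borel ((+) (- t))) g \<longleftrightarrow> integrable lborel (\<lambda>y. g (- t + y))"
    by (intro integrable_distr_eq) auto
  then show "integrable lborel (\<lambda>y. g (y - t)) \<longleftrightarrow> integrable lborel g"
    by (simp add: lborel_distr_plus)
qed

lemma (in prob_space) expectation_weight_le: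
  fixes D :: "'d::finite rvec set"
  assumes D: "closed D" and h: "0 < h" "h \<le> \<rho>"
    and f0: "\<forall>y\<in>D. 0 \<le> f y" and F: "\<And>u. u \<in> nbhd D t \<rho> \<Longrightarrow> f (t + u) \<le> F"
    and X: "distributed M lborel X (\<lambda>y. ennreal (f y * indicator D y))"
  shows "expectation (\<lambda>\<omega>. weight D t h (X \<omega> - t)) \<le> F * Wh D t h"
proof -
  note w [measurable] = weight_measurable[OF D, of t h]
  have "expectation (\<lambda>\<omega>. weight D t h (X \<omega> - t))
      = (\<integral>y. (f y * indicator D y) * weight D t h (y - t) \<partial>lborel)"
    using f0 by (intro distributed_integral[OF X, symmetric]) (auto simp: indicator_def)
  also have "\<dots> \<le> (\<integral>y. F * weight D t h (y - t) \<partial>lborel)"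
  proof (rule integral_mono')
    show "integrable lborel (\<lambda>y. F * weight D t h (y - t))"
      using lborel_integral_shift(2)[OF w] weight_integrable[OF D h(1)] by simp
    fix y :: "'d rvec"
    have pt: "f y * indicator D y * weight D t h (y - t) \<le> F * weight D t h (y - t)
        \<and> 0 \<le> f y * indicator D y * weight D t h (y - t)"
    proof (cases "weight D t h (y - t) = 0")
      case False
      then have y: "(1 / h) *\<^sub>R (y - t) \<in> cube" "y \<in> D"
        by (auto simp: weight_def indicator_def split: if_splits)
      then have "y - t \<in> nbhd D t \<rho>"
        using cube_scaled_imp_infnorm_le[OF h(1) y(1)] h by (simp add: nbhd_def)
      then have "f y \<le> F" using F[of "y - t"] by simp
      then show ?thesis using y f0 weight_nonneg[OF h(1), of D t "y - t"]
        by (auto intro!: mult_right_mono)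
    qed simp
    then show "f y * indicator D y * weight D t h (y - t) \<le> F * weight D t h (y - t)"
      and "0 \<le> F * weight D t h (y - t)" by linarith+
  qed
  also have "\<dots> = F * Wh D t h"
    using lborel_integral_shift(1)[OF w, of t] by (simp add: Wh_def)
  finally show ?thesis .
qed

section \<open>The kernel of a local polynomial estimator\<close>

lemma gram_carrier [simp]:
  "gram (D :: 'd::{finite,linorder} rvec set) t (m, h) \<in> carrier_mat (Dm TYPE('d) m) (Dm TYPE('d) m)"
  by (simp add: gram_def)

lemma gram_symmetric: "transpose_mat (gram D t (m, h)) = gram D t (m, h)"
  by (rule eq_matI) (auto simp: gram_def mult.commute)

lemma lam_le_Rayleigh:
  fixes D :: "'d::{finite,linorder} rvec set"
  assumes "x \<in> carrier_vec (Dm TYPE('d) m)"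
  shows "lam D t (m, h) * scalar_prod x x \<le> scalar_prod x (gram D t (m, h) *\<^sub>v x)"
  unfolding lam_def by (rule Min_spectrum_le_Rayleigh[OF gram_carrier gram_symmetric Dm_pos assms])

lemma
  fixes D :: "'d::{finite,linorder} rvec set"
  assumes lam: "0 < lam D t (m, h)"
  defines "R \<equiv> the (mat_inverse (cholesky (gram D t (m, h))))"
  shows gram_Cholesky_inverse_carrier: "R \<in> carrier_mat (Dm TYPE('d) m) (Dm TYPE('d) m)"
    and Hvec_scalar_prod_le: "(1 / h) *\<^sub>R u \<in> cube \<Longrightarrow>
      \<bar>scalar_prod (Hvec D t (m, h) 0) (Hvec D t (m, h) u)\<bar>
        \<le> sqrt (real (Dm TYPE('d) m)) / lam D t (m, h)"
proof -
  let ?n = "Dm TYPE('d) m" and ?G = "gram D t (m, h)" and ?l = "lam D t (m, h)"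
  have pd: "0 < scalar_prod x (?G *\<^sub>v x)" if "x \<in> carrier_vec ?n" "x \<noteq> 0\<^sub>v ?n" for x
    using mult_pos_pos[OF lam scalar_prod_self_pos[OF that]] lam_le_Rayleigh[OF that(1), of D t h]
    by linarith
  note chol = cholesky_properties[OF gram_carrier gram_symmetric pd]
  note inv = cholesky_inverse[OF gram_carrier gram_symmetric pd, folded R_def]
  show R: "R \<in> carrier_mat ?n ?n" by (rule inv(1))
  assume u: "(1 / h) *\<^sub>R u \<in> cube"
  have "\<bar>scalar_prod (R *\<^sub>v Phi (m, h) (0 :: 'd rvec)) (R *\<^sub>v Phi (m, h) u)\<bar>
      \<le> sqrt (scalar_prod (Phi (m, h) (0 :: 'd rvec)) (Phi (m, h) (0 :: 'd rvec)))
        * sqrt (scalar_prod (Phi (m, h) u) (Phi (m, h) u)) / ?l"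
    by (rule inverse_Cholesky_scalar_prod_le[of ?G ?n "cholesky ?G"])
      (use chol inv lam lam_le_Rayleigh in auto)
  also have "\<dots> \<le> 1 * sqrt (real ?n) / ?l"
    using lam Phi_zero_norm_le Phi_norm_le[OF u] scalar_prod_self_nonneg
    by (intro divide_right_mono mult_mono) auto
  finally show "\<bar>scalar_prod (Hvec D t (m, h) 0) (Hvec D t (m, h) u)\<bar> \<le> sqrt (real ?n) / ?l"
    by (simp add: Hvec_def R_def)
qed

lemma lp_kernel_measurable:
  fixes D :: "'d::{finite,linorder} rvec set"
  assumes D: "closed D" and lam: "0 < lam D t (m, h)"
  shows "lp_kernel D t (m, h) \<in> borel_measurable borel"
proof -
  let ?n = "Dm TYPE('d) m"
  define R where "R = the (mat_inverse (cholesky (gram D t (m, h))))"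
  have R: "R \<in> carrier_mat ?n ?n" unfolding R_def by (rule gram_Cholesky_inverse_carrier[OF lam])
  have H0: "Hvec D t (m, h) 0 \<in> carrier_vec ?n" using R by (simp add: Hvec_def R_def[symmetric])
  have "lp_kernel D t (m, h) u = (\<Sum>i<?n. \<Sum>j<?n. vec_index (Hvec D t (m, h) 0) i * R $$ (i, j)
      * vec_index (Phi (m, h) u) j) * weight D t h u" for u
    using scalar_prod_mult_mat_vec[OF R H0 Phi_carrier, of h u]
    by (simp add: lp_kernel_def Hvec_def[of D t "(m, h)" u] R_def[symmetric])
  moreover have "(\<lambda>u. (\<Sum>i<?n. \<Sum>j<?n. vec_index (Hvec D t (m, h) 0) i * R $$ (i, j)
      * vec_index (Phi (m, h) u) j) * weight D t h u) \<in> borel_measurable borel"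
    using Phi_index_measurable weight_measurable[OF D]
    by (intro borel_measurable_times borel_measurable_sum borel_measurable_const) auto
  ultimately show ?thesis by (metis (no_types, lifting) ext)
qed

lemma lp_kernel_abs_le_weight:
  fixes D :: "'d::{finite,linorder} rvec set"
  assumes lam: "0 < lam D t (m, h)" and h: "0 < h"
  shows "\<bar>lp_kernel D t (m, h) u\<bar> \<le> sqrt (real (Dm TYPE('d) m)) / lam D t (m, h) * weight D t h u"
proof (cases "(1 / h) *\<^sub>R u \<in> cube")
  case True
  show ?thesis
    using Hvec_scalar_prod_le[OF lam True] weight_nonneg[OF h, of D t u]
    by (simp add: lp_kernel_def abs_mult mult_right_mono del: times_divide_eq_left)
next
  case False
  then show ?thesis by (simp add: lp_kernel_def weight_def)
qed

lemma lp_kernel_abs_le: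
  fixes D :: "'d::{finite,linorder} rvec set"
  assumes lam: "0 < lam D t (m, h)" and h: "0 < h"
  shows "\<bar>lp_kernel D t (m, h) u\<bar> \<le> sqrt (real (Dm TYPE('d) m)) / (h ^ CARD('d) * lam D t (m, h))"
proof -
  have "\<bar>lp_kernel D t (m, h) u\<bar> \<le> sqrt (real (Dm TYPE('d) m)) / lam D t (m, h) * (1 / h ^ CARD('d))"
    using lam h weight_le[OF h, of D t u]
    by (intro order_trans[OF lp_kernel_abs_le_weight] mult_left_mono) auto
  then show ?thesis by (simp add: mult.commute)
qed

lemma (in prob_space) expectation_lp_kernel_square_le:
  fixes D :: "'d::{finite,linorder} rvec set"
  assumes D: "closed D" and h: "0 < h" "h \<le> \<rho>" and lam: "0 < lam D t (m, h)"
    and f0: "\<forall>y\<in>D. 0 \<le> f y" and F: "\<And>u. u \<in> nbhd D t \<rho> \<Longrightarrow> f (t + u) \<le> F"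
    and X: "distributed M lborel X (\<lambda>y. ennreal (f y * indicator D y))"
  shows "expectation (\<lambda>\<omega>. (lp_kernel D t (m, h) (X \<omega> - t))\<^sup>2)
    \<le> real (Dm TYPE('d) m) / ((lam D t (m, h))\<^sup>2 * h ^ CARD('d)) * (F * Wh D t h)"
proof -
  let ?c = "real (Dm TYPE('d) m) / ((lam D t (m, h))\<^sup>2 * h ^ CARD('d))"
  have Xm [measurable]: "X \<in> borel_measurable M" using X by (simp add: distributed_def)
  note w [measurable] = weight_measurable[OF D, of t h]
  have pt: "(lp_kernel D t (m, h) u)\<^sup>2 \<le> ?c * weight D t h u" for u
  proof -
    have "\<bar>lp_kernel D t (m, h) u\<bar>\<^sup>2 \<le> (sqrt (real (Dm TYPE('d) m)) / lam D t (m, h) * weight D t h u)\<^sup>2"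
      by (intro power_mono lp_kernel_abs_le_weight[OF lam h(1)]) simp
    also have "\<dots> = ?c * weight D t h u"
      by (simp add: power_mult_distrib power_divide weight_square)
    finally show ?thesis by simp
  qed
  have iw: "integrable M (\<lambda>\<omega>. weight D t h (X \<omega> - t))"
    using weight_le[OF h(1), of D t] weight_nonneg[OF h(1), of D t]
    by (intro integrable_bounded[where B = "1 / h ^ CARD('d)"]) (auto simp: abs_of_nonneg)
  have "expectation (\<lambda>\<omega>. (lp_kernel D t (m, h) (X \<omega> - t))\<^sup>2)
      \<le> expectation (\<lambda>\<omega>. ?c * weight D t h (X \<omega> - t))"
    using iw pt weight_nonneg[OF h(1), of D t] h(1) by (intro integral_mono') auto
  also have "\<dots> = ?c * expectation (\<lambda>\<omega>. weight D t h (X \<omega> - t))" by simp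
  also have "\<dots> \<le> ?c * (F * Wh D t h)"
    using expectation_weight_le[OF D h f0 F X] h(1) by (intro mult_left_mono) auto
  finally show ?thesis .
qed

section \<open>Selection by pairwise comparison\<close>

text \<open>
  The number \<open>E \<gamma>\<close> is the mean of the estimate \<open>F \<gamma>\<close>, \<open>U\<close> the data-driven majorant and \<open>Z\<close> an
  excess valid for all indices at once.
\<close>

lemma pairwise_selection_oracle:
  fixes F E U :: "nat \<times> real \<Rightarrow> real" and f0 B Z :: real
  assumes G: "finite G" "\<gamma> \<in> G" "inj_on snd G"
    and U0: "\<And>\<gamma>. \<gamma> \<in> G \<Longrightarrow> 0 \<le> U \<gamma>" and Z0: "0 \<le> Z"
    and Z: "\<And>\<gamma>. \<gamma> \<in> G \<Longrightarrow> \<bar>F \<gamma> - E \<gamma>\<bar> \<le> U \<gamma> + Z"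
    and B: "\<And>\<gamma>'. \<gamma>' \<in> G \<Longrightarrow> gle \<gamma>' \<gamma> \<Longrightarrow> \<bar>E \<gamma>' - f0\<bar> \<le> B"
  defines "A \<equiv> \<lambda>\<gamma>. MAX \<gamma>'\<in>G. max (\<bar>F (gmax \<gamma> \<gamma>') - F \<gamma>'\<bar> - U (gmax \<gamma> \<gamma>') - U \<gamma>') 0"
  assumes g: "g \<in> G" and crit: "A g + U g \<le> A \<gamma> + U \<gamma>"
  shows "\<bar>F g - f0\<bar> \<le> 5 * B + \<bar>F \<gamma> - E \<gamma>\<bar> + 2 * U \<gamma> + 4 * Z"
proof -
  have A_ge: "\<bar>F (gmax \<gamma>1 \<gamma>2) - F \<gamma>2\<bar> \<le> A \<gamma>1 + U (gmax \<gamma>1 \<gamma>2) + U \<gamma>2" if "\<gamma>2 \<in> G" for \<gamma>1 \<gamma>2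
  proof -
    have "max (\<bar>F (gmax \<gamma>1 \<gamma>2) - F \<gamma>2\<bar> - U (gmax \<gamma>1 \<gamma>2) - U \<gamma>2) 0 \<le> A \<gamma>1"
      unfolding A_def using G that by (intro Max_ge) auto
    then show ?thesis by linarith
  qed
  have B\<gamma>: "\<bar>E \<gamma> - f0\<bar> \<le> B" using B[OF G(2)] by (simp add: gle_def)
  have A_le: "A \<gamma> \<le> 2 * B + 2 * Z"
    unfolding A_def
  proof (rule Max.boundedI)
    fix y assume "y \<in> (\<lambda>\<gamma>'. max (\<bar>F (gmax \<gamma> \<gamma>') - F \<gamma>'\<bar> - U (gmax \<gamma> \<gamma>') - U \<gamma>') 0) ` G"
    then obtain \<gamma>' where \<gamma>': "\<gamma>' \<in> G"
      "y = max (\<bar>F (gmax \<gamma> \<gamma>') - F \<gamma>'\<bar> - U (gmax \<gamma> \<gamma>') - U \<gamma>') 0" by auto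
    show "y \<le> 2 * B + 2 * Z"
    proof (cases "gle \<gamma> \<gamma>'")
      case True
      then show ?thesis using \<gamma>' U0[OF \<gamma>'(1)] B\<gamma> Z0 by (simp add: gmax_def)
    next
      case False
      then have "\<bar>E \<gamma>' - f0\<bar> \<le> B" using B[OF \<gamma>'(1)] by (simp add: gle_def)
      then show ?thesis
        using \<gamma>'(2) False B\<gamma> Z[OF \<gamma>'(1)] Z[OF G(2)] Z0 by (simp add: gmax_def)
    qed
  qed (use G in auto)
  have A0: "0 \<le> A \<gamma>" unfolding A_def
    using G by (meson Max_ge finite_imageI imageI max.cobounded2 order_trans)
  have A0g: "0 \<le> A g" unfolding A_def
    using G by (meson Max_ge finite_imageI imageI max.cobounded2 order_trans)
  have "\<bar>F g - F \<gamma>\<bar> \<le> 2 * A \<gamma> + 2 * U \<gamma>"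
  proof (cases "gle g \<gamma>")
    case True
    show ?thesis
    proof (cases "gle \<gamma> g")
      case True
      \<comment> \<open>Two indices of the grid with the same bandwidth coincide.\<close>
      with \<open>gle g \<gamma>\<close> have "g = \<gamma>" using G g by (auto simp: gle_def inj_on_def)
      then show ?thesis using A0 U0[OF G(2)] by simp
    next
      case False
      then show ?thesis using A_ge[OF g, of \<gamma>] crit A0g by (simp add: gmax_def abs_minus_commute)
    qed
  next
    case False
    then show ?thesis using A_ge[OF G(2), of g] crit A0 U0[OF G(2)] by (simp add: gmax_def)
  qed
  then show ?thesis using A_le B\<gamma> by linarith
qed

section \<open>Bandwidths and the selection grid\<close>

lemma finite_levels: "finite (levels D t \<rho> n)"
  by (rule finite_subset[of _ "{..nat \<lfloor>ln (real n)\<rfloor>}"]) (auto simp: levels_def)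

lemma finite_Gam: "finite (Gam D t \<rho> m n)"
  by (simp add: Gam_def finite_levels)

lemma bandwidth_eq_iff: "0 < \<rho> \<Longrightarrow> bandwidth \<rho> l = bandwidth \<rho> l' \<longleftrightarrow> l = l'"
  by (simp add: bandwidth_def)

lemma bandwidth_pos: "0 < \<rho> \<Longrightarrow> 0 < bandwidth \<rho> l"
  by (simp add: bandwidth_def)

lemma bandwidth_le: "0 < \<rho> \<Longrightarrow> bandwidth \<rho> l \<le> \<rho>"
  by (simp add: bandwidth_def)

lemma ln_bandwidth: "0 < \<rho> \<Longrightarrow> ln (bandwidth \<rho> l) = ln \<rho> - real l"
  by (simp add: bandwidth_def ln_mult)

lemma inj_on_snd_Gam: "0 < \<rho> \<Longrightarrow> inj_on snd (Gam D t \<rho> m n)"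
  by (auto simp: inj_on_def Gam_def bandwidth_eq_iff)

text \<open>
  So \<open>2 * pen \<ge> 1\<close>, which makes \<open>Ustar\<close> an upper bound of \<open>sqrt vstar\<close>.
\<close>

lemma pen_ge_1:
  fixes D :: "'d::{finite,linorder} rvec set"
  assumes "0 < h" "h \<le> exp (- 1)" "1 \<le> \<delta>"
  shows "1 \<le> pen D t \<delta> (k, h)"
proof -
  have "ln h \<le> - 1" using assms by (metis exp_gt_zero ln_exp ln_le_cancel_iff)
  then have "1 * 1 * 1 \<le> real CARD('d) * \<delta> * \<bar>ln h\<bar>"
    using assms by (intro mult_mono) (auto simp: Suc_leI)
  then show ?thesis by (simp add: pen_def Lampar_def)
qed

section \<open>Local polynomial estimators under a bounded density\<close>

text \<open>
  An independent sample with density \<open>f\<close> on the closed set \<open>D\<close>, bounded on \<open>nbhd D t \<rho>\<close> (read as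
  a subset of the translate of \<open>D\<close> by \<open>- t\<close>).
\<close>

locale bounded_density_sample = prob_space M for M :: "'a measure" +
  fixes D :: "'d::{finite,linorder} rvec set" and t :: "'d rvec" and \<rho> :: real
    and f :: "'d rvec \<Rightarrow> real" and X :: "nat \<Rightarrow> 'a \<Rightarrow> 'd rvec"
  assumes closed_D: "closed D"
    and f_nonneg: "\<forall>y\<in>D. 0 \<le> f y"
    and X_density: "\<forall>i\<ge>1. distributed M lborel (X i) (\<lambda>y. ennreal (f y * indicator D y))"
    and X_indep: "indep_vars (\<lambda>_. borel) X {1..}"
    and f_bounded: "bdd_above ((\<lambda>u. \<bar>f (t + u)\<bar>) ` nbhd D t \<rho>)"
begin

lemma density_le_fnorm: "u \<in> nbhd D t \<rho> \<Longrightarrow> f (t + u) \<le> fnorm D t \<rho> f"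
  unfolding fnorm_def by (rule cSUP_upper2[OF f_bounded]) auto

lemma X_measurable: "1 \<le> i \<Longrightarrow> X i \<in> borel_measurable M"
  using X_density by (auto simp: distributed_def)

context
  fixes n k :: nat and h :: real
  assumes n: "0 < n" and h: "0 < h" "h \<le> \<rho>" and lam: "0 < lam D t (k, h)"
begin

text \<open>
  The summands of the estimator with index \<open>(k, h)\<close>.
\<close>

abbreviation "kern i \<omega> \<equiv> lp_kernel D t (k, h) (X i \<omega> - t)"

lemma kern_measurable: "1 \<le> i \<Longrightarrow> kern i \<in> borel_measurable M"
  using X_measurable[of i] lp_kernel_measurable[OF closed_D lam] by measurable

lemma kern_abs_le: "\<bar>kern i \<omega>\<bar> \<le> real n * cpar D t n (k, h)"
  using lp_kernel_abs_le[OF lam h(1)] n by (simp add: cpar_def)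

lemma kern_indep: "indep_vars (\<lambda>_. borel) kern {1..n}"
proof -
  have "indep_vars (\<lambda>_. borel) X {1..n}" by (rule indep_vars_subset[OF X_indep]) auto
  then show ?thesis
    using lp_kernel_measurable[OF closed_D lam]
    by (intro indep_vars_compose2[where Y = "\<lambda>_ y. lp_kernel D t (k, h) (y - t)"]) auto
qed

lemma kern_identically_distributed:
  assumes [measurable]: "g \<in> borel_measurable borel" and "1 \<le> i"
  shows "expectation (\<lambda>\<omega>. g (kern i \<omega>)) = expectation (\<lambda>\<omega>. g (kern 1 \<omega>) :: real)"
proof -
  note [measurable] = lp_kernel_measurable[OF closed_D lam]
  have "(\<integral>y. (f y * indicator D y) * g (lp_kernel D t (k, h) (y - t)) \<partial>lborel)
      = expectation (\<lambda>\<omega>. g (kern i \<omega>))" if "1 \<le> i" for i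
    using X_density f_nonneg that by (intro distributed_integral) (auto simp: indicator_def)
  from this[OF \<open>1 \<le> i\<close>] this[of 1] show ?thesis by simp
qed

text \<open>
  Second moment of the kernel at one observation divided by \<open>n\<close>; also the mean of \<open>vhat\<close>.
\<close>

definition "second_moment = expectation (\<lambda>\<omega>. (kern 1 \<omega>)\<^sup>2) / real n"

lemma kern_second_moment:
  "1 \<le> i \<Longrightarrow> expectation (\<lambda>\<omega>. (kern i \<omega>)\<^sup>2) = real n * second_moment"
  using kern_identically_distributed[of "\<lambda>y. y\<^sup>2" i] n by (simp add: second_moment_def)

lemma vstar_eq: "vstar f D t \<rho> n (k, h) = real (Dm TYPE('d) k) / ((lam D t (k, h))\<^sup>2 * h ^ CARD('d))
    * (fnorm D t \<rho> f * Wh D t h) / real n"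
proof -
  have "(Wh D t h * sqrt (real (Dm TYPE('d) k)) / lam D t (k, h))\<^sup>2
      = (Wh D t h)\<^sup>2 * real (Dm TYPE('d) k) / (lam D t (k, h))\<^sup>2"
    by (simp add: power_mult_distrib power_divide)
  then show ?thesis
    by (cases "Wh D t h = 0") (simp_all add: vstar_def power2_eq_square mult_ac)
qed

lemma second_moment_le: "second_moment \<le> vstar f D t \<rho> n (k, h)"
  unfolding second_moment_def vstar_eq
  using expectation_lp_kernel_square_le[OF closed_D h lam f_nonneg density_le_fnorm] X_density
  by (intro divide_right_mono) auto

lemma fhat_eq: "fhat D t n (\<lambda>i. X i \<omega>) (k, h) = (\<Sum>i=1..n. kern i \<omega>) / real n"
  by (simp add: fhat_def)

lemma vhat_eq: "vhat D t n (\<lambda>i. X i \<omega>) (k, h) = (\<Sum>i=1..n. (kern i \<omega>)\<^sup>2) / (real n)\<^sup>2"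
  by (simp add: vhat_def)

lemma kern_integrable: "1 \<le> i \<Longrightarrow> integrable M (kern i)"
  using kern_measurable kern_abs_le by (intro integrable_bounded) auto

lemma kern_square_integrable: "1 \<le> i \<Longrightarrow> integrable M (\<lambda>\<omega>. (kern i \<omega>)\<^sup>2)"
proof (rule integrable_bounded[where B = "(real n * cpar D t n (k, h))\<^sup>2"])
  show "\<bar>(kern i \<omega>)\<^sup>2\<bar> \<le> (real n * cpar D t n (k, h))\<^sup>2" for \<omega>
    using power_mono[OF kern_abs_le[of i \<omega>], of 2] by simp
qed (use kern_measurable[of i] in simp)

lemma expectation_fhat: "expectation (\<lambda>\<omega>. fhat D t n (\<lambda>i. X i \<omega>) (k, h)) = expectation (kern 1)"
proof -
  have "expectation (\<lambda>\<omega>. fhat D t n (\<lambda>i. X i \<omega>) (k, h)) = (\<Sum>i=1..n. expectation (kern i)) / real n"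
    unfolding fhat_eq using kern_integrable by simp
  also have "\<dots> = (\<Sum>i=1..n. expectation (kern 1)) / real n"
  proof -
    have "expectation (kern i) = expectation (kern 1)" if "i \<in> {1..n}" for i
      using kern_identically_distributed[of "\<lambda>y. y" i] that by simp
    then show ?thesis by (metis (no_types, lifting) sum.cong)
  qed
  finally show ?thesis using n by simp
qed

lemma expectation_kern:
  "1 \<le> i \<Longrightarrow> expectation (kern i) = expectation (\<lambda>\<omega>. fhat D t n (\<lambda>i. X i \<omega>) (k, h))"
  unfolding expectation_fhat using kern_identically_distributed[of "\<lambda>y. y" i] by simp

lemma cpar_pos: "0 < cpar D t n (k, h)"
  using n h lam Dm_pos[of k, where 'd = 'd] by (simp add: cpar_def)

lemma fhat_measurable: "(\<lambda>\<omega>. fhat D t n (\<lambda>i. X i \<omega>) (k, h)) \<in> borel_measurable M"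
  unfolding fhat_eq using kern_measurable by (intro borel_measurable_divide borel_measurable_sum) auto

lemma vhat_measurable: "(\<lambda>\<omega>. vhat D t n (\<lambda>i. X i \<omega>) (k, h)) \<in> borel_measurable M"
  unfolding vhat_eq using kern_measurable
  by (intro borel_measurable_divide borel_measurable_sum borel_measurable_power) auto

lemma fhat_abs_le: "\<bar>fhat D t n x (k, h)\<bar> \<le> real n * cpar D t n (k, h)"
proof -
  have "\<bar>\<Sum>i=1..n. lp_kernel D t (k, h) (x i - t)\<bar> \<le> (\<Sum>i=1..n. real n * cpar D t n (k, h))"
    using lp_kernel_abs_le[OF lam h(1)] n
    by (intro order_trans[OF sum_abs] sum_mono) (simp add: cpar_def)
  also have "\<dots> = real n * (real n * cpar D t n (k, h))" by simp
  finally show ?thesis using n by (simp add: fhat_def abs_mult divide_le_eq mult.commute)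
qed

lemma vhat_nonneg: "0 \<le> vhat D t n x (k, h)"
  by (auto simp: vhat_def intro!: divide_nonneg_nonneg sum_nonneg)

lemma expectation_vhat: "integrable M (\<lambda>\<omega>. vhat D t n (\<lambda>i. X i \<omega>) (k, h))"
  "expectation (\<lambda>\<omega>. vhat D t n (\<lambda>i. X i \<omega>) (k, h)) = second_moment"
proof -
  show "integrable M (\<lambda>\<omega>. vhat D t n (\<lambda>i. X i \<omega>) (k, h))"
    unfolding vhat_eq
    by (intro integrable_divide Bochner_Integration.integrable_sum kern_square_integrable) auto
  have "expectation (\<lambda>\<omega>. vhat D t n (\<lambda>i. X i \<omega>) (k, h))
      = (\<Sum>i=1..n. expectation (\<lambda>\<omega>. (kern i \<omega>)\<^sup>2)) / (real n)\<^sup>2"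
    unfolding vhat_eq using kern_square_integrable by simp
  also have "\<dots> = (\<Sum>i=1..n. real n * second_moment) / (real n)\<^sup>2"
  proof -
    have "expectation (\<lambda>\<omega>. (kern i \<omega>)\<^sup>2) = real n * second_moment" if "i \<in> {1..n}" for i
      using kern_second_moment that by simp
    then show ?thesis by (metis (no_types, lifting) sum.cong)
  qed
  finally show "expectation (\<lambda>\<omega>. vhat D t n (\<lambda>i. X i \<omega>) (k, h)) = second_moment"
    using n by (simp add: power2_eq_square)
qed

lemma deviation_square_integrable:
  "integrable M (\<lambda>\<omega>. (\<bar>fhat D t n (\<lambda>i. X i \<omega>) (k, h)
     - expectation (\<lambda>\<omega>. fhat D t n (\<lambda>i. X i \<omega>) (k, h))\<bar>)\<^sup>2)" (is "integrable M (\<lambda>\<omega>. \<bar>?F \<omega> - ?E\<bar>\<^sup>2)")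
proof (rule integrable_bounded[where B = "(real n * cpar D t n (k, h) + \<bar>?E\<bar>)\<^sup>2"])
  show "\<bar>\<bar>?F \<omega> - ?E\<bar>\<^sup>2\<bar> \<le> (real n * cpar D t n (k, h) + \<bar>?E\<bar>)\<^sup>2" for \<omega>
  proof -
    have "\<bar>?F \<omega> - ?E\<bar> \<le> real n * cpar D t n (k, h) + \<bar>?E\<bar>"
      using fhat_abs_le[of "\<lambda>i. X i \<omega>"] by linarith
    then show ?thesis using power_mono[of "\<bar>?F \<omega> - ?E\<bar>" _ 2] by simp
  qed
qed (use fhat_measurable in measurable)

lemma vstar_nonneg: "0 \<le> vstar f D t \<rho> n (k, h)"
proof -
  have "0 \<le> second_moment" by (simp add: second_moment_def)
  then show ?thesis using second_moment_le by linarith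
qed

lemma Ustar_nonneg: "1 \<le> pen D t \<delta> (k, h) \<Longrightarrow> 0 \<le> Ustar f D t \<rho> \<delta> n (k, h)"
  unfolding Ustar_def rfun_def using vstar_nonneg cpar_pos by (intro add_nonneg_nonneg) auto

lemma L2norm_deviation_le:
  assumes "1 \<le> pen D t \<delta> (k, h)"
  shows "L2norm M (\<lambda>\<omega>. \<bar>fhat D t n (\<lambda>i. X i \<omega>) (k, h)
     - expectation (\<lambda>\<omega>. fhat D t n (\<lambda>i. X i \<omega>) (k, h))\<bar>) \<le> Ustar f D t \<rho> \<delta> n (k, h)"
proof -
  let ?v = "vstar f D t \<rho> n (k, h)" and ?x = "pen D t \<delta> (k, h)"
  have "L2norm M (\<lambda>\<omega>. \<bar>fhat D t n (\<lambda>i. X i \<omega>) (k, h)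
     - expectation (\<lambda>\<omega>. fhat D t n (\<lambda>i. X i \<omega>) (k, h))\<bar>) \<le> sqrt second_moment"
    using L2norm_sample_mean_le[OF n kern_indep kern_abs_le expectation_kern] kern_second_moment
    by (simp add: L2norm_def fhat_eq)
  also have "\<dots> \<le> sqrt (2 * ?v * ?x)"
  proof (rule real_sqrt_le_mono)
    have "?v * 1 \<le> ?v * (2 * ?x)" using vstar_nonneg assms by (intro mult_left_mono) auto
    then show "second_moment \<le> 2 * ?v * ?x" using second_moment_le by simp
  qed
  also have "\<dots> \<le> Ustar f D t \<rho> \<delta> n (k, h)"
    using cpar_pos assms by (simp add: Ustar_def rfun_def)
  finally show ?thesis .
qed

lemma epspar_eq_vstar:
  assumes "fnorm D t \<rho> f \<noteq> 0"
  shows "epspar D t \<delta> n (k, h) = (\<delta> - 1) / fnorm D t \<rho> f * vstar f D t \<rho> n (k, h)"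
  unfolding vstar_eq epspar_def using assms by (simp add: mult_ac)

lemma epspar_nonneg: "1 \<le> \<delta> \<Longrightarrow> 0 \<le> epspar D t \<delta> n (k, h)"
  using h Wh_nonneg[OF closed_D h(1)] by (simp add: epspar_def)

lemma Uhat_nonneg:
  assumes "1 \<le> \<delta>" "0 \<le> pen D t \<delta> (k, h)"
  shows "0 \<le> Uhat D t \<delta> n x (k, h)"
  unfolding Uhat_def rfun_def using assms vhat_nonneg epspar_nonneg cpar_pos
  by (intro add_nonneg_nonneg) auto

lemma Uhat_measurable: "(\<lambda>\<omega>. Uhat D t \<delta> n (\<lambda>i. X i \<omega>) (k, h)) \<in> borel_measurable M"
  unfolding Uhat_def rfun_def using vhat_measurable by measurable

lemma Uhat_square_integrable:
  assumes "1 \<le> \<delta>" "0 \<le> pen D t \<delta> (k, h)"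
  shows "integrable M (\<lambda>\<omega>. (Uhat D t \<delta> n (\<lambda>i. X i \<omega>) (k, h))\<^sup>2)"
proof (rule Bochner_Integration.integrable_bound)
  let ?v = "\<lambda>\<omega>. vhat D t n (\<lambda>i. X i \<omega>) (k, h) + epspar D t \<delta> n (k, h)"
    and ?x = "pen D t \<delta> (k, h)" and ?c = "cpar D t n (k, h)"
  show "integrable M (\<lambda>\<omega>. 2 * (2 * ?v \<omega> * ?x) + 2 * (?c * ?x)\<^sup>2)"
    using expectation_vhat(1) by simp
  show "AE \<omega> in M. norm ((Uhat D t \<delta> n (\<lambda>i. X i \<omega>) (k, h))\<^sup>2) \<le> norm (2 * (2 * ?v \<omega> * ?x) + 2 * (?c * ?x)\<^sup>2)"
  proof (rule AE_I2)
    fix \<omega>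
    let ?s = "sqrt (2 * ?v \<omega> * ?x)"
    have s2: "?s\<^sup>2 = 2 * ?v \<omega> * ?x"
      using assms vhat_nonneg epspar_nonneg by (intro real_sqrt_pow2) auto
    have "0 \<le> (?s - ?c * ?x)\<^sup>2" by simp
    then have "(?s + ?c * ?x)\<^sup>2 \<le> 2 * ?s\<^sup>2 + 2 * (?c * ?x)\<^sup>2"
      by (simp add: power2_sum power2_diff)
    then show "norm ((Uhat D t \<delta> n (\<lambda>i. X i \<omega>) (k, h))\<^sup>2) \<le> norm (2 * (2 * ?v \<omega> * ?x) + 2 * (?c * ?x)\<^sup>2)"
      unfolding s2 by (simp add: Uhat_def rfun_def)
  qed
qed (use Uhat_measurable in measurable)

lemma L2norm_Uhat_le:
  assumes F: "0 < fnorm D t \<rho> f" and \<delta>: "1 \<le> \<delta>" and x: "1 \<le> pen D t \<delta> (k, h)"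
  shows "L2norm M (\<lambda>\<omega>. Uhat D t \<delta> n (\<lambda>i. X i \<omega>) (k, h))
    \<le> (1 + sqrt ((\<delta> - 1) / fnorm D t \<rho> f)) * Ustar f D t \<rho> \<delta> n (k, h)"
proof -
  let ?e = "epspar D t \<delta> n (k, h)" and ?x = "pen D t \<delta> (k, h)" and ?c = "cpar D t n (k, h)"
    and ?w = "vstar f D t \<rho> n (k, h)"
  define q where "q = (\<delta> - 1) / fnorm D t \<rho> f"
  define s where "s \<omega> = sqrt (2 * (vhat D t n (\<lambda>i. X i \<omega>) (k, h) + ?e) * ?x)" for \<omega>
  have q: "0 \<le> q" using F \<delta> by (simp add: q_def)
  have s2: "(s \<omega>)\<^sup>2 = 2 * (vhat D t n (\<lambda>i. X i \<omega>) (k, h) + ?e) * ?x" for \<omega>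
    unfolding s_def using x \<delta> vhat_nonneg epspar_nonneg by (intro real_sqrt_pow2) auto
  have "L2norm M (\<lambda>\<omega>. Uhat D t \<delta> n (\<lambda>i. X i \<omega>) (k, h)) \<le> L2norm M s + L2norm M (\<lambda>_. ?c * ?x)"
    unfolding Uhat_def rfun_def s_def[symmetric]
    using expectation_vhat(1) by (intro L2norm_add_le) (simp_all add: s2)
  also have "L2norm M (\<lambda>_. ?c * ?x) = ?c * ?x" using cpar_pos x by (simp add: L2norm_const)
  also have "L2norm M s = sqrt (2 * (second_moment + ?e) * ?x)"
    unfolding L2norm_def s2 using expectation_vhat by (simp add: prob_space)
  also have "\<dots> \<le> sqrt (2 * ?w * ?x + q * (2 * ?w * ?x))"
  proof (rule real_sqrt_le_mono)
    have "2 * (second_moment + ?e) * ?x \<le> 2 * (?w + q * ?w) * ?x"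
      using second_moment_le epspar_eq_vstar[of \<delta>] F x
      by (intro mult_right_mono mult_left_mono) (auto simp: q_def)
    then show "2 * (second_moment + ?e) * ?x \<le> 2 * ?w * ?x + q * (2 * ?w * ?x)"
      by (simp add: algebra_simps)
  qed
  also have "\<dots> \<le> sqrt (2 * ?w * ?x) + sqrt (q * (2 * ?w * ?x))"
    using q x vstar_nonneg by (intro sqrt_add_le_add_sqrt) auto
  also have "sqrt (q * (2 * ?w * ?x)) = sqrt q * sqrt (2 * ?w * ?x)"
    by (rule real_sqrt_mult)
  finally have "L2norm M (\<lambda>\<omega>. Uhat D t \<delta> n (\<lambda>i. X i \<omega>) (k, h))
      \<le> sqrt (2 * ?w * ?x) + sqrt q * sqrt (2 * ?w * ?x) + ?c * ?x" by simp
  also have "\<dots> \<le> (1 + sqrt q) * (sqrt (2 * ?w * ?x) + ?c * ?x)"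
    using q cpar_pos x by (simp add: algebra_simps)
  finally show ?thesis by (simp add: q_def Ustar_def rfun_def)
qed

lemma expectation_excess_le:
  assumes F: "0 < fnorm D t \<rho> f" and \<delta>: "1 < \<delta>" and x: "1 \<le> pen D t \<delta> (k, h)"
    and W: "0 < Wh D t h"
  shows "expectation (\<lambda>\<omega>. (max 0 (\<bar>fhat D t n (\<lambda>i. X i \<omega>) (k, h)
      - expectation (\<lambda>\<omega>. fhat D t n (\<lambda>i. X i \<omega>) (k, h))\<bar> - Uhat D t \<delta> n (\<lambda>i. X i \<omega>) (k, h)))\<^sup>2)
    \<le> 4 * (vstar f D t \<rho> n (k, h) + epspar D t \<delta> n (k, h) + 2 * (cpar D t n (k, h))\<^sup>2)
        * exp (- pen D t \<delta> (k, h))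
      + 4 * (real n * cpar D t n (k, h))\<^sup>2
        * exp (- ((\<delta> - 1)\<^sup>2 / (8 * fnorm D t \<rho> f) * (real n * h ^ CARD('d) * Wh D t h)))"
proof -
  let ?e = "epspar D t \<delta> n (k, h)" and ?w = "vstar f D t \<rho> n (k, h)" and ?c = "cpar D t n (k, h)"
    and ?F = "fnorm D t \<rho> f" and ?l = "lam D t (k, h)" and ?N = "real (Dm TYPE('d) k)"
  have N: "0 < ?N" using Dm_pos by simp
  have w: "0 < ?w" unfolding vstar_eq using N lam h F W n by simp
  have e: "0 < ?e" using epspar_eq_vstar[of \<delta>] F \<delta> w by simp
  have expo: "?e\<^sup>2 * (real n)\<^sup>2 / (8 * (real n * ?c)\<^sup>2 * ?w)
      = (\<delta> - 1)\<^sup>2 / (8 * ?F) * (real n * h ^ CARD('d) * Wh D t h)"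
  proof -
    have c2: "(real n * ?c)\<^sup>2 = ?N / ((h ^ CARD('d))\<^sup>2 * ?l\<^sup>2)"
      using n by (simp add: cpar_def power_mult_distrib power_divide)
    have w': "?w = (real n * ?c)\<^sup>2 * (h ^ CARD('d) * Wh D t h * ?F / real n)"
      unfolding vstar_eq c2 using h lam by (simp add: power2_eq_square field_simps)
    have e': "?e = (\<delta> - 1) / ?F * ?w" using epspar_eq_vstar[of \<delta>] F by simp
    have "?e\<^sup>2 * (real n)\<^sup>2 / (8 * (real n * ?c)\<^sup>2 * ?w)
        = ((\<delta> - 1) / ?F)\<^sup>2 * (real n)\<^sup>2 * (?w / (8 * (real n * ?c)\<^sup>2))"
      unfolding e' using w by (simp add: power2_eq_square)
    also have "?w / (8 * (real n * ?c)\<^sup>2) = h ^ CARD('d) * Wh D t h * ?F / real n / 8"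
      unfolding w' using n cpar_pos by simp
    finally show ?thesis using n F by (simp add: power2_eq_square)
  qed
  have "expectation (\<lambda>\<omega>. (max 0 (\<bar>(\<Sum>i=1..n. kern i \<omega>) / real n
        - expectation (\<lambda>\<omega>. fhat D t n (\<lambda>i. X i \<omega>) (k, h))\<bar>
      - (sqrt (2 * ((\<Sum>i=1..n. (kern i \<omega>)\<^sup>2) / (real n)\<^sup>2 + ?e) * pen D t \<delta> (k, h))
          + real n * ?c / real n * pen D t \<delta> (k, h))))\<^sup>2)
    \<le> 4 * (?w + ?e + 2 * (real n * ?c / real n)\<^sup>2) * exp (- pen D t \<delta> (k, h))
      + 4 * (real n * ?c)\<^sup>2 * exp (- (?e\<^sup>2 * (real n)\<^sup>2 / (8 * (real n * ?c)\<^sup>2 * ?w)))"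
    by (rule empirical_Bernstein_excess[OF n kern_indep kern_abs_le expectation_kern kern_second_moment])
      (use n cpar_pos second_moment_le w e x in auto)
  then show ?thesis
    unfolding expo using n by (simp add: Uhat_def rfun_def vhat_eq fhat_eq)
qed

end

end

section \<open>Risk of the selected estimator\<close>

text \<open>
  The remainder is \<open>4\<close> times the \<open>L\<^sup>2\<close> norm of the total excess \<open>Z\<close>, the root of the sum of
  the squared excesses over all indices of the grid.
\<close>

lemma (in bounded_density_sample) risk_le_oracle:
  fixes g :: "'a \<Rightarrow> nat \<times> real"
  assumes n: "0 < n" and \<rho>: "0 < \<rho>" "\<rho> \<le> exp (- 1)" and \<delta>: "1 < \<delta>"
    and lam: "\<And>\<gamma>. \<gamma> \<in> Gam D t \<rho> m n \<Longrightarrow> 0 < lam D t \<gamma>"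
    and F: "0 < fnorm D t \<rho> f"
    and g: "\<And>\<omega>. \<omega> \<in> space M \<Longrightarrow> is_arg_min (crit D t \<rho> \<delta> m n (\<lambda>i. X i \<omega>)) (\<lambda>\<gamma>. \<gamma> \<in> Gam D t \<rho> m n) (g \<omega>)"
    and \<gamma>: "\<gamma> \<in> Gam D t \<rho> m n"
  shows "risk M (\<lambda>\<omega>. fhat D t n (\<lambda>i. X i \<omega>) (g \<omega>)) (f t)
    \<le> 5 * bias_maj M X f D t \<rho> m n \<gamma>
      + (3 + 2 * sqrt ((\<delta> - 1) / fnorm D t \<rho> f)) * Ustar f D t \<rho> \<delta> n \<gamma>
      + 4 * sqrt (\<Sum>\<gamma>'\<in>Gam D t \<rho> m n. expectation (\<lambda>\<omega>. (max 0 (\<bar>fhat D t n (\<lambda>i. X i \<omega>) \<gamma>'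
          - expectation (\<lambda>\<omega>. fhat D t n (\<lambda>i. X i \<omega>) \<gamma>')\<bar> - Uhat D t \<delta> n (\<lambda>i. X i \<omega>) \<gamma>'))\<^sup>2))"
proof -
  let ?G = "Gam D t \<rho> m n"
  define Fh where "Fh \<gamma> \<omega> = fhat D t n (\<lambda>i. X i \<omega>) \<gamma>" for \<gamma> \<omega>
  define U where "U \<gamma> \<omega> = Uhat D t \<delta> n (\<lambda>i. X i \<omega>) \<gamma>" for \<gamma> \<omega>
  define E where "E \<gamma> = expectation (Fh \<gamma>)" for \<gamma>
  define ex where "ex \<gamma> \<omega> = max 0 (\<bar>Fh \<gamma> \<omega> - E \<gamma>\<bar> - U \<gamma> \<omega>)" for \<gamma> \<omega>
  define Z where "Z \<omega> = sqrt (\<Sum>\<gamma>'\<in>?G. (ex \<gamma>' \<omega>)\<^sup>2)" for \<omega>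
  define B where "B = bias_maj M X f D t \<rho> m n \<gamma>"
  have G: "0 < h \<and> h \<le> \<rho> \<and> 0 < lam D t (k, h) \<and> 1 \<le> pen D t \<delta> (k, h)"
    if "(k, h) \<in> ?G" for k h
  proof -
    have h: "0 < h" "h \<le> \<rho>" using that \<rho> bandwidth_pos bandwidth_le by (auto simp: Gam_def)
    then show ?thesis using lam[OF that] pen_ge_1[of h \<delta> D t k] \<rho> \<delta> by auto
  qed
  have Fm [measurable]: "Fh \<gamma> \<in> borel_measurable M" if "\<gamma> \<in> ?G" for \<gamma>
    using fhat_measurable[OF n] G that unfolding Fh_def by (cases \<gamma>) fastforce
  have Um [measurable]: "U \<gamma> \<in> borel_measurable M" if "\<gamma> \<in> ?G" for \<gamma>
    using Uhat_measurable[OF n] G that unfolding U_def by (cases \<gamma>) fastforce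
  have U0: "0 \<le> U \<gamma> \<omega>" if "\<gamma> \<in> ?G" for \<gamma> \<omega>
  proof (cases \<gamma>)
    case (Pair k h)
    then show ?thesis using Uhat_nonneg[OF n, of h k \<delta>] G[of k h] that \<delta> by (auto simp: U_def)
  qed
  have Usq: "integrable M (\<lambda>\<omega>. (U \<gamma> \<omega>)\<^sup>2)" if "\<gamma> \<in> ?G" for \<gamma>
  proof (cases \<gamma>)
    case (Pair k h)
    then show ?thesis using Uhat_square_integrable[OF n, of h k \<delta>] G[of k h] that \<delta> by (auto simp: U_def)
  qed
  have devsq: "integrable M (\<lambda>\<omega>. (\<bar>Fh \<gamma> \<omega> - E \<gamma>\<bar>)\<^sup>2)" if "\<gamma> \<in> ?G" for \<gamma>
  proof (cases \<gamma>)
    case (Pair k h)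
    then show ?thesis
      using deviation_square_integrable[OF n, of h k] G[of k h] that by (auto simp: Fh_def[abs_def] E_def)
  qed
  have exm [measurable]: "ex \<gamma> \<in> borel_measurable M" if "\<gamma> \<in> ?G" for \<gamma>
    using Fm[OF that] Um[OF that] unfolding ex_def by measurable
  have exsq: "integrable M (\<lambda>\<omega>. (ex \<gamma> \<omega>)\<^sup>2)" if \<gamma>: "\<gamma> \<in> ?G" for \<gamma>
  proof (rule Bochner_Integration.integrable_bound[OF devsq[OF \<gamma>]])
    have "(ex \<gamma> \<omega>)\<^sup>2 \<le> \<bar>Fh \<gamma> \<omega> - E \<gamma>\<bar>\<^sup>2" for \<omega>
      using U0[OF \<gamma>, of \<omega>] unfolding ex_def by (intro power_mono) auto
    then show "AE \<omega> in M. norm ((ex \<gamma> \<omega>)\<^sup>2) \<le> norm (\<bar>Fh \<gamma> \<omega> - E \<gamma>\<bar>\<^sup>2)"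
      by (intro AE_I2) simp
  qed (use exm[OF \<gamma>] in measurable)
  have Z2: "(Z \<omega>)\<^sup>2 = (\<Sum>\<gamma>'\<in>?G. (ex \<gamma>' \<omega>)\<^sup>2)" for \<omega>
    unfolding Z_def by (intro real_sqrt_pow2 sum_nonneg) simp
  have Zm [measurable]: "Z \<in> borel_measurable M"
    unfolding Z_def using exm
    by (intro borel_measurable_sqrt[THEN measurable_compose_rev] borel_measurable_sum borel_measurable_power) auto
  have Zsq: "integrable M (\<lambda>\<omega>. (Z \<omega>)\<^sup>2)" unfolding Z2 using exsq by simp
  have LZ: "L2norm M Z = sqrt (\<Sum>\<gamma>'\<in>?G. expectation (\<lambda>\<omega>. (ex \<gamma>' \<omega>)\<^sup>2))"
    unfolding L2norm_def Z2 using exsq by simp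
  have ex_le: "ex \<gamma>' \<omega> \<le> Z \<omega>" if "\<gamma>' \<in> ?G" for \<gamma>' \<omega>
  proof -
    have "(ex \<gamma>' \<omega>)\<^sup>2 \<le> (\<Sum>\<gamma>'\<in>?G. (ex \<gamma>' \<omega>)\<^sup>2)"
      using finite_Gam that by (intro member_le_sum) auto
    then show ?thesis unfolding Z_def by (rule real_le_rsqrt)
  qed
  have point: "\<bar>Fh (g \<omega>) \<omega> - f t\<bar> \<le> 5 * B + (\<bar>Fh \<gamma> \<omega> - E \<gamma>\<bar> + (2 * U \<gamma> \<omega> + 4 * Z \<omega>))"
    if \<omega>: "\<omega> \<in> space M" for \<omega>
  proof -
    have gG: "g \<omega> \<in> ?G" and min: "crit D t \<rho> \<delta> m n (\<lambda>i. X i \<omega>) (g \<omega>) \<le> crit D t \<rho> \<delta> m n (\<lambda>i. X i \<omega>) \<gamma>"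
      using g[OF \<omega>] \<gamma> unfolding is_arg_min_def by (blast, metis not_less)
    have "\<bar>Fh (g \<omega>) \<omega> - f t\<bar> \<le> 5 * B + \<bar>Fh \<gamma> \<omega> - E \<gamma>\<bar> + 2 * U \<gamma> \<omega> + 4 * Z \<omega>"
    proof (rule pairwise_selection_oracle[where F = "\<lambda>\<gamma>. Fh \<gamma> \<omega>" and U = "\<lambda>\<gamma>. U \<gamma> \<omega>" and G = ?G])
      show "\<bar>Fh \<gamma>' \<omega> - E \<gamma>'\<bar> \<le> U \<gamma>' \<omega> + Z \<omega>" if "\<gamma>' \<in> ?G" for \<gamma>'
        using ex_le[OF that, of \<omega>] by (simp add: ex_def)
      show "\<bar>E \<gamma>' - f t\<bar> \<le> B" if "\<gamma>' \<in> ?G" "gle \<gamma>' \<gamma>" for \<gamma>'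
        unfolding B_def bias_maj_def E_def Fh_def using that by (intro Max_ge) (auto simp: finite_Gam)
      show "0 \<le> Z \<omega>" unfolding Z_def by (intro real_sqrt_ge_zero sum_nonneg) simp
    qed (use finite_Gam \<gamma> inj_on_snd_Gam[OF \<rho>(1)] U0 gG min in
        \<open>auto simp: crit_def Ahat_def Fh_def U_def\<close>)
    then show ?thesis by simp
  qed
  have Ld: "L2norm M (\<lambda>\<omega>. \<bar>Fh \<gamma> \<omega> - E \<gamma>\<bar>) \<le> Ustar f D t \<rho> \<delta> n \<gamma>"
  proof (cases \<gamma>)
    case (Pair k h)
    then show ?thesis using L2norm_deviation_le[OF n, of h k \<delta>] G[of k h] \<gamma> by (auto simp: Fh_def[abs_def] E_def)
  qed
  have LU: "L2norm M (U \<gamma>) \<le> (1 + sqrt ((\<delta> - 1) / fnorm D t \<rho> f)) * Ustar f D t \<rho> \<delta> n \<gamma>"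
  proof (cases \<gamma>)
    case (Pair k h)
    then show ?thesis using L2norm_Uhat_le[OF n, of h k \<delta>] G[of k h] \<gamma> F \<delta> by (auto simp: U_def[abs_def])
  qed
  have B0: "0 \<le> B"
  proof -
    have "\<bar>E \<gamma> - f t\<bar> \<le> B"
      unfolding B_def bias_maj_def E_def Fh_def using \<gamma>
      by (intro Max_ge) (auto simp: gle_def finite_Gam)
    then show ?thesis by linarith
  qed
  note m\<gamma> [measurable] = Fm[OF \<gamma>] Um[OF \<gamma>]
  have s1: "integrable M (\<lambda>\<omega>. (2 * U \<gamma> \<omega>)\<^sup>2)" "integrable M (\<lambda>\<omega>. (4 * Z \<omega>)\<^sup>2)"
    using Usq[OF \<gamma>] Zsq by (simp_all add: power_mult_distrib)
  have s2: "integrable M (\<lambda>\<omega>. (2 * U \<gamma> \<omega> + 4 * Z \<omega>)\<^sup>2)"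
    by (rule square_add_integrable[OF _ _ s1]) measurable
  have s3: "integrable M (\<lambda>\<omega>. (\<bar>Fh \<gamma> \<omega> - E \<gamma>\<bar> + (2 * U \<gamma> \<omega> + 4 * Z \<omega>))\<^sup>2)"
    by (rule square_add_integrable[OF _ _ devsq[OF \<gamma>] s2]) measurable
  have s4: "integrable M (\<lambda>\<omega>. (5 * B + (\<bar>Fh \<gamma> \<omega> - E \<gamma>\<bar> + (2 * U \<gamma> \<omega> + 4 * Z \<omega>)))\<^sup>2)"
    by (rule square_add_integrable[OF _ _ _ s3]) simp_all
  have "risk M (\<lambda>\<omega>. fhat D t n (\<lambda>i. X i \<omega>) (g \<omega>)) (f t) = L2norm M (\<lambda>\<omega>. Fh (g \<omega>) \<omega> - f t)"
    by (simp add: risk_def L2norm_def Fh_def)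
  also have "\<dots> \<le> L2norm M (\<lambda>\<omega>. 5 * B + (\<bar>Fh \<gamma> \<omega> - E \<gamma>\<bar> + (2 * U \<gamma> \<omega> + 4 * Z \<omega>)))"
    using s4 point by (rule L2norm_mono)
  also have "\<dots> \<le> L2norm M (\<lambda>_. 5 * B) + L2norm M (\<lambda>\<omega>. \<bar>Fh \<gamma> \<omega> - E \<gamma>\<bar> + (2 * U \<gamma> \<omega> + 4 * Z \<omega>))"
    using s3 by (intro L2norm_add_le) auto
  also have "\<dots> \<le> L2norm M (\<lambda>_. 5 * B) + (L2norm M (\<lambda>\<omega>. \<bar>Fh \<gamma> \<omega> - E \<gamma>\<bar>)
      + L2norm M (\<lambda>\<omega>. 2 * U \<gamma> \<omega> + 4 * Z \<omega>))"
    using devsq[OF \<gamma>] s2 by (intro add_left_mono L2norm_add_le)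
  also have "\<dots> \<le> L2norm M (\<lambda>_. 5 * B) + (L2norm M (\<lambda>\<omega>. \<bar>Fh \<gamma> \<omega> - E \<gamma>\<bar>)
      + (L2norm M (\<lambda>\<omega>. 2 * U \<gamma> \<omega>) + L2norm M (\<lambda>\<omega>. 4 * Z \<omega>)))"
    using s1 by (intro add_left_mono L2norm_add_le)
  also have "\<dots> = 5 * B + L2norm M (\<lambda>\<omega>. \<bar>Fh \<gamma> \<omega> - E \<gamma>\<bar>) + 2 * L2norm M (U \<gamma>) + 4 * L2norm M Z"
    using B0 by (simp add: L2norm_const L2norm_cmult)
  also have "\<dots> \<le> 5 * B + (3 + 2 * sqrt ((\<delta> - 1) / fnorm D t \<rho> f)) * Ustar f D t \<rho> \<delta> n \<gamma> + 4 * L2norm M Z"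
    using Ld LU by (simp add: algebra_simps)
  finally show ?thesis unfolding LZ B_def ex_def Fh_def U_def E_def .
qed

section \<open>Size of the remainder\<close>

text \<open>
  The two parts of the penalty compensate the factors \<open>h ^ d\<close> and \<open>\<lambda>\<^sup>2\<close> in the denominators of the
  variance terms; what is left is summable over the levels because \<open>\<delta> > 1\<close>.
\<close>

lemma exp_minus_pen_le:
  fixes D :: "'d::{finite,linorder} rvec set" and k l :: nat
  assumes \<rho>: "0 < \<rho>" "\<rho> \<le> exp (- 1)" and \<delta>: "1 \<le> \<delta>"
  defines "h \<equiv> bandwidth \<rho> l"
  assumes lam: "0 < lam D t (k, h)"
  shows "exp (- pen D t \<delta> (k, h)) \<le> h ^ CARD('d) * (lam D t (k, h))\<^sup>2 * exp (- (\<delta> - 1)) ^ l"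
proof -
  let ?d = "real CARD('d)" and ?l = "lam D t (k, h)"
  have h: "0 < h" using \<rho> by (simp add: h_def bandwidth_pos)
  have d: "1 \<le> ?d" by (simp add: Suc_leI)
  have "ln \<rho> \<le> 0" using \<rho> by (smt (verit) exp_le_one_iff ln_le_zero_iff)
  then have lnh: "\<bar>ln h\<bar> = - ln h" "real l \<le> - ln h" by (auto simp: h_def ln_bandwidth[OF \<rho>(1)])
  have "1 * ((\<delta> - 1) * real l) \<le> ?d * ((\<delta> - 1) * (- ln h))"
    using d \<delta> lnh(2) by (intro mult_mono mult_left_mono) auto
  \<comment> \<open>This inequality holds for either sign of \<open>ln \<lambda>\<close>.\<close>
  then have "- pen D t \<delta> (k, h) \<le> ?d * ln h + 2 * ln ?l + real l * (- (\<delta> - 1))"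
    unfolding pen_def Lampar_def prod.case lnh(1) using abs_ge_minus_self[of "ln ?l"]
    by (simp add: algebra_simps)
  then have "exp (- pen D t \<delta> (k, h)) \<le> exp (?d * ln h + 2 * ln ?l + real l * (- (\<delta> - 1)))"
    by simp
  also have "\<dots> = exp (?d * ln h) * exp (2 * ln ?l) * exp (real l * (- (\<delta> - 1)))"
    by (simp only: exp_add)
  also have "exp (?d * ln h) = h ^ CARD('d)" using h by (simp add: exp_of_nat_mult)
  also have "exp (2 * ln ?l) = ?l\<^sup>2" using lam exp_of_nat_mult[of 2 "ln ?l"] by simp
  also have "exp (real l * (- (\<delta> - 1))) = exp (- (\<delta> - 1)) ^ l" by (rule exp_of_nat_mult)
  finally show ?thesis .
qed

text \<open>
  With \<open>k\<close> and \<open>l\<close> at most \<open>L = ln n\<close>, the sup bound of the kernel grows only like \<open>exp (O(L\<^sup>2))\<close>.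
\<close>

lemma square_cpar_le:
  fixes D :: "'d::{finite,linorder} rvec set" and k l :: nat
  assumes n: "0 < n" and \<rho>: "0 < \<rho>" "\<rho> \<le> exp (- 1)" and b: "0 \<le> b"
  defines "h \<equiv> bandwidth \<rho> l"
  assumes lam: "1 \<le> (h ^ k) powr (- b) * lam D t (k, h)"
    and L: "real l \<le> L" "real k \<le> L"
  shows "(real n * cpar D t n (k, h))\<^sup>2 \<le> real (Dm TYPE('d) k)
    * exp (2 * real CARD('d) * (L - ln \<rho>) + 2 * b * L * (L - ln \<rho>))"
proof -
  let ?l = "lam D t (k, h)" and ?d = "real CARD('d)"
  have h: "0 < h" using \<rho> by (simp add: h_def bandwidth_pos)
  have "ln \<rho> \<le> 0" using \<rho> by (smt (verit) exp_le_one_iff ln_le_zero_iff)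
  then have lnh: "- ln h \<le> L - ln \<rho>" "0 \<le> L - ln \<rho>" "0 \<le> - ln h"
    using L by (auto simp: h_def ln_bandwidth[OF \<rho>(1)])
  have hb: "(h ^ k) powr b = exp (b * (real k * ln h))"
    using h by (simp add: powr_def ln_realpow)
  have lp: "(h ^ k) powr b \<le> ?l"
  proof -
    have "(h ^ k) powr b * 1 \<le> (h ^ k) powr b * ((h ^ k) powr (- b) * ?l)"
      using lam by (intro mult_left_mono) auto
    also have "\<dots> = ?l" using h by (simp add: powr_minus)
    finally show ?thesis by simp
  qed
  have "real k * - ln h \<le> L * (L - ln \<rho>)" using lnh L by (intro mult_mono) auto
  then have "b * (real k * - ln h) \<le> b * (L * (L - ln \<rho>))" using b by (rule mult_left_mono)
  then have "exp (- (b * (L * (L - ln \<rho>)))) \<le> (h ^ k) powr b" unfolding hb by simp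
  then have l1: "exp (- (b * (L * (L - ln \<rho>)))) \<le> ?l" using lp by linarith
  have lpos: "0 < ?l" using l1 by (meson exp_gt_zero less_le_trans)
  have "?d * - ln h \<le> ?d * (L - ln \<rho>)" using lnh by (intro mult_left_mono) auto
  then have h1: "exp (- (?d * (L - ln \<rho>))) \<le> h ^ CARD('d)"
  proof -
    have "exp (?d * ln h) = h ^ CARD('d)" using h by (simp add: exp_of_nat_mult)
    moreover have "- (?d * (L - ln \<rho>)) \<le> ?d * ln h"
      using \<open>?d * - ln h \<le> ?d * (L - ln \<rho>)\<close> by simp
    ultimately show ?thesis by (metis exp_le_cancel_iff)
  qed
  have "exp (- (?d * (L - ln \<rho>))) * exp (- (b * (L * (L - ln \<rho>)))) \<le> h ^ CARD('d) * ?l"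
    using h1 l1 h by (intro mult_mono) auto
  then have low: "exp (- (?d * (L - ln \<rho>)) - b * (L * (L - ln \<rho>))) \<le> h ^ CARD('d) * ?l"
    by (simp add: exp_diff exp_minus divide_inverse)
  have "(real n * cpar D t n (k, h))\<^sup>2 = real (Dm TYPE('d) k) * (1 / (h ^ CARD('d) * ?l))\<^sup>2"
    using n by (simp add: cpar_def power_mult_distrib power_divide)
  also have "\<dots> \<le> real (Dm TYPE('d) k) * (1 / exp (- (?d * (L - ln \<rho>)) - b * (L * (L - ln \<rho>))))\<^sup>2"
    using low h lpos by (intro mult_left_mono power_mono divide_left_mono) auto
  also have "(1 / exp (- (?d * (L - ln \<rho>)) - b * (L * (L - ln \<rho>))))\<^sup>2
      = exp (2 * ?d * (L - ln \<rho>) + 2 * b * L * (L - ln \<rho>))"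
    by (simp add: power_divide algebra_simps flip: exp_minus inverse_eq_divide exp_double)
  finally show ?thesis .
qed

lemma Dm_le_power:
  assumes "real k \<le> L" "1 \<le> L"
  shows "real (Dm TYPE('d::finite) k) \<le> (2 * L) ^ CARD('d)"
proof -
  have "real (Dm TYPE('d) k) \<le> real ((k + 1) ^ CARD('d))" using Dm_le by (rule of_nat_mono)
  also have "\<dots> = (real k + 1) ^ CARD('d)" by (simp add: add.commute)
  also have "\<dots> \<le> (2 * L) ^ CARD('d)" using assms by (intro power_mono) auto
  finally show ?thesis .
qed

lemma (in bounded_density_sample) level_variance_le:
  fixes k l :: nat
  assumes n: "0 < n" and \<rho>: "0 < \<rho>" "\<rho> \<le> exp (- 1)" and \<delta>: "1 \<le> \<delta>"
  defines "h \<equiv> bandwidth \<rho> l"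
  assumes lam: "0 < lam D t (k, h)"
    and L: "real k \<le> L" "1 \<le> L" "1 \<le> real n * h ^ CARD('d) * Wh D t h"
    and F: "0 < fnorm D t \<rho> f"
  shows "(vstar f D t \<rho> n (k, h) + epspar D t \<delta> n (k, h) + 2 * (cpar D t n (k, h))\<^sup>2)
      * exp (- pen D t \<delta> (k, h))
    \<le> 4 ^ CARD('d) * (fnorm D t \<rho> f + \<delta> + 1) * (L ^ CARD('d) / real n) * exp (- (\<delta> - 1)) ^ l"
proof -
  let ?l = "lam D t (k, h)" and ?N = "real (Dm TYPE('d) k)" and ?W = "Wh D t h"
    and ?F = "fnorm D t \<rho> f" and ?q = "exp (- (\<delta> - 1)) ^ l"
  define p where "p = h ^ CARD('d)"
  have h: "0 < h" "h \<le> \<rho>" using \<rho> by (simp_all add: h_def bandwidth_pos bandwidth_le)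
  have p: "0 < p" using h by (simp add: p_def)
  have W: "0 \<le> ?W" "?W \<le> 2 ^ CARD('d)"
    using Wh_nonneg[OF closed_D h(1)] Wh_le[OF closed_D h(1)] by auto
  have np: "1 / (real n * p) \<le> 2 ^ CARD('d)"
  proof -
    have "1 / (real n * p) \<le> ?W" using L(3) n p by (simp add: p_def divide_le_eq mult.commute)
    then show ?thesis using W by linarith
  qed
  have "(vstar f D t \<rho> n (k, h) + epspar D t \<delta> n (k, h) + 2 * (cpar D t n (k, h))\<^sup>2)
      * exp (- pen D t \<delta> (k, h))
      \<le> (vstar f D t \<rho> n (k, h) + epspar D t \<delta> n (k, h) + 2 * (cpar D t n (k, h))\<^sup>2)
        * (p * ?l\<^sup>2 * ?q)"
    using exp_minus_pen_le[OF \<rho> \<delta>, of D t k l] lam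
      vstar_nonneg[OF n h lam] epspar_nonneg[OF n h lam \<delta>]
    by (intro mult_left_mono add_nonneg_nonneg) (auto simp: h_def p_def)
  also have "\<dots> = ?N / real n * (?W * (?F + \<delta> - 1) + 2 * (1 / (real n * p))) * ?q"
    unfolding vstar_eq[OF n h lam] epspar_def cpar_def prod.case p_def[symmetric]
    using n p lam by (simp add: power_mult_distrib power_divide power2_eq_square field_simps)
  also have "\<dots> \<le> ?N / real n * (2 ^ CARD('d) * (?F + \<delta> - 1) + 2 * 2 ^ CARD('d)) * ?q"
    using W np F \<delta> by (intro mult_right_mono mult_left_mono add_mono) auto
  also have "\<dots> = 2 ^ CARD('d) * (?F + \<delta> + 1) * (?N / real n) * ?q"
    by (simp add: algebra_simps)
  also have "\<dots> \<le> 2 ^ CARD('d) * (?F + \<delta> + 1) * ((2 * L) ^ CARD('d) / real n) * ?q"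
    using Dm_le_power[OF L(1,2), where 'd = 'd] F \<delta>
    by (intro mult_right_mono mult_left_mono divide_right_mono) auto
  also have "2 ^ CARD('d) * (?F + \<delta> + 1) * ((2 * L) ^ CARD('d) / real n)
      = 4 ^ CARD('d) * (?F + \<delta> + 1) * (L ^ CARD('d) / real n)"
    by (simp add: power_mult_distrib flip: power_mult_distrib[of 2 2])
  finally show ?thesis .
qed

lemma one_le_ln_of_nat: "3 \<le> n \<Longrightarrow> 1 \<le> ln (real n)"
  using exp_le by (subst ln_ge_iff) auto

lemma card_levels_le:
  assumes "1 \<le> n"
  shows "real (card (levels D t \<rho> n)) \<le> ln (real n)"
proof -
  have "card (levels D t \<rho> n) \<le> card {1..nat \<lfloor>ln (real n)\<rfloor>}"
    by (intro card_mono) (auto simp: levels_def)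
  then have "real (card (levels D t \<rho> n)) \<le> real (nat \<lfloor>ln (real n)\<rfloor>)" by simp
  also have "\<dots> \<le> ln (real n)" using assms by (intro of_nat_floor) simp
  finally show ?thesis .
qed

text \<open>
  The assumption \<open>small\<close>, which holds for all large \<open>n\<close>, says that the exceptional events contribute less
  than the main term.
\<close>

lemma (in bounded_density_sample) sum_excess_le:
  assumes n: "3 \<le> n" and \<rho>: "0 < \<rho>" "\<rho> \<le> exp (- 1)" and \<delta>: "1 < \<delta>" and b: "0 \<le> b"
    and F: "0 < fnorm D t \<rho> f"
    and m: "\<forall>l\<ge>1. m l \<le> nat \<lfloor>ln (real n)\<rfloor>"
    and lam: "\<And>\<gamma>. \<gamma> \<in> Gam D t \<rho> m n \<Longrightarrow> 1 \<le> (snd \<gamma> ^ fst \<gamma>) powr (- b) * lam D t \<gamma>"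
  defines "L \<equiv> ln (real n)" and "q \<equiv> exp (- (\<delta> - 1))"
    and "\<kappa> \<equiv> (\<delta> - 1)\<^sup>2 / (8 * fnorm D t \<rho> f)"
  assumes small: "L * exp (L + 2 * real CARD('d) * (L - ln \<rho>) + 2 * b * L * (L - ln \<rho>) - \<kappa> * L ^ 3) \<le> 1"
  shows "(\<Sum>\<gamma>\<in>Gam D t \<rho> m n. expectation (\<lambda>\<omega>. (max 0 (\<bar>fhat D t n (\<lambda>i. X i \<omega>) \<gamma>
        - expectation (\<lambda>\<omega>. fhat D t n (\<lambda>i. X i \<omega>) \<gamma>)\<bar> - Uhat D t \<delta> n (\<lambda>i. X i \<omega>) \<gamma>))\<^sup>2))
    \<le> (4 * 4 ^ CARD('d) * (fnorm D t \<rho> f + \<delta> + 1) / (1 - q) + 4 * 2 ^ CARD('d))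
      * (L ^ CARD('d) / real n)"
    (is "(\<Sum>\<gamma>\<in>?G. ?ex \<gamma>) \<le> _")
proof -
  let ?F = "fnorm D t \<rho> f" and ?I = "levels D t \<rho> n"
  let ?A = "2 * real CARD('d) * (L - ln \<rho>) + 2 * b * L * (L - ln \<rho>)"
  define K where "K = 4 ^ CARD('d) * (?F + \<delta> + 1) * (L ^ CARD('d) / real n)"
  define S where "S = 4 * (2 * L) ^ CARD('d) * (exp ?A * exp (- (\<kappa> * L ^ 3)))"
  have n0: "0 < n" and L1: "1 \<le> L" using n one_le_ln_of_nat[of n] by (auto simp: L_def)
  have q: "0 < q" "q < 1" using \<delta> by (auto simp: q_def)
  have K0: "0 \<le> K" using F \<delta> L1 by (simp add: K_def)
  have S0: "0 \<le> S" using L1 by (simp add: S_def)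
  have level: "?ex (m l, bandwidth \<rho> l) \<le> 4 * K * q ^ l + S" if l: "l \<in> ?I" for l
  proof -
    let ?h = "bandwidth \<rho> l" and ?k = "m l"
    have lI: "1 \<le> l" "l \<le> nat \<lfloor>L\<rfloor>" "L ^ 3 \<le> real n * ?h ^ CARD('d) * Wh D t ?h"
      using l by (auto simp: levels_def L_def)
    have lL: "real l \<le> L" using lI(2) L1 by linarith
    have kL: "real ?k \<le> L" using m lI(1) L1 unfolding L_def by (smt (verit) le_nat_floor nat_floor_neg of_nat_0_le_iff of_nat_floor of_nat_mono)
    have h: "0 < ?h" "?h \<le> \<rho>" using \<rho> by (simp_all add: bandwidth_pos bandwidth_le)
    have "(m l, ?h) \<in> ?G" using l by (auto simp: Gam_def)
    from lam[OF this] have lb: "1 \<le> (?h ^ ?k) powr (- b) * lam D t (?k, ?h)" by simp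
    then have lp: "0 < lam D t (?k, ?h)"
      using powr_ge_zero[of "?h ^ ?k" "- b"] by (smt (verit) mult_nonneg_nonpos)
    have x: "1 \<le> pen D t \<delta> (?k, ?h)" using h \<rho> \<delta> by (intro pen_ge_1) auto
    have "1 \<le> L ^ 3" using L1 by simp
    then have e1: "1 \<le> real n * ?h ^ CARD('d) * Wh D t ?h" using lI(3) by linarith
    have W: "0 < Wh D t ?h"
    proof -
      have "0 < real n * ?h ^ CARD('d)" using n0 h by simp
      then show ?thesis using e1 by (smt (verit) mult_nonneg_nonpos)
    qed
    have "?ex (?k, ?h) \<le> 4 * (vstar f D t \<rho> n (?k, ?h) + epspar D t \<delta> n (?k, ?h)
          + 2 * (cpar D t n (?k, ?h))\<^sup>2) * exp (- pen D t \<delta> (?k, ?h))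
        + 4 * (real n * cpar D t n (?k, ?h))\<^sup>2
          * exp (- (\<kappa> * (real n * ?h ^ CARD('d) * Wh D t ?h)))"
      unfolding \<kappa>_def by (rule expectation_excess_le[OF n0 h lp F \<delta> x W])
    also have "\<dots> \<le> 4 * (K * q ^ l) + S"
    proof (rule add_mono)
      show "4 * (vstar f D t \<rho> n (?k, ?h) + epspar D t \<delta> n (?k, ?h)
          + 2 * (cpar D t n (?k, ?h))\<^sup>2) * exp (- pen D t \<delta> (?k, ?h)) \<le> 4 * (K * q ^ l)"
        using level_variance_le[OF n0 \<rho> less_imp_le[OF \<delta>] lp kL L1 e1 F, folded K_def q_def]
        unfolding mult.assoc by linarith
      have "(real n * cpar D t n (?k, ?h))\<^sup>2 \<le> real (Dm TYPE('d) ?k) * exp ?A"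
        by (rule square_cpar_le[OF n0 \<rho> b lb lL kL])
      also have "\<dots> \<le> (2 * L) ^ CARD('d) * exp ?A"
        using Dm_le_power[OF kL L1, where 'd = 'd] by (intro mult_right_mono) auto
      finally have c: "(real n * cpar D t n (?k, ?h))\<^sup>2 \<le> (2 * L) ^ CARD('d) * exp ?A" .
      have "\<kappa> * L ^ 3 \<le> \<kappa> * (real n * ?h ^ CARD('d) * Wh D t ?h)"
        using lI(3) F by (intro mult_left_mono) (auto simp: \<kappa>_def)
      then have "4 * (real n * cpar D t n (?k, ?h))\<^sup>2
          * exp (- (\<kappa> * (real n * ?h ^ CARD('d) * Wh D t ?h)))
          \<le> 4 * ((2 * L) ^ CARD('d) * exp ?A) * exp (- (\<kappa> * L ^ 3))"
        using c L1 by (intro mult_mono) auto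
      then show "4 * (real n * cpar D t n (?k, ?h))\<^sup>2
          * exp (- (\<kappa> * (real n * ?h ^ CARD('d) * Wh D t ?h))) \<le> S"
        by (simp add: S_def mult.assoc)
    qed
    finally show ?thesis by simp
  qed
  have "(\<Sum>\<gamma>\<in>?G. ?ex \<gamma>) = (\<Sum>l\<in>?I. ?ex (m l, bandwidth \<rho> l))"
    unfolding Gam_def
    by (subst sum.reindex) (auto simp: inj_on_def bandwidth_eq_iff[OF \<rho>(1)])
  also have "\<dots> \<le> (\<Sum>l\<in>?I. 4 * K * q ^ l + S)" using level by (rule sum_mono)
  also have "\<dots> = 4 * K * (\<Sum>l\<in>?I. q ^ l) + real (card ?I) * S"
    by (simp add: sum.distrib sum_distrib_left)
  also have "\<dots> \<le> 4 * K * (1 / (1 - q)) + L * S"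
  proof (rule add_mono)
    have "(\<Sum>l\<in>?I. q ^ l) \<le> (\<Sum>l. q ^ l)"
      using q finite_levels by (intro sum_le_suminf summable_geometric) auto
    also have "\<dots> = 1 / (1 - q)" using q by (intro suminf_geometric) auto
    finally show "4 * K * (\<Sum>l\<in>?I. q ^ l) \<le> 4 * K * (1 / (1 - q))"
      using K0 by (intro mult_left_mono) auto
    show "real (card ?I) * S \<le> L * S"
      using card_levels_le[of n D t \<rho>] n0 S0 by (intro mult_right_mono) (auto simp: L_def)
  qed
  also have "L * S \<le> 4 * 2 ^ CARD('d) * (L ^ CARD('d) / real n)"
  proof -
    have nL: "exp (- L) = 1 / real n" using n0 by (simp add: L_def exp_minus inverse_eq_divide)
    have "exp ?A * exp (- (\<kappa> * L ^ 3)) = exp (L + ?A - \<kappa> * L ^ 3) * (1 / real n)"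
      unfolding nL[symmetric] exp_add[symmetric] by (simp add: algebra_simps)
    then have "L * S = 4 * 2 ^ CARD('d) * (L ^ CARD('d) / real n) * (L * exp (L + ?A - \<kappa> * L ^ 3))"
      by (simp add: S_def power_mult_distrib)
    also have "\<dots> \<le> 4 * 2 ^ CARD('d) * (L ^ CARD('d) / real n) * 1"
      using small L1 by (intro mult_left_mono) (auto simp: add.assoc)
    finally show ?thesis by simp
  qed
  finally have bound: "(\<Sum>\<gamma>\<in>?G. ?ex \<gamma>)
      \<le> 4 * K * (1 / (1 - q)) + 4 * 2 ^ CARD('d) * (L ^ CARD('d) / real n)"
    by simp
  have "4 * (u * v * x) * (1 / r) + c * x = (4 * u * v / r + c) * x" for u v x r c :: real
    by (simp add: distrib_right mult.assoc)
  then show ?thesis using bound unfolding K_def by metis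
qed

lemma (in bounded_density_sample) Ustar_Gam_nonneg:
  assumes n: "0 < n" and \<rho>: "0 < \<rho>" "\<rho> \<le> exp (- 1)" and \<delta>: "1 \<le> \<delta>"
    and lam: "0 < lam D t \<gamma>" and \<gamma>: "\<gamma> \<in> Gam D t \<rho> m n"
  shows "0 \<le> Ustar f D t \<rho> \<delta> n \<gamma>"
proof -
  obtain l where l: "\<gamma> = (m l, bandwidth \<rho> l)" using \<gamma> by (auto simp: Gam_def)
  have h: "0 < bandwidth \<rho> l" "bandwidth \<rho> l \<le> \<rho>"
    using \<rho> by (simp_all add: bandwidth_pos bandwidth_le)
  show ?thesis
    using Ustar_nonneg[OF n h, of "m l" \<delta>] lam pen_ge_1[of "bandwidth \<rho> l" \<delta> D t "m l"] h \<rho> \<delta>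
    by (simp add: l)
qed

lemma bias_maj_nonneg:
  assumes "\<gamma> \<in> Gam D t \<rho> m n"
  shows "0 \<le> bias_maj M X f D t \<rho> m n \<gamma>"
proof -
  have "\<bar>(\<integral>\<omega>. fhat D t n (\<lambda>i. X i \<omega>) \<gamma> \<partial>M) - f t\<bar> \<le> bias_maj M X f D t \<rho> m n \<gamma>"
    unfolding bias_maj_def using assms by (intro Max_ge) (auto simp: gle_def finite_Gam)
  then show ?thesis by linarith
qed

text \<open>
  By the Cauchy-Schwarz inequality \<open>(fhat)\<^sup>2 \<le> n * vhat\<close>, and \<open>vhat\<close> has mean \<open>0\<close>.
\<close>

lemma (in bounded_density_sample) risk_eq_0_if_fnorm_0:
  assumes n: "0 < n" and \<rho>: "0 < \<rho>" and t: "t \<in> D"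
    and lam: "\<And>\<gamma>. \<gamma> \<in> Gam D t \<rho> m n \<Longrightarrow> 0 < lam D t \<gamma>"
    and F: "fnorm D t \<rho> f = 0"
    and g: "\<And>\<omega>. \<omega> \<in> space M \<Longrightarrow> g \<omega> \<in> Gam D t \<rho> m n"
  shows "risk M (\<lambda>\<omega>. fhat D t n (\<lambda>i. X i \<omega>) (g \<omega>)) (f t) \<le> 0"
proof -
  let ?G = "Gam D t \<rho> m n" and ?V = "\<lambda>\<gamma> \<omega>. vhat D t n (\<lambda>i. X i \<omega>) \<gamma>"
  have "f (t + 0) \<le> fnorm D t \<rho> f"
    using \<rho> t by (intro density_le_fnorm) (simp add: nbhd_def infnorm_0)
  then have ft: "f t = 0" using F f_nonneg t by force
  have V: "integrable M (?V \<gamma>) \<and> expectation (?V \<gamma>) \<le> 0 \<and> (\<forall>\<omega>. 0 \<le> ?V \<gamma> \<omega>)" if \<gamma>: "\<gamma> \<in> ?G" for \<gamma>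
  proof -
    obtain l where l: "\<gamma> = (m l, bandwidth \<rho> l)" using \<gamma> by (auto simp: Gam_def)
    have h: "0 < bandwidth \<rho> l" "bandwidth \<rho> l \<le> \<rho>"
      using \<rho> by (simp_all add: bandwidth_pos bandwidth_le)
    have lp: "0 < lam D t (m l, bandwidth \<rho> l)" using lam[OF \<gamma>] l by simp
    show ?thesis
      using expectation_vhat[OF n h lp] second_moment_le[OF n h lp] vhat_nonneg[OF n h lp]
      by (simp add: l vstar_def F)
  qed
  have le: "(fhat D t n x \<gamma>)\<^sup>2 \<le> real n * vhat D t n x \<gamma>" for x \<gamma>
  proof -
    have "(\<Sum>i=1..n. lp_kernel D t \<gamma> (x i - t))\<^sup>2 \<le> real n * (\<Sum>i=1..n. (lp_kernel D t \<gamma> (x i - t))\<^sup>2)"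
      using sum_squared_le_sum_of_squares[of "\<lambda>i. lp_kernel D t \<gamma> (x i - t)" "{1..n}"]
      by (simp add: mult.commute)
    then show ?thesis
      using n by (simp add: fhat_def vhat_def power_divide divide_right_mono)
  qed
  have "(\<integral>\<omega>. (fhat D t n (\<lambda>i. X i \<omega>) (g \<omega>) - f t)\<^sup>2 \<partial>M) \<le> (\<integral>\<omega>. (\<Sum>\<gamma>\<in>?G. real n * ?V \<gamma> \<omega>) \<partial>M)"
  proof (rule integral_mono')
    show "integrable M (\<lambda>\<omega>. \<Sum>\<gamma>\<in>?G. real n * ?V \<gamma> \<omega>)" using V by auto
    show "0 \<le> (\<Sum>\<gamma>\<in>?G. real n * ?V \<gamma> \<omega>)" for \<omega> using V by (intro sum_nonneg) auto
    fix \<omega> assume "\<omega> \<in> space M"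
    then have "real n * ?V (g \<omega>) \<omega> \<le> (\<Sum>\<gamma>\<in>?G. real n * ?V \<gamma> \<omega>)"
      using V g by (intro member_le_sum) (auto simp: finite_Gam)
    then show "(fhat D t n (\<lambda>i. X i \<omega>) (g \<omega>) - f t)\<^sup>2 \<le> (\<Sum>\<gamma>\<in>?G. real n * ?V \<gamma> \<omega>)"
      using le[of "\<lambda>i. X i \<omega>" "g \<omega>"] by (simp add: ft)
  qed
  also have "\<dots> = (\<Sum>\<gamma>\<in>?G. real n * expectation (?V \<gamma>))" using V by simp
  also have "\<dots> \<le> 0" using V by (intro sum_nonpos mult_nonneg_nonpos) auto
  finally show ?thesis by (simp add: risk_def)
qed

lemma eventually_bad_event_negligible:
  fixes a b r \<kappa> :: real
  assumes "0 < \<kappa>"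
  shows "\<forall>\<^sub>F n in sequentially. ln (real n) * exp (ln (real n) + a * (ln (real n) - r)
    + b * ln (real n) * (ln (real n) - r) - \<kappa> * ln (real n) ^ 3) \<le> 1"
proof -
  have "((\<lambda>L. L * exp (L + a * (L - r) + b * L * (L - r) - \<kappa> * L ^ 3)) \<longlongrightarrow> 0) at_top"
    using assms by real_asymp
  then have "\<forall>\<^sub>F L in at_top. L * exp (L + a * (L - r) + b * L * (L - r) - \<kappa> * L ^ 3) < 1"
    by (rule order_tendstoD) simp
  moreover have "filterlim (\<lambda>n. ln (real n)) at_top sequentially" by real_asymp
  ultimately have "\<forall>\<^sub>F n in sequentially. ln (real n) * exp (ln (real n) + a * (ln (real n) - r)
      + b * ln (real n) * (ln (real n) - r) - \<kappa> * ln (real n) ^ 3) < 1"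
    by (rule eventually_compose_filterlim)
  then show ?thesis by eventually_elim simp
qed

lemma eventually_Gam_nonempty:
  fixes D :: "'d::finite rvec set" and m :: "nat \<Rightarrow> nat \<Rightarrow> nat"
  assumes S: "open S" "D = closure S" and t: "t \<in> D" and \<rho>: "0 < \<rho>"
  shows "\<forall>\<^sub>F n in sequentially. Gam D t \<rho> (m n) n \<noteq> {}"
proof -
  \<comment> \<open>For \<open>l = 1\<close> the defining inequality of the grid compares \<open>n * c\<close> with \<open>(log n)\<^sup>3\<close>.\<close>
  define c where "c = bandwidth \<rho> 1 ^ CARD('d) * Wh D t (bandwidth \<rho> 1)"
  have "0 < c"
    unfolding c_def using Wh_pos[OF S t] bandwidth_pos[OF \<rho>] by (intro mult_pos_pos) auto
  then have "filterlim (\<lambda>n. real n * c - ln (real n) ^ 3) at_top sequentially" by real_asymp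
  then have "\<forall>\<^sub>F n in sequentially. 0 \<le> real n * c - ln (real n) ^ 3"
    unfolding filterlim_at_top by blast
  then show ?thesis
    using eventually_ge_at_top[of 3]
  proof eventually_elim
    case (elim n)
    then have "1 \<le> ln (real n)" using one_le_ln_of_nat by simp
    then have "1 \<in> levels D t \<rho> n"
      using elim by (auto simp: levels_def c_def mult.assoc le_nat_iff le_floor_iff)
    then show ?case by (auto simp: Gam_def)
  qed
qed

section \<open>The oracle inequality\<close>

theorem theorem4p3:
  fixes D :: "'d::{finite,linorder} rvec set" and t :: "'d rvec"
    and \<rho> \<delta> b :: real
    and f :: "'d rvec \<Rightarrow> real"
    and M :: "'a measure" and X :: "nat \<Rightarrow> 'a \<Rightarrow> 'd rvec"
    and m :: "nat \<Rightarrow> nat \<Rightarrow> nat"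
    and gamhat :: "nat \<Rightarrow> 'a \<Rightarrow> nat \<times> real"
  assumes domain: "\<exists>S. open S \<and> S \<noteq> {} \<and> D = closure S"
    and t: "t \<in> D"
    and rho: "0 < \<rho>" "\<rho> \<le> exp (- 1)"
    and rho_nbhd: "\<exists>S. openin (top_of_set ((\<lambda>y. y - t) ` D)) S \<and> 0 \<in> S \<and> S \<subseteq> nbhd D t \<rho>"
    and delta: "1 < \<delta>"
    and prob: "prob_space M"
    and f_nonneg: "\<forall>y\<in>D. 0 \<le> f y"
    and X_density: "\<forall>i\<ge>1. distributed M lborel (X i) (\<lambda>y. ennreal (f y * indicator D y))"
    and X_indep: "prob_space.indep_vars M (\<lambda>_. borel) X {1..}"
    and m_range: "\<forall>n\<ge>1. \<forall>l\<ge>1. m n l \<le> nat \<lfloor>ln (real n)\<rfloor>"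
    and m_antimono: "\<forall>n\<ge>1. antimono_on {1..} (m n)"
    and gamhat_argmin: "\<forall>n. Gam D t \<rho> (m n) n \<noteq> {} \<longrightarrow> (\<forall>\<omega>\<in>space M.
          is_arg_min (crit D t \<rho> \<delta> (m n) n (\<lambda>i. X i \<omega>)) (\<lambda>\<gamma>. \<gamma> \<in> Gam D t \<rho> (m n) n) (gamhat n \<omega>))"
    and gamhat_measurable: "\<forall>n. Gam D t \<rho> (m n) n \<noteq> {} \<longrightarrow>
          gamhat n \<in> measurable M (count_space UNIV)"
    and f_bounded: "bdd_above ((\<lambda>u. \<bar>f (t + u)\<bar>) ` nbhd D t \<rho>)"
    and b: "0 < b"
    and domain_lam: "\<forall>n. Gam D t \<rho> (m n) n \<noteq> {} \<longrightarrow>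
          (MIN \<gamma>\<in>Gam D t \<rho> (m n) n. (snd \<gamma> ^ fst \<gamma>) powr (- b) * lam D t \<gamma>) \<ge> 1"
  shows "\<exists>e. e \<in> O(\<lambda>n. sqrt (ln (real n) ^ CARD('d) / real n)) \<and>
    (\<forall>\<^sub>F n in sequentially.
       risk M (\<lambda>\<omega>. fhat D t n (\<lambda>i. X i \<omega>) (gamhat n \<omega>)) (f t)
       \<le> (MIN \<gamma>\<in>Gam D t \<rho> (m n) n.
            5 * bias_maj M X f D t \<rho> (m n) n \<gamma>
            + (3 + 2 * sqrt ((\<delta> - 1) / fnorm D t \<rho> f)) * Ustar f D t \<rho> \<delta> n \<gamma>)
         + e n)"
proof -
  obtain S where S: "open S" "D = closure S" using domain by blast
  then have closed: "closed D" by simp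
  interpret prob_space M by (rule prob)
  interpret bounded_density_sample M D t \<rho> f X
    using closed f_nonneg X_density X_indep f_bounded by unfold_locales
  define F where "F = fnorm D t \<rho> f"
  define C where "C = 4 * 4 ^ CARD('d) * (F + \<delta> + 1) / (1 - exp (- (\<delta> - 1))) + 4 * 2 ^ CARD('d)"
  define e where "e n = 4 * sqrt C * sqrt (ln (real n) ^ CARD('d) / real n)" for n
  have zero_nbhd: "0 \<in> nbhd D t \<rho>" using t rho by (simp add: nbhd_def infnorm_0)
  have F0: "0 \<le> F"
    unfolding F_def fnorm_def using zero_nbhd by (intro cSUP_upper2[OF f_bounded]) auto
  have C0: "0 \<le> C"
    using F0 delta by (auto simp: C_def intro!: add_nonneg_nonneg divide_nonneg_pos mult_nonneg_nonneg)
  have key: "risk M (\<lambda>\<omega>. fhat D t n (\<lambda>i. X i \<omega>) (gamhat n \<omega>)) (f t)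
      \<le> (5 * bias_maj M X f D t \<rho> (m n) n \<gamma>
        + (3 + 2 * sqrt ((\<delta> - 1) / F)) * Ustar f D t \<rho> \<delta> n \<gamma>) + e n"
    if n: "3 \<le> n" and \<gamma>: "\<gamma> \<in> Gam D t \<rho> (m n) n"
      and small: "0 < F \<Longrightarrow> ln (real n) * exp (ln (real n) + 2 * real CARD('d) * (ln (real n) - ln \<rho>)
        + 2 * b * ln (real n) * (ln (real n) - ln \<rho>) - (\<delta> - 1)\<^sup>2 / (8 * F) * ln (real n) ^ 3) \<le> 1"
    for n \<gamma>
  proof -
    let ?G = "Gam D t \<rho> (m n) n"
    have n0: "0 < n" "1 \<le> n" and ne: "?G \<noteq> {}" using n \<gamma> by auto
    have lamb: "1 \<le> (snd \<gamma> ^ fst \<gamma>) powr (- b) * lam D t \<gamma>" if "\<gamma> \<in> ?G" for \<gamma>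
    proof -
      have "(MIN \<gamma>\<in>?G. (snd \<gamma> ^ fst \<gamma>) powr (- b) * lam D t \<gamma>) \<le> (snd \<gamma> ^ fst \<gamma>) powr (- b) * lam D t \<gamma>"
        using that by (intro Min_le) (auto simp: finite_Gam)
      then show ?thesis using domain_lam ne by force
    qed
    have lamp: "0 < lam D t \<gamma>" if "\<gamma> \<in> ?G" for \<gamma>
      using lamb[OF that] powr_ge_zero[of "snd \<gamma> ^ fst \<gamma>" "- b"] by (smt (verit) mult_nonneg_nonpos)
    have arg: "is_arg_min (crit D t \<rho> \<delta> (m n) n (\<lambda>i. X i \<omega>)) (\<lambda>\<gamma>. \<gamma> \<in> ?G) (gamhat n \<omega>)"
      if "\<omega> \<in> space M" for \<omega>
      using gamhat_argmin ne that by blast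
    have e0: "0 \<le> e n" using C0 one_le_ln_of_nat[OF n] by (simp add: e_def)
    show ?thesis
    proof (cases "F = 0")
      case True
      have "risk M (\<lambda>\<omega>. fhat D t n (\<lambda>i. X i \<omega>) (gamhat n \<omega>)) (f t) \<le> 0"
        using arg True
        by (intro risk_eq_0_if_fnorm_0[OF n0(1) rho(1) t lamp]) (auto simp: F_def is_arg_min_def)
      moreover have "0 \<le> 5 * bias_maj M X f D t \<rho> (m n) n \<gamma>
          + (3 + 2 * sqrt ((\<delta> - 1) / F)) * Ustar f D t \<rho> \<delta> n \<gamma>"
        using bias_maj_nonneg[OF \<gamma>, of M X f] delta F0
          Ustar_Gam_nonneg[OF n0(1) rho less_imp_le[OF delta] lamp[OF \<gamma>] \<gamma>]
        by (intro add_nonneg_nonneg mult_nonneg_nonneg) auto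
      ultimately show ?thesis using e0 by linarith
    next
      case False
      then have Fp: "0 < F" using F0 by simp
      have m: "\<forall>l\<ge>1. m n l \<le> nat \<lfloor>ln (real n)\<rfloor>" using m_range n0 by blast
      have "risk M (\<lambda>\<omega>. fhat D t n (\<lambda>i. X i \<omega>) (gamhat n \<omega>)) (f t)
        \<le> (5 * bias_maj M X f D t \<rho> (m n) n \<gamma>
          + (3 + 2 * sqrt ((\<delta> - 1) / F)) * Ustar f D t \<rho> \<delta> n \<gamma>)
          + 4 * sqrt (\<Sum>\<gamma>'\<in>?G. expectation (\<lambda>\<omega>. (max 0 (\<bar>fhat D t n (\<lambda>i. X i \<omega>) \<gamma>'
            - expectation (\<lambda>\<omega>. fhat D t n (\<lambda>i. X i \<omega>) \<gamma>')\<bar> - Uhat D t \<delta> n (\<lambda>i. X i \<omega>) \<gamma>'))\<^sup>2))"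
        unfolding F_def by (rule risk_le_oracle[OF n0(1) rho delta lamp Fp[unfolded F_def] arg \<gamma>])
      also have "\<dots> \<le> (5 * bias_maj M X f D t \<rho> (m n) n \<gamma>
          + (3 + 2 * sqrt ((\<delta> - 1) / F)) * Ustar f D t \<rho> \<delta> n \<gamma>)
          + 4 * sqrt (C * (ln (real n) ^ CARD('d) / real n))"
        unfolding C_def F_def
        by (intro add_left_mono mult_left_mono real_sqrt_le_mono
            sum_excess_le[OF n rho delta less_imp_le[OF b] Fp[unfolded F_def] m lamb
              small[OF Fp, unfolded F_def]]) auto
      also have "4 * sqrt (C * (ln (real n) ^ CARD('d) / real n)) = e n"
        unfolding e_def by (simp only: real_sqrt_mult mult.assoc)
      finally show ?thesis .
    qed
  qed
  have ev: "\<forall>\<^sub>F n in sequentially. 0 < F \<longrightarrow>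
      ln (real n) * exp (ln (real n) + 2 * real CARD('d) * (ln (real n) - ln \<rho>)
        + 2 * b * ln (real n) * (ln (real n) - ln \<rho>) - (\<delta> - 1)\<^sup>2 / (8 * F) * ln (real n) ^ 3) \<le> 1"
  proof (cases "0 < F")
    case True
    then have "0 < (\<delta> - 1)\<^sup>2 / (8 * F)" using delta by simp
    from eventually_bad_event_negligible[OF this, of "2 * real CARD('d)" "ln \<rho>" "2 * b"]
    show ?thesis by simp
  qed simp
  have "\<forall>\<^sub>F n in sequentially. risk M (\<lambda>\<omega>. fhat D t n (\<lambda>i. X i \<omega>) (gamhat n \<omega>)) (f t)
      \<le> (MIN \<gamma>\<in>Gam D t \<rho> (m n) n. 5 * bias_maj M X f D t \<rho> (m n) n \<gamma>
        + (3 + 2 * sqrt ((\<delta> - 1) / F)) * Ustar f D t \<rho> \<delta> n \<gamma>) + e n"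
    using ev eventually_Gam_nonempty[OF S t rho(1), of m] eventually_ge_at_top[of 3]
  proof eventually_elim
    case (elim n)
    have "risk M (\<lambda>\<omega>. fhat D t n (\<lambda>i. X i \<omega>) (gamhat n \<omega>)) (f t) - e n
      \<le> (MIN \<gamma>\<in>Gam D t \<rho> (m n) n. 5 * bias_maj M X f D t \<rho> (m n) n \<gamma>
        + (3 + 2 * sqrt ((\<delta> - 1) / F)) * Ustar f D t \<rho> \<delta> n \<gamma>)"
    proof (rule Min.boundedI)
      fix y assume "y \<in> (\<lambda>\<gamma>. 5 * bias_maj M X f D t \<rho> (m n) n \<gamma>
        + (3 + 2 * sqrt ((\<delta> - 1) / F)) * Ustar f D t \<rho> \<delta> n \<gamma>) ` Gam D t \<rho> (m n) n"
      then obtain \<gamma> where \<gamma>: "\<gamma> \<in> Gam D t \<rho> (m n) n" and y: "y = 5 * bias_maj M X f D t \<rho> (m n) n \<gamma>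
        + (3 + 2 * sqrt ((\<delta> - 1) / F)) * Ustar f D t \<rho> \<delta> n \<gamma>" by blast
      show "risk M (\<lambda>\<omega>. fhat D t n (\<lambda>i. X i \<omega>) (gamhat n \<omega>)) (f t) - e n \<le> y"
        using key[OF elim(3) \<gamma>] elim(1) unfolding y by linarith
    qed (use elim in \<open>auto simp: finite_Gam\<close>)
    then show ?case by linarith
  qed
  moreover have "e \<in> O(\<lambda>n. sqrt (ln (real n) ^ CARD('d) / real n))"
    unfolding e_def by (intro landau_o.big.cmult_in_iff[THEN iffD2] bigoI[of _ "\<bar>4 * sqrt C\<bar>"])
      (auto simp: abs_mult)
  ultimately show ?thesis unfolding F_def by blast
qed

end
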